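(* The theory $\mathsf{RCA}_0$ proves that $\forall n\,\forall k\,\mathsf{RT}^n_k$ implies $\mathsf{ACA}_0'$.
   Context: $\mathsf{RCA}_0$ is the usual base system of Reverse Mathematics. $\mathsf{ACA}_0'$ is $\mathsf{RCA}_0$ together with $\forall n\,\forall X\,\exists Y\,(Y=X^{(n)})$, i.e. for every $n$ the $n$-th Turing jump of every set exists; "implies $\mathsf{ACA}_0'$" over $\mathsf{RCA}_0$ means implying this axiom. $\mathsf{RT}^n_k$ is the statement: for every colouring $C:[\mathbb{N}]^n\to\{0,\dots,k-1\}$ of the $n$-element subsets of $\mathbb{N}$ there is an infinite set $H\subseteq\mathbb{N}$ such that $C$ is constant on $[H]^n$. In $\forall n\,\forall k\,\mathsf{RT}^n_k$ the quantifiers over $n,k$ (positive integers) are internal to the theory. *)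

theory Defs
  imports Main
begin

section \<open>Two-sorted language of second-order arithmetic\<close>

text \<open>
  De Bruijn indices, with separate index spaces for number variables and set variables:
  \<open>Forall\<close> binds number index 0 and \<open>ForallS\<close> binds set index 0. The only set terms are variables,
  and equality is primitive for numbers only.
\<close>

datatype tm = Var nat | Zero | One | Add tm tm | Mult tm tm

datatype fm =
    Eq tm tm
  | Less tm tm
  | Mem tm nat
  | Fls
  | Imp fm fm
  | Forall fm
  | ForallS fm

definition Neg :: "fm \<Rightarrow> fm" where "Neg p = Imp p Fls"
definition And :: "fm \<Rightarrow> fm \<Rightarrow> fm" where "And p q = Neg (Imp p (Neg q))"
definition Or :: "fm \<Rightarrow> fm \<Rightarrow> fm" where "Or p q = Imp (Neg p) q"
definition Iff :: "fm \<Rightarrow> fm \<Rightarrow> fm" where "Iff p q = And (Imp p q) (Imp q p)"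
definition Exists :: "fm \<Rightarrow> fm" where "Exists p = Neg (Forall (Neg p))"
definition ExistsS :: "fm \<Rightarrow> fm" where "ExistsS p = Neg (ForallS (Neg p))"

primrec tsubst :: "(nat \<Rightarrow> tm) \<Rightarrow> tm \<Rightarrow> tm" where
  "tsubst f (Var i) = f i"
| "tsubst f Zero = Zero"
| "tsubst f One = One"
| "tsubst f (Add s t) = Add (tsubst f s) (tsubst f t)"
| "tsubst f (Mult s t) = Mult (tsubst f s) (tsubst f t)"

definition tlift :: "tm \<Rightarrow> tm" where
  "tlift = tsubst (\<lambda>i. Var (Suc i))"

primrec subst :: "(nat \<Rightarrow> tm) \<Rightarrow> (nat \<Rightarrow> nat) \<Rightarrow> fm \<Rightarrow> fm" where
  "subst f g (Eq s t) = Eq (tsubst f s) (tsubst f t)"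
| "subst f g (Less s t) = Less (tsubst f s) (tsubst f t)"
| "subst f g (Mem t X) = Mem (tsubst f t) (g X)"
| "subst f g Fls = Fls"
| "subst f g (Imp p q) = Imp (subst f g p) (subst f g q)"
| "subst f g (Forall p) = Forall (subst (case_nat (Var 0) (\<lambda>i. tlift (f i))) g p)"
| "subst f g (ForallS p) = ForallS (subst f (case_nat 0 (\<lambda>X. Suc (g X))) p)"

definition lift :: "fm \<Rightarrow> fm" where "lift = subst (\<lambda>i. Var (Suc i)) id"
definition liftS :: "fm \<Rightarrow> fm" where "liftS = subst Var Suc"
definition inst :: "tm \<Rightarrow> fm \<Rightarrow> fm" where "inst t = subst (case_nat t Var) id"
definition instS :: "nat \<Rightarrow> fm \<Rightarrow> fm" where "instS X = subst Var (case_nat X id)"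


section \<open>Provability\<close>

text \<open>
  A Hilbert calculus for classical two-sorted first-order logic with equality. Axioms in \<open>T\<close>
  may have free variables; by the rules \<open>Gen\<close> and \<open>GenS\<close> they stand for their universal
  closures.
\<close>

inductive proves :: "fm set \<Rightarrow> fm \<Rightarrow> bool" (infix "\<turnstile>" 50) for T :: "fm set" where
  Ax: "p \<in> T \<Longrightarrow> T \<turnstile> p"
| K: "T \<turnstile> Imp p (Imp q p)"
| S: "T \<turnstile> Imp (Imp p (Imp q r)) (Imp (Imp p q) (Imp p r))"
| DN: "T \<turnstile> Imp (Neg (Neg p)) p"
| MP: "T \<turnstile> Imp p q \<Longrightarrow> T \<turnstile> p \<Longrightarrow> T \<turnstile> q"
| ForallE: "T \<turnstile> Imp (Forall p) (inst t p)"
| ForallImp: "T \<turnstile> Imp (Forall (Imp p q)) (Imp (Forall p) (Forall q))"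
| ForallI: "T \<turnstile> Imp p (Forall (lift p))"
| Gen: "T \<turnstile> p \<Longrightarrow> T \<turnstile> Forall p"
| ForallSE: "T \<turnstile> Imp (ForallS p) (instS X p)"
| ForallSImp: "T \<turnstile> Imp (ForallS (Imp p q)) (Imp (ForallS p) (ForallS q))"
| ForallSI: "T \<turnstile> Imp p (ForallS (liftS p))"
| GenS: "T \<turnstile> p \<Longrightarrow> T \<turnstile> ForallS p"
| Refl: "T \<turnstile> Eq t t"
| Leibniz: "T \<turnstile> Imp (Eq s t) (Imp (inst s p) (inst t p))"


section \<open>Formulas with named bound variables\<close>

text \<open>
  To write concrete formulas with HOL-bound variables instead of indices, terms and formulas are
  represented as functions of the number \<open>d\<close> of number quantifiers and the number \<open>D\<close> of set
  quantifiers above them. A variable bound at depth \<open>d\<close> has index \<open>d' - Suc d\<close> when it occurs at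
  depth \<open>d'\<close>.
\<close>

type_synonym nterm = "nat \<Rightarrow> tm"
type_synonym sterm = "nat \<Rightarrow> nat"
type_synonym form = "nat \<Rightarrow> nat \<Rightarrow> fm"

definition fZero :: nterm ("\<^bold>0") where "\<^bold>0 = (\<lambda>d. Zero)"
definition fOne :: nterm ("\<^bold>1") where "\<^bold>1 = (\<lambda>d. One)"
definition fAdd :: "nterm \<Rightarrow> nterm \<Rightarrow> nterm" (infixl "\<^bold>+" 65) where
  "s \<^bold>+ t = (\<lambda>d. Add (s d) (t d))"
definition fMult :: "nterm \<Rightarrow> nterm \<Rightarrow> nterm" (infixl "\<^bold>*" 70) where
  "s \<^bold>* t = (\<lambda>d. Mult (s d) (t d))"

primrec num :: "nat \<Rightarrow> nterm" where
  "num 0 = \<^bold>0"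
| "num (Suc n) = num n \<^bold>+ \<^bold>1"

definition fEq :: "nterm \<Rightarrow> nterm \<Rightarrow> form" (infix "\<^bold>=" 50) where
  "(s \<^bold>= t) = (\<lambda>d D. Eq (s d) (t d))"
definition fLess :: "nterm \<Rightarrow> nterm \<Rightarrow> form" (infix "\<^bold><" 50) where
  "(s \<^bold>< t) = (\<lambda>d D. Less (s d) (t d))"
definition fMem :: "nterm \<Rightarrow> sterm \<Rightarrow> form" (infix "\<^bold>\<in>" 50) where
  "(t \<^bold>\<in> X) = (\<lambda>d D. Mem (t d) (X D))"
definition fNeg :: "form \<Rightarrow> form" ("\<^bold>\<not> _" [40] 40) where
  "(\<^bold>\<not> p) = (\<lambda>d D. Neg (p d D))"
definition fAnd :: "form \<Rightarrow> form \<Rightarrow> form" (infixr "\<^bold>\<and>" 35) where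
  "(p \<^bold>\<and> q) = (\<lambda>d D. And (p d D) (q d D))"
definition fOr :: "form \<Rightarrow> form \<Rightarrow> form" (infixr "\<^bold>\<or>" 30) where
  "(p \<^bold>\<or> q) = (\<lambda>d D. Or (p d D) (q d D))"
definition fImp :: "form \<Rightarrow> form \<Rightarrow> form" (infixr "\<^bold>\<longrightarrow>" 25) where
  "(p \<^bold>\<longrightarrow> q) = (\<lambda>d D. Imp (p d D) (q d D))"
definition fIff :: "form \<Rightarrow> form \<Rightarrow> form" (infixr "\<^bold>\<longleftrightarrow>" 25) where
  "(p \<^bold>\<longleftrightarrow> q) = (\<lambda>d D. Iff (p d D) (q d D))"
definition fAll :: "(nterm \<Rightarrow> form) \<Rightarrow> form" (binder "\<^bold>\<forall>" 10) where
  "fAll F = (\<lambda>d D. Forall (F (\<lambda>d'. Var (d' - Suc d)) (Suc d) D))"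
definition fEx :: "(nterm \<Rightarrow> form) \<Rightarrow> form" (binder "\<^bold>\<exists>" 10) where
  "fEx F = (\<lambda>d D. Exists (F (\<lambda>d'. Var (d' - Suc d)) (Suc d) D))"
definition fAllS :: "(sterm \<Rightarrow> form) \<Rightarrow> form" (binder "\<^bold>\<forall>\<^sub>S" 10) where
  "fAllS F = (\<lambda>d D. ForallS (F (\<lambda>D'. D' - Suc D) d (Suc D)))"
definition fExS :: "(sterm \<Rightarrow> form) \<Rightarrow> form" (binder "\<^bold>\<exists>\<^sub>S" 10) where
  "fExS F = (\<lambda>d D. ExistsS (F (\<lambda>D'. D' - Suc D) d (Suc D)))"

definition fBall :: "nterm \<Rightarrow> (nterm \<Rightarrow> form) \<Rightarrow> form" where
  "fBall t F = (\<^bold>\<forall>x. x \<^bold>< t \<^bold>\<longrightarrow> F x)"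
definition fBex :: "nterm \<Rightarrow> (nterm \<Rightarrow> form) \<Rightarrow> form" where
  "fBex t F = (\<^bold>\<exists>x. x \<^bold>< t \<^bold>\<and> F x)"

syntax
  "_fBall" :: "pttrn \<Rightarrow> nterm \<Rightarrow> form \<Rightarrow> form" ("(3\<^bold>\<forall>_\<^bold><_./ _)" [0, 51, 10] 10)
  "_fBex" :: "pttrn \<Rightarrow> nterm \<Rightarrow> form \<Rightarrow> form" ("(3\<^bold>\<exists>_\<^bold><_./ _)" [0, 51, 10] 10)
translations
  "\<^bold>\<forall>x\<^bold><t. P" == "CONST fBall t (\<lambda>x. P)"
  "\<^bold>\<exists>x\<^bold><t. P" == "CONST fBex t (\<lambda>x. P)"

definition sentence :: "form \<Rightarrow> fm" where "sentence p = p 0 0"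


section \<open>The theory $\mathsf{RCA}_0$\<close>

text \<open>In the bounded quantifiers the bound is lifted, so it does not contain the bound variable.\<close>

inductive Delta0 :: "fm \<Rightarrow> bool" where
  "Delta0 (Eq s t)"
| "Delta0 (Less s t)"
| "Delta0 (Mem t X)"
| "Delta0 Fls"
| "Delta0 p \<Longrightarrow> Delta0 q \<Longrightarrow> Delta0 (Imp p q)"
| "Delta0 p \<Longrightarrow> Delta0 (Forall (Imp (Less (Var 0) (tlift t)) p))"
| "Delta0 p \<Longrightarrow> Delta0 (Exists (And (Less (Var 0) (tlift t)) p))"

definition Sigma1 :: "fm \<Rightarrow> bool" where "Sigma1 p \<longleftrightarrow> (\<exists>q. Delta0 q \<and> p = Exists q)"
definition Pi1 :: "fm \<Rightarrow> bool" where "Pi1 p \<longleftrightarrow> (\<exists>q. Delta0 q \<and> p = Forall q)"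

definition basic_axioms :: "fm set" where
  "basic_axioms = sentence `
    {\<^bold>\<forall>m. \<^bold>\<not> m \<^bold>+ \<^bold>1 \<^bold>= \<^bold>0,
     \<^bold>\<forall>m n. m \<^bold>+ \<^bold>1 \<^bold>= n \<^bold>+ \<^bold>1 \<^bold>\<longrightarrow> m \<^bold>= n,
     \<^bold>\<forall>m. m \<^bold>+ \<^bold>0 \<^bold>= m,
     \<^bold>\<forall>m n. m \<^bold>+ (n \<^bold>+ \<^bold>1) \<^bold>= (m \<^bold>+ n) \<^bold>+ \<^bold>1,
     \<^bold>\<forall>m. m \<^bold>* \<^bold>0 \<^bold>= \<^bold>0,
     \<^bold>\<forall>m n. m \<^bold>* (n \<^bold>+ \<^bold>1) \<^bold>= (m \<^bold>* n) \<^bold>+ m,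
     \<^bold>\<forall>m. \<^bold>\<not> m \<^bold>< \<^bold>0,
     \<^bold>\<forall>m n. m \<^bold>< n \<^bold>+ \<^bold>1 \<^bold>\<longleftrightarrow> m \<^bold>< n \<^bold>\<or> m \<^bold>= n}"

text \<open>
  In the two schemes number index 0 of \<open>p\<close> and \<open>q\<close> is the distinguished variable; all other free
  variables are parameters. The lifting in comprehension makes the comprehended set not free in \<open>p\<close>.
\<close>

definition induction_axiom :: "fm \<Rightarrow> fm" where
  "induction_axiom p =
    Imp (And (inst Zero p)
             (Forall (Imp p (subst (case_nat (Add (Var 0) One) (\<lambda>i. Var (Suc i))) id p))))
        (Forall p)"

definition comprehension_axiom :: "fm \<Rightarrow> fm \<Rightarrow> fm" where
  "comprehension_axiom p q =
    Imp (Forall (Iff p q)) (ExistsS (Forall (Iff (Mem (Var 0) 0) (liftS p))))"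

definition RCA0 :: "fm set" where
  "RCA0 = basic_axioms
    \<union> {induction_axiom p | p. Sigma1 p}
    \<union> {comprehension_axiom p q | p q. Sigma1 p \<and> Pi1 q}"


section \<open>Ramsey's theorem with internal exponent and number of colours\<close>

definition pair :: "nterm \<Rightarrow> nterm \<Rightarrow> nterm" ("\<^bold>\<langle>_, _\<^bold>\<rangle>") where
  "\<^bold>\<langle>i, j\<^bold>\<rangle> = (i \<^bold>+ j) \<^bold>* (i \<^bold>+ j) \<^bold>+ i"

text \<open>
  A pair \<open>s\<close> of \<open>a\<close> and \<open>b\<close> codes sequences by Goedel's beta function: entry \<open>i\<close> is the remainder
  of \<open>a\<close> modulo \<open>b * (i + 1) + 1\<close>. Codes carry no length, and a sequence has many codes.
\<close>

definition entry :: "nterm \<Rightarrow> nterm \<Rightarrow> nterm \<Rightarrow> form" where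
  "entry s i v =
    (\<^bold>\<exists>a\<^bold><s \<^bold>+ \<^bold>1. \<^bold>\<exists>b\<^bold><s \<^bold>+ \<^bold>1. s \<^bold>= \<^bold>\<langle>a, b\<^bold>\<rangle> \<^bold>\<and> v \<^bold>< b \<^bold>* (i \<^bold>+ \<^bold>1) \<^bold>+ \<^bold>1 \<^bold>\<and>
      (\<^bold>\<exists>q\<^bold><a \<^bold>+ \<^bold>1. a \<^bold>= q \<^bold>* (b \<^bold>* (i \<^bold>+ \<^bold>1) \<^bold>+ \<^bold>1) \<^bold>+ v))"

text \<open>An $n$-element set is represented by the codes of its increasing enumeration.\<close>

definition nset :: "nterm \<Rightarrow> nterm \<Rightarrow> form" where
  "nset n s =
    ((\<^bold>\<forall>i\<^bold><n. \<^bold>\<exists>v\<^bold><s \<^bold>+ \<^bold>1. entry s i v) \<^bold>\<and>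
     (\<^bold>\<forall>i\<^bold><n. \<^bold>\<forall>j\<^bold><n. i \<^bold>< j \<^bold>\<longrightarrow>
        (\<^bold>\<exists>u\<^bold><s \<^bold>+ \<^bold>1. \<^bold>\<exists>v\<^bold><s \<^bold>+ \<^bold>1. entry s i u \<^bold>\<and> entry s j v \<^bold>\<and> u \<^bold>< v)))"

definition same_nset :: "nterm \<Rightarrow> nterm \<Rightarrow> nterm \<Rightarrow> form" where
  "same_nset n s t = (\<^bold>\<forall>i\<^bold><n. \<^bold>\<exists>v\<^bold><s \<^bold>+ \<^bold>1. entry s i v \<^bold>\<and> entry t i v)"

text \<open>
  \<open>C\<close> is the graph of a colouring with colours below \<open>k\<close>; different codes of the same \<open>n\<close>-element
  set receive the same colour.
\<close>

definition colouring :: "nterm \<Rightarrow> nterm \<Rightarrow> sterm \<Rightarrow> form" where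
  "colouring n k C =
    ((\<^bold>\<forall>s. nset n s \<^bold>\<longrightarrow> (\<^bold>\<exists>c\<^bold><k. \<^bold>\<langle>s, c\<^bold>\<rangle> \<^bold>\<in> C)) \<^bold>\<and>
     (\<^bold>\<forall>s t c d. nset n s \<^bold>\<and> nset n t \<^bold>\<and> same_nset n s t \<^bold>\<and>
        \<^bold>\<langle>s, c\<^bold>\<rangle> \<^bold>\<in> C \<^bold>\<and> \<^bold>\<langle>t, d\<^bold>\<rangle> \<^bold>\<in> C \<^bold>\<longrightarrow> c \<^bold>= d))"

definition infinite_set :: "sterm \<Rightarrow> form" where
  "infinite_set H = (\<^bold>\<forall>m. \<^bold>\<exists>x. m \<^bold>< x \<^bold>\<and> x \<^bold>\<in> H)"

definition nset_within :: "nterm \<Rightarrow> nterm \<Rightarrow> sterm \<Rightarrow> form" where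
  "nset_within n s H =
    (nset n s \<^bold>\<and> (\<^bold>\<forall>i\<^bold><n. \<^bold>\<exists>v\<^bold><s \<^bold>+ \<^bold>1. entry s i v \<^bold>\<and> v \<^bold>\<in> H))"

definition homogeneous :: "nterm \<Rightarrow> sterm \<Rightarrow> sterm \<Rightarrow> form" where
  "homogeneous n C H = (\<^bold>\<exists>c. \<^bold>\<forall>s. nset_within n s H \<^bold>\<longrightarrow> \<^bold>\<langle>s, c\<^bold>\<rangle> \<^bold>\<in> C)"

definition RT :: "nterm \<Rightarrow> nterm \<Rightarrow> form" where
  "RT n k =
    (\<^bold>\<forall>\<^sub>SC. colouring n k C \<^bold>\<longrightarrow> (\<^bold>\<exists>\<^sub>SH. infinite_set H \<^bold>\<and> homogeneous n C H))"

definition all_RT :: form where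
  "all_RT = (\<^bold>\<forall>n k. \<^bold>0 \<^bold>< n \<^bold>\<and> \<^bold>0 \<^bold>< k \<^bold>\<longrightarrow> RT n k)"


section \<open>Iterated Turing jumps\<close>

text \<open>\<open>(k, a, b)\<close> codes the finite set of all \<open>i < k\<close> such that \<open>b * (i + 1) + 1\<close> divides \<open>a\<close>.\<close>

definition in_finset :: "nterm \<Rightarrow> nterm \<Rightarrow> nterm \<Rightarrow> nterm \<Rightarrow> form" where
  "in_finset k a b i =
    (i \<^bold>< k \<^bold>\<and> (\<^bold>\<exists>q\<^bold><a \<^bold>+ \<^bold>1. a \<^bold>= q \<^bold>* (b \<^bold>* (i \<^bold>+ \<^bold>1) \<^bold>+ \<^bold>1)))"

text \<open>
  Indices of the partial functions recursive in \<open>X\<close>. These are generated from zero, successor,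
  identity, the two projections, sum, product, the characteristic function of \<open><\<close> and the one of
  \<open>X\<close> by pairing, composition and minimization; arguments are unary, with tuples formed by \<open>pair\<close>.
  (Primitive recursion is then derivable by the beta function.)
\<close>

definition fun_zero :: nterm where "fun_zero = \<^bold>\<langle>num 0, num 0\<^bold>\<rangle>"
definition fun_suc :: nterm where "fun_suc = \<^bold>\<langle>num 0, num 1\<^bold>\<rangle>"
definition fun_id :: nterm where "fun_id = \<^bold>\<langle>num 0, num 2\<^bold>\<rangle>"
definition fun_left :: nterm where "fun_left = \<^bold>\<langle>num 0, num 3\<^bold>\<rangle>"
definition fun_right :: nterm where "fun_right = \<^bold>\<langle>num 0, num 4\<^bold>\<rangle>"
definition fun_sum :: nterm where "fun_sum = \<^bold>\<langle>num 0, num 5\<^bold>\<rangle>"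
definition fun_prod :: nterm where "fun_prod = \<^bold>\<langle>num 0, num 6\<^bold>\<rangle>"
definition fun_less :: nterm where "fun_less = \<^bold>\<langle>num 0, num 7\<^bold>\<rangle>"
definition fun_oracle :: nterm where "fun_oracle = \<^bold>\<langle>num 0, num 8\<^bold>\<rangle>"
definition fun_pair :: "nterm \<Rightarrow> nterm \<Rightarrow> nterm" where "fun_pair f g = \<^bold>\<langle>num 1, \<^bold>\<langle>f, g\<^bold>\<rangle>\<^bold>\<rangle>"
definition fun_comp :: "nterm \<Rightarrow> nterm \<Rightarrow> nterm" where "fun_comp f g = \<^bold>\<langle>num 2, \<^bold>\<langle>f, g\<^bold>\<rangle>\<^bold>\<rangle>"
definition fun_mu :: "nterm \<Rightarrow> nterm" where "fun_mu f = \<^bold>\<langle>num 3, f\<^bold>\<rangle>"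

definition computed :: "nterm \<Rightarrow> nterm \<Rightarrow> nterm \<Rightarrow> nterm \<Rightarrow> nterm \<Rightarrow> nterm \<Rightarrow> form" where
  "computed k a b e x y = in_finset k a b \<^bold>\<langle>e, \<^bold>\<langle>x, y\<^bold>\<rangle>\<^bold>\<rangle>"

text \<open>
  \<open>justified X k a b e x y\<close>: the assertion that function \<open>e\<close> with oracle \<open>X\<close> maps \<open>x\<close> to \<open>y\<close>
  follows in one step from the assertions in the finite set coded by \<open>(k, a, b)\<close>. Bounding the
  quantifiers by \<open>k\<close> loses nothing, since a pair is at least as large as its components.
\<close>

definition justified ::
    "sterm \<Rightarrow> nterm \<Rightarrow> nterm \<Rightarrow> nterm \<Rightarrow> nterm \<Rightarrow> nterm \<Rightarrow> nterm \<Rightarrow> form" where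
  "justified X k a b e x y =
    (e \<^bold>= fun_zero \<^bold>\<and> y \<^bold>= \<^bold>0 \<^bold>\<or>
     e \<^bold>= fun_suc \<^bold>\<and> y \<^bold>= x \<^bold>+ \<^bold>1 \<^bold>\<or>
     e \<^bold>= fun_id \<^bold>\<and> y \<^bold>= x \<^bold>\<or>
     e \<^bold>= fun_left \<^bold>\<and> (\<^bold>\<exists>v\<^bold><k. x \<^bold>= \<^bold>\<langle>y, v\<^bold>\<rangle>) \<^bold>\<or>
     e \<^bold>= fun_right \<^bold>\<and> (\<^bold>\<exists>u\<^bold><k. x \<^bold>= \<^bold>\<langle>u, y\<^bold>\<rangle>) \<^bold>\<or>
     e \<^bold>= fun_sum \<^bold>\<and> (\<^bold>\<exists>u\<^bold><k. \<^bold>\<exists>v\<^bold><k. x \<^bold>= \<^bold>\<langle>u, v\<^bold>\<rangle> \<^bold>\<and> y \<^bold>= u \<^bold>+ v) \<^bold>\<or>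
     e \<^bold>= fun_prod \<^bold>\<and> (\<^bold>\<exists>u\<^bold><k. \<^bold>\<exists>v\<^bold><k. x \<^bold>= \<^bold>\<langle>u, v\<^bold>\<rangle> \<^bold>\<and> y \<^bold>= u \<^bold>* v) \<^bold>\<or>
     e \<^bold>= fun_less \<^bold>\<and> (\<^bold>\<exists>u\<^bold><k. \<^bold>\<exists>v\<^bold><k. x \<^bold>= \<^bold>\<langle>u, v\<^bold>\<rangle> \<^bold>\<and>
        (u \<^bold>< v \<^bold>\<and> y \<^bold>= \<^bold>1 \<^bold>\<or> \<^bold>\<not> u \<^bold>< v \<^bold>\<and> y \<^bold>= \<^bold>0)) \<^bold>\<or>
     e \<^bold>= fun_oracle \<^bold>\<and> (x \<^bold>\<in> X \<^bold>\<and> y \<^bold>= \<^bold>1 \<^bold>\<or> \<^bold>\<not> x \<^bold>\<in> X \<^bold>\<and> y \<^bold>= \<^bold>0) \<^bold>\<or>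
     (\<^bold>\<exists>f\<^bold><k. \<^bold>\<exists>g\<^bold><k. e \<^bold>= fun_pair f g \<^bold>\<and>
        (\<^bold>\<exists>u\<^bold><k. \<^bold>\<exists>v\<^bold><k. computed k a b f x u \<^bold>\<and> computed k a b g x v \<^bold>\<and> y \<^bold>= \<^bold>\<langle>u, v\<^bold>\<rangle>)) \<^bold>\<or>
     (\<^bold>\<exists>f\<^bold><k. \<^bold>\<exists>g\<^bold><k. e \<^bold>= fun_comp f g \<^bold>\<and>
        (\<^bold>\<exists>u\<^bold><k. computed k a b g x u \<^bold>\<and> computed k a b f u y)) \<^bold>\<or>
     (\<^bold>\<exists>f\<^bold><k. e \<^bold>= fun_mu f \<^bold>\<and> computed k a b f \<^bold>\<langle>x, y\<^bold>\<rangle> \<^bold>0 \<^bold>\<and>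
        (\<^bold>\<forall>z\<^bold><y. \<^bold>\<exists>v\<^bold><k. computed k a b f \<^bold>\<langle>x, z\<^bold>\<rangle> (v \<^bold>+ \<^bold>1))))"

text \<open>
  Derivations need no ordering of the finite set: every one-step justification of an assertion
  about \<open>e\<close> appeals only to assertions about smaller indices, so it cannot be circular.
\<close>

definition derivation :: "sterm \<Rightarrow> nterm \<Rightarrow> nterm \<Rightarrow> nterm \<Rightarrow> form" where
  "derivation X k a b =
    (\<^bold>\<forall>e\<^bold><k. \<^bold>\<forall>x\<^bold><k. \<^bold>\<forall>y\<^bold><k. computed k a b e x y \<^bold>\<longrightarrow> justified X k a b e x y)"

definition halts :: "sterm \<Rightarrow> nterm \<Rightarrow> nterm \<Rightarrow> form" where
  "halts X e x = (\<^bold>\<exists>k a b y. derivation X k a b \<^bold>\<and> computed k a b e x y)"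

definition is_jump :: "sterm \<Rightarrow> sterm \<Rightarrow> form" where
  "is_jump X Y = (\<^bold>\<forall>e. e \<^bold>\<in> Y \<^bold>\<longleftrightarrow> halts X e e)"

definition is_section :: "sterm \<Rightarrow> nterm \<Rightarrow> sterm \<Rightarrow> form" where
  "is_section Z i X = (\<^bold>\<forall>x. x \<^bold>\<in> X \<^bold>\<longleftrightarrow> \<^bold>\<langle>i, x\<^bold>\<rangle> \<^bold>\<in> Z)"

text \<open>\<open>is_iterated_jump n X Y\<close> says $Y = X^{(n)}$, with \<open>Z\<close> coding the sequence $X^{(0)},\dots,X^{(n)}$.\<close>

definition is_iterated_jump :: "nterm \<Rightarrow> sterm \<Rightarrow> sterm \<Rightarrow> form" where
  "is_iterated_jump n X Y =
    (\<^bold>\<exists>\<^sub>SZ. is_section Z \<^bold>0 X \<^bold>\<and> is_section Z n Y \<^bold>\<and>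
      (\<^bold>\<forall>i\<^bold><n. \<^bold>\<exists>\<^sub>SU. \<^bold>\<exists>\<^sub>SV. is_section Z i U \<^bold>\<and> is_section Z (i \<^bold>+ \<^bold>1) V \<^bold>\<and> is_jump U V))"

definition ACA0' :: form where
  "ACA0' = (\<^bold>\<forall>n. \<^bold>\<forall>\<^sub>SX. \<^bold>\<exists>\<^sub>SY. is_iterated_jump n X Y)"

end

theory Submission
  imports Defs "HOL-Library.Countable_Set"
begin

text \<open>
  By the completeness theorem it suffices to work in a model of \<open>RCA\<^sub>0\<close>. The jump of \<open>A\<close> consists of
  the \<open>e\<close> with \<open>\<exists>w. \<theta>(e, w, A)\<close>, where \<open>\<theta>\<close> is bounded, monotone in \<open>w\<close>, and depends only on the
  elements of \<open>A\<close> below \<open>w\<close>; no other property of computations matters. Stages \<open>s\<^sub>1 < \<dots> < s\<^sub>n\<close> define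
  approximations \<open>B\<^sub>n = X\<close> and \<open>B\<^sub>j = {e. \<theta>(e, s\<^sub>j\<^sub>+\<^sub>1, B\<^sub>j\<^sub>+\<^sub>1)}\<close> of \<open>X\<close> and its iterated jumps, with \<open>B\<^sub>j\<close>
  approximating the jump of order \<open>n - j\<close>. Below a number \<open>m\<close> all of them are described by a
  number, their pattern, that is bounded in terms of \<open>m\<close> and \<open>n\<close>.

  Colour \<open>m < s\<^sub>1 < \<dots> < s\<^sub>n < t\<^sub>1 < \<dots> < t\<^sub>n\<close> according to whether the pattern of \<open>s\<close> below \<open>m\<close> is equal
  to, greater than or less than that of \<open>t\<close>. On a homogeneous set \<open>H\<close> the patterns cannot decrease
  forever, and cannot increase forever because they are bounded; hence they agree. So below \<open>m \<in> H\<close>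
  the approximations do not depend on the stages chosen in \<open>H\<close> above \<open>m\<close>, and these common values,
  which are \<open>\<Delta>\<^sub>1\<close> in \<open>H\<close> and \<open>X\<close>, are the iterated jumps: if \<open>v = s\<^sub>j\<^sub>+\<^sub>1\<close> and the later stages are chosen far above
  \<open>v\<close>, then \<open>B\<^sub>j\<^sub>+\<^sub>1\<close> is correct below \<open>v\<close>, so \<open>B\<^sub>j\<close> correctly records halting before stage \<open>v\<close>, and \<open>v\<close>
  is arbitrarily large. Only \<open>\<Sigma>\<^sub>1\<close> induction and \<open>\<Delta>\<^sub>1\<close> comprehension are used, so \<open>n\<close> may be nonstandard.
\<close>

section \<open>Substitution\<close>

text \<open>For standard n one could form one jump after the other. For nonstandard n this breaks
  down: that the i-th jump exists is a statement with set quantifiers, for which no induction is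
  available. Hence one homogeneous set has to deliver all jumps at once, and this is what the
  exponent \<open>1 + n + n\<close> is for: a tuple holds a bound m and two choices of n stages.

  The stages are assigned backwards, the smallest to the highest jump. A computation of stage v
  consults its oracle only below v, and the oracle is approximated with larger stages, so it has
  settled there.

  With two colours, equal and different, a pigeonhole principle for definable sequences would be
  required. Splitting the second colour by direction leaves only a chain of blocks to be followed,
  which Sigma1 induction can do.

  Working in a model allows definability to be checked by introduction rules on HOL predicates. The
  price is that all arithmetic of the model, from commutativity of addition on, has to be derived by
  induction for predicates shown to be definable.\<close>

instance tm :: countable by countable_datatype
instance fm :: countable by countable_datatype

lemma tsubst_tsubst: "tsubst f (tsubst g t) = tsubst (\<lambda>i. tsubst f (g i)) t"
  by (induction t) auto

lemma tsubst_Var [simp]: "tsubst Var t = t"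
  by (induction t) auto

lemma case_nat_Var [simp]: "case_nat (Var 0) (\<lambda>i. tlift (Var i)) = Var"
  by (rule ext) (simp add: tlift_def split: nat.split)

lemma case_nat_Suc [simp]: "case_nat 0 Suc = (\<lambda>X. X)"
  by (rule ext) (simp split: nat.split)

lemma tsubst_up_tlift: "tsubst (case_nat a (\<lambda>i. tlift (f i))) (tlift t) = tlift (tsubst f t)"
  by (simp add: tlift_def tsubst_tsubst)

lemma subst_subst:
  "subst f g (subst f' g' p) = subst (\<lambda>i. tsubst f (f' i)) (\<lambda>X. g (g' X)) p"
proof (induction p arbitrary: f g f' g')
  case (Forall p)
  have "(\<lambda>i. tsubst (case_nat (Var 0) (\<lambda>i. tlift (f i))) (case_nat (Var 0) (\<lambda>i. tlift (f' i)) i)) =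
      case_nat (Var 0) (\<lambda>i. tlift (tsubst f (f' i)))"
    by (rule ext) (simp add: tsubst_up_tlift split: nat.split)
  then show ?case by (simp add: Forall)
next
  case (ForallS p)
  have "(\<lambda>X. case_nat 0 (\<lambda>X. Suc (g X)) (case_nat 0 (\<lambda>X. Suc (g' X)) X)) =
      case_nat 0 (\<lambda>X. Suc (g (g' X)))"
    by (rule ext) (simp split: nat.split)
  then show ?case by (simp add: ForallS)
qed (auto simp: tsubst_tsubst)

lemma subst_Var [simp]: "subst Var (\<lambda>X. X) p = p"
  by (induction p) auto

lemma subst_Var_id [simp]: "subst Var id p = p"
  using subst_Var by (simp add: id_def)

text \<open>Says that all variables of t have index below n, without collecting them: changing a
  substitution from n on has no effect.\<close>

definition tbelow :: "nat \<Rightarrow> tm \<Rightarrow> bool" where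
  "tbelow n t \<longleftrightarrow> (\<forall>f f'. (\<forall>i<n. f i = f' i) \<longrightarrow> tsubst f t = tsubst f' t)"

lemma tbelow_mono: "tbelow m t \<Longrightarrow> m \<le> n \<Longrightarrow> tbelow n t"
  unfolding tbelow_def by (meson order_less_le_trans)

lemma ex_tbelow: "\<exists>n. tbelow n t"
proof (induction t)
  case (Var x) then show ?case by (intro exI[of _ "Suc x"]) (simp add: tbelow_def)
next
  case (Add s t)
  then obtain m n where "tbelow m s" "tbelow n t" by blast
  then have "tbelow (m + n) s" "tbelow (m + n) t" by (auto elim: tbelow_mono)
  then show ?case unfolding tbelow_def by (metis tsubst.simps(4))
next
  case (Mult s t)
  then obtain m n where "tbelow m s" "tbelow n t" by blast
  then have "tbelow (m + n) s" "tbelow (m + n) t" by (auto elim: tbelow_mono)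
  then show ?case unfolding tbelow_def by (metis tsubst.simps(5))
qed (auto simp: tbelow_def)

definition below :: "nat \<Rightarrow> fm \<Rightarrow> bool" where
  "below n p \<longleftrightarrow> (\<forall>f f' g g'. (\<forall>i<n. f i = f' i \<and> g i = g' i) \<longrightarrow> subst f g p = subst f' g' p)"

lemma belowD: "below n p \<Longrightarrow> (\<And>i. i < n \<Longrightarrow> f i = f' i) \<Longrightarrow> (\<And>i. i < n \<Longrightarrow> g i = g' i) \<Longrightarrow>
    subst f g p = subst f' g' p"
  unfolding below_def by blast

lemma below_mono: "below m p \<Longrightarrow> m \<le> n \<Longrightarrow> below n p"
  unfolding below_def by (meson order_less_le_trans)

lemma ex_below: "\<exists>n. below n p"
proof (induction p)
  case (Eq s t)
  obtain m n where "tbelow m s" "tbelow n t" using ex_tbelow by meson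
  then have "tbelow (m + n) s" "tbelow (m + n) t" by (auto elim: tbelow_mono)
  then show ?case unfolding tbelow_def below_def by (metis subst.simps(1))
next
  case (Less s t)
  obtain m n where "tbelow m s" "tbelow n t" using ex_tbelow by meson
  then have "tbelow (m + n) s" "tbelow (m + n) t" by (auto elim: tbelow_mono)
  then show ?case unfolding tbelow_def below_def by (metis subst.simps(2))
next
  case (Mem t X)
  obtain n where "tbelow n t" using ex_tbelow by blast
  then have "tbelow (n + Suc X) t" by (auto elim: tbelow_mono)
  then have "below (n + Suc X) (Mem t X)" unfolding tbelow_def below_def by simp
  then show ?case ..
next
  case Fls then show ?case by (simp add: below_def)
next
  case (Imp p q)
  then obtain m n where "below m p" "below n q" by blast
  then have "below (m + n) p" "below (m + n) q" by (auto elim: below_mono)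
  then show ?case unfolding below_def by (metis subst.simps(5))
next
  case (Forall p)
  then obtain n where n: "below n p" by blast
  have "below n (Forall p)"
    unfolding below_def
    by (auto intro!: belowD[OF n] split: nat.split)
  then show ?case ..
next
  case (ForallS p)
  then obtain n where n: "below n p" by blast
  have "below n (ForallS p)"
    unfolding below_def
    by (auto intro!: belowD[OF n] split: nat.split)
  then show ?case ..
qed

text \<open>The action of f under m number quantifiers: the m bound variables stay, and the values
  of f are lifted past them.\<close>

definition upn :: "nat \<Rightarrow> (nat \<Rightarrow> tm) \<Rightarrow> nat \<Rightarrow> tm" where
  "upn m f i = (if i < m then Var i else tsubst (\<lambda>j. Var (j + m)) (f (i - m)))"

lemma up_upn: "case_nat (Var 0) (\<lambda>i. tlift (upn m f i)) = upn (Suc m) f"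
  by (rule ext) (auto simp: upn_def tlift_def tsubst_tsubst split: nat.split)

lemma subst_Foralls: "subst (upn k f) g ((Forall ^^ m) p) = (Forall ^^ m) (subst (upn (k + m) f) g p)"
  by (induction m arbitrary: k) (simp_all add: up_upn)

definition upnS :: "nat \<Rightarrow> (nat \<Rightarrow> nat) \<Rightarrow> nat \<Rightarrow> nat" where
  "upnS m g i = (if i < m then i else g (i - m) + m)"

lemma up_upnS: "case_nat 0 (\<lambda>i. Suc (upnS m g i)) = upnS (Suc m) g"
  by (rule ext) (auto simp: upnS_def split: nat.split)

lemma subst_ForallSs: "subst f (upnS k g) ((ForallS ^^ m) p) = (ForallS ^^ m) (subst f (upnS (k + m) g) p)"
  by (induction m arbitrary: k) (simp_all add: up_upnS)

lemma upn_0 [simp]: "upn 0 f = f" by (rule ext) (simp add: upn_def)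
lemma upnS_0 [simp]: "upnS 0 g = g" by (rule ext) (simp add: upnS_def)

text \<open>\<open>ForallE\<close> replaces one variable at a time, and the terms put in may contain
  variables that are still to be replaced. So all relevant variables are quantified first. The
  outermost quantifiers are then instantiated in turn, each term being lifted past those that
  remain, and the result is the simultaneous substitution.\<close>

lemma proves_subst_Var:
  assumes "T \<turnstile> q" shows "T \<turnstile> subst \<sigma> id q"
proof -
  obtain n where n: "below n q" using ex_below by blast
  have "T \<turnstile> (Forall ^^ m) (subst (upn m (\<lambda>i. \<sigma> (i + m))) id q)" if "m \<le> n" for m
    using that
  proof (induction m rule: inc_induct)
    case base
    \<comment> \<open>At m = n nothing has been substituted yet, since q has no variables from n
      on.\<close>
    have eq: "subst (upn n (\<lambda>i. \<sigma> (i + n))) id q = subst Var id q"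
      by (rule belowD[OF n]) (simp_all add: upn_def)
    moreover have "T \<turnstile> (Forall ^^ m) q" for m
      using assms by (induction m) (simp_all add: proves.Gen)
    ultimately show ?case unfolding eq by simp
  next
    case (step m)
    let ?r = "subst (upn (Suc m) (\<lambda>i. \<sigma> (i + Suc m))) id q"
    have "T \<turnstile> inst (\<sigma> m) ((Forall ^^ m) ?r)"
      using step.IH proves.ForallE proves.MP by (metis funpow.simps(2) o_apply)
    also have "inst (\<sigma> m) ((Forall ^^ m) ?r) = (Forall ^^ m) (subst (upn m (case_nat (\<sigma> m) Var)) id ?r)"
      unfolding inst_def using subst_Foralls[of 0 "case_nat (\<sigma> m) Var" id m ?r] by simp
    also have "(\<lambda>i. tsubst (upn m (case_nat (\<sigma> m) Var)) (upn (Suc m) (\<lambda>i. \<sigma> (i + Suc m)) i)) =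
        upn m (\<lambda>i. \<sigma> (i + m))"
      by (rule ext) (auto simp: upn_def tsubst_tsubst less_Suc_eq)
    then have "subst (upn m (case_nat (\<sigma> m) Var)) id ?r = subst (upn m (\<lambda>i. \<sigma> (i + m))) id q"
      by (simp add: subst_subst id_def)
    finally show ?case .
  qed
  from this[of 0] show ?thesis by simp
qed

lemma proves_subst_S:
  assumes "T \<turnstile> q" shows "T \<turnstile> subst Var \<sigma> q"
proof -
  obtain n where n: "below n q" using ex_below by blast
  have "T \<turnstile> (ForallS ^^ m) (subst Var (upnS m (\<lambda>i. \<sigma> (i + m))) q)" if "m \<le> n" for m
    using that
  proof (induction m rule: inc_induct)
    case base
    have eq: "subst Var (upnS n (\<lambda>i. \<sigma> (i + n))) q = subst Var id q"
      by (rule belowD[OF n]) (simp_all add: upnS_def)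
    moreover have "T \<turnstile> (ForallS ^^ m) q" for m
      using assms by (induction m) (simp_all add: proves.GenS)
    ultimately show ?case unfolding eq by simp
  next
    case (step m)
    let ?r = "subst Var (upnS (Suc m) (\<lambda>i. \<sigma> (i + Suc m))) q"
    have "T \<turnstile> instS (\<sigma> m) ((ForallS ^^ m) ?r)"
      using step.IH proves.ForallSE proves.MP by (metis funpow.simps(2) o_apply)
    also have "instS (\<sigma> m) ((ForallS ^^ m) ?r) = (ForallS ^^ m) (subst Var (upnS m (case_nat (\<sigma> m) id)) ?r)"
      unfolding instS_def using subst_ForallSs[of Var 0 "case_nat (\<sigma> m) id" m ?r] by simp
    also have "(\<lambda>i. upnS m (case_nat (\<sigma> m) id) (upnS (Suc m) (\<lambda>i. \<sigma> (i + Suc m)) i)) =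
        upnS m (\<lambda>i. \<sigma> (i + m))"
      by (rule ext) (auto simp: upnS_def less_Suc_eq)
    then have "subst Var (upnS m (case_nat (\<sigma> m) id)) ?r = subst Var (upnS m (\<lambda>i. \<sigma> (i + m))) q"
      by (simp add: subst_subst)
    finally show ?case .
  qed
  from this[of 0] show ?thesis by simp
qed

lemma proves_subst: "T \<turnstile> q \<Longrightarrow> T \<turnstile> subst f g q"
proof -
  assume "T \<turnstile> q"
  then obtain "T \<turnstile> subst (\<lambda>i. f i) id (subst Var g q)"
    by (blast intro: proves_subst_Var proves_subst_S)
  then show ?thesis by (simp add: subst_subst)
qed

section \<open>Completeness\<close>

text \<open>Hypotheses are antecedents rather than additions to T, because \<open>Gen\<close> would
  generalize over their free variables. The deduction theorem becomes the definition.\<close>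

primrec derives :: "fm set \<Rightarrow> fm list \<Rightarrow> fm \<Rightarrow> bool" where
  "derives T [] p \<longleftrightarrow> T \<turnstile> p"
| "derives T (a # L) p \<longleftrightarrow> derives T L (Imp a p)"

lemma derives_thm: "T \<turnstile> p \<Longrightarrow> derives T L p"
  by (induction L arbitrary: p) (auto intro: proves.MP proves.K)

lemma derives_MP: "derives T L (Imp p q) \<Longrightarrow> derives T L p \<Longrightarrow> derives T L q"
proof (induction L arbitrary: p q)
  case Nil then show ?case by (auto intro: proves.MP)
next
  case (Cons a L)
  have "derives T L (Imp (Imp a (Imp p q)) (Imp (Imp a p) (Imp a q)))"
    by (rule derives_thm) (rule proves.S)
  then show ?case using Cons by simp blast
qed

lemma derives_weaken: "derives T L p \<Longrightarrow> derives T (a # L) p"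
  using derives_MP[OF derives_thm[OF proves.K]] by simp

lemma derives_append: "derives T L p \<Longrightarrow> derives T (M @ L) p"
proof (induction M)
  case (Cons a M) then show ?case using derives_weaken by (metis append_Cons)
qed simp

lemma proves_refl: "T \<turnstile> Imp p p"
  by (meson proves.K proves.S proves.MP)

lemma derives_hd: "derives T (p # L) p"
  by (simp add: derives_thm proves_refl)

lemma derives_mem: "p \<in> set L \<Longrightarrow> derives T L p"
proof (induction L)
  case (Cons a L) then show ?case using derives_hd derives_weaken by (metis set_ConsD)
qed simp

lemma derives_DN: "derives T L (Neg (Neg p)) \<Longrightarrow> derives T L p"
  using derives_MP[OF derives_thm[OF proves.DN]] .

lemma derives_Neg: "derives T (p # L) Fls \<Longrightarrow> derives T L (Neg p)"
  by (simp add: Neg_def)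

lemma derives_NegE: "derives T L (Neg p) \<Longrightarrow> derives T L p \<Longrightarrow> derives T L Fls"
  using derives_MP by (simp add: Neg_def)

lemma derives_Fls: "derives T L Fls \<Longrightarrow> derives T L p"
  by (rule derives_DN) (rule derives_Neg, erule derives_weaken)

text \<open>Lifted hypotheses do not contain variable 0, so p may be generalized.
  \<open>ForallImp\<close> distributes the quantifier over the antecedents, and
  \<open>ForallI\<close> supplies the quantified antecedents.\<close>

lemma derives_Forall_lift:
  "derives T (map lift L) p \<Longrightarrow> derives T L (Forall p)"
proof (induction L arbitrary: p)
  case Nil then show ?case by (simp add: proves.Gen)
next
  case (Cons a L)
  then have "derives T L (Forall (Imp (lift a) p))" by simp
  then have "derives T L (Imp (Forall (lift a)) (Forall p))"
    using derives_MP[OF derives_thm[OF proves.ForallImp]] by blast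
  then have "derives T (a # L) (Imp (Forall (lift a)) (Forall p))" by (rule derives_weaken)
  moreover have "derives T (a # L) (Forall (lift a))"
    using derives_MP[OF derives_thm[OF proves.ForallI] derives_hd] .
  ultimately show ?case by (rule derives_MP)
qed

lemma derives_ForallS_lift:
  "derives T (map liftS L) p \<Longrightarrow> derives T L (ForallS p)"
proof (induction L arbitrary: p)
  case Nil then show ?case by (simp add: proves.GenS)
next
  case (Cons a L)
  then have "derives T L (ForallS (Imp (liftS a) p))" by simp
  then have "derives T L (Imp (ForallS (liftS a)) (ForallS p))"
    using derives_MP[OF derives_thm[OF proves.ForallSImp]] by blast
  then have "derives T (a # L) (Imp (ForallS (liftS a)) (ForallS p))" by (rule derives_weaken)
  moreover have "derives T (a # L) (ForallS (liftS a))"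
    using derives_MP[OF derives_thm[OF proves.ForallSI] derives_hd] .
  ultimately show ?case by (rule derives_MP)
qed

lemma derives_subst: "derives T L p \<Longrightarrow> derives T (map (subst f g) L) (subst f g p)"
proof (induction L arbitrary: p)
  case (Cons a L) then show ?case using Cons.IH[of "Imp a p"] by simp
qed (simp add: proves_subst)

lemma ex_below_list: "\<exists>n. \<forall>p\<in>set L. below n p"
proof (induction L)
  case (Cons a L)
  then obtain m n where "\<forall>p\<in>set L. below m p" "below n a" using ex_below by blast
  then show ?case by (intro exI[of _ "m + n"]) (auto intro: below_mono)
qed simp

lemma derives_Forall_fresh:
  assumes "\<forall>q\<in>set (p # L). below k q" "derives T L (inst (Var k) p)"
  shows "derives T L (Forall p)"
proof -
  \<comment> \<open>Renames the fresh variable k to 0 and lifts all others, which undoes the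
    instance and lifts L at once.\<close>
  let ?f = "\<lambda>i. if i = k then Var 0 else Var (Suc i)"
  have "subst ?f id q = lift q" if "q \<in> set L" for q
    unfolding lift_def using assms(1) that by (intro belowD[of k]) auto
  then have L: "map (subst ?f id) L = map lift L" by simp
  have "subst ?f id (inst (Var k) p) = subst (\<lambda>i. tsubst ?f (case_nat (Var k) Var i)) id p"
    by (simp add: inst_def subst_subst id_def)
  also have "\<dots> = subst Var id p"
    using assms(1) by (intro belowD[of k]) (auto split: nat.split)
  finally have "derives T (map lift L) p"
    using derives_subst[OF assms(2), of ?f id] L by simp
  then show ?thesis by (rule derives_Forall_lift)
qed

lemma derives_ForallS_fresh:
  assumes "\<forall>q\<in>set (p # L). below k q" "derives T L (instS k p)"
  shows "derives T L (ForallS p)"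
proof -
  let ?g = "\<lambda>i. if i = k then 0 else Suc i"
  have "subst Var ?g q = liftS q" if "q \<in> set L" for q
    unfolding liftS_def using assms(1) that by (intro belowD[of k]) auto
  then have L: "map (subst Var ?g) L = map liftS L" by simp
  have "subst Var ?g (instS k p) = subst Var (\<lambda>i. ?g (case_nat k id i)) p"
    by (simp add: instS_def subst_subst)
  also have "\<dots> = subst Var id p"
    using assms(1) by (intro belowD[of k]) (auto split: nat.split)
  finally have "derives T (map liftS L) p"
    using derives_subst[OF assms(2), of Var ?g] L by simp
  then show ?thesis by (rule derives_ForallS_lift)
qed

section \<open>Complete consistent sets with witnesses\<close>

definition decided :: "fm set \<Rightarrow> fm list \<Rightarrow> fm \<Rightarrow> bool" where
  "decided T L p \<longleftrightarrow> derives T L p \<or> derives T L (Neg p) \<and>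
    (\<forall>q. p = Forall q \<longrightarrow> (\<exists>t. derives T L (Neg (inst t q)))) \<and>
    (\<forall>q. p = ForallS q \<longrightarrow> (\<exists>X. derives T L (Neg (instS X q))))"

text \<open>Variables serve as Henkin constants. L is finite, so some variable occurs neither in L
  nor in q and can be the counterexample to a refuted universal formula. T imposes no restriction on
  it, since its theorems are closed under substitution.\<close>

lemma decided_extension:
  assumes L: "\<not> derives T L Fls"
  shows "\<exists>M. \<not> derives T (M @ L) Fls \<and> decided T (M @ L) p"
proof (cases "derives T (p # L) Fls")
  case False
  then show ?thesis
    by (intro exI[of _ "[p]"]) (simp add: decided_def derives_thm proves_refl)
next
  case True
  then have neg: "derives T L (Neg p)" by (rule derives_Neg)
  consider q where "p = Forall q" | q where "p = ForallS q" | "\<nexists>q. p = Forall q \<or> p = ForallS q" by blast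
  then show ?thesis
  proof cases
    case (1 q)
    obtain k where k: "\<forall>r\<in>set (q # L). below k r" using ex_below_list by blast
    have "\<not> derives T (Neg (inst (Var k) q) # L) Fls"
    proof
      assume "derives T (Neg (inst (Var k) q) # L) Fls"
      then have "derives T L (Forall q)"
        using derives_Neg derives_DN derives_Forall_fresh[OF k] by blast
      then show False using neg L derives_NegE 1 by blast
    qed
    moreover have "decided T (Neg (inst (Var k) q) # L) p"
      unfolding decided_def using 1 derives_weaken[OF neg] derives_hd by blast
    ultimately show ?thesis by (intro exI[of _ "[Neg (inst (Var k) q)]"]) simp
  next
    case (2 q)
    obtain k where k: "\<forall>r\<in>set (q # L). below k r" using ex_below_list by blast
    have "\<not> derives T (Neg (instS k q) # L) Fls"
    proof
      assume "derives T (Neg (instS k q) # L) Fls"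
      then have "derives T L (ForallS q)"
        using derives_Neg derives_DN derives_ForallS_fresh[OF k] by blast
      then show False using neg L derives_NegE 2 by blast
    qed
    moreover have "decided T (Neg (instS k q) # L) p"
      unfolding decided_def using 2 derives_weaken[OF neg] derives_hd by blast
    ultimately show ?thesis by (intro exI[of _ "[Neg (instS k q)]"]) simp
  next
    case 3
    then show ?thesis using neg L by (intro exI[of _ "[]"]) (auto simp: decided_def)
  qed
qed

definition Henkin :: "fm set \<Rightarrow> bool" where
  "Henkin \<Gamma> \<longleftrightarrow> Fls \<notin> \<Gamma> \<and>
    (\<forall>p q. Imp p q \<in> \<Gamma> \<longleftrightarrow> (p \<in> \<Gamma> \<longrightarrow> q \<in> \<Gamma>)) \<and>
    (\<forall>p. Forall p \<in> \<Gamma> \<longleftrightarrow> (\<forall>t. inst t p \<in> \<Gamma>)) \<and>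
    (\<forall>p. ForallS p \<in> \<Gamma> \<longleftrightarrow> (\<forall>X. instS X p \<in> \<Gamma>))"

lemma Henkin_extension:
  assumes L0: "\<not> derives T L0 Fls"
  shows "\<exists>\<Gamma>. Henkin \<Gamma> \<and> {p. T \<turnstile> p} \<subseteq> \<Gamma> \<and> set L0 \<subseteq> \<Gamma>"
proof -
  define ext where "ext p L = (SOME M. \<not> derives T (M @ L) Fls \<and> decided T (M @ L) p)" for p L
  have ext: "\<not> derives T (ext p L @ L) Fls \<and> decided T (ext p L @ L) p" if "\<not> derives T L Fls" for L p
    unfolding ext_def using someI_ex[OF decided_extension[OF that]] .
  define L where "L = rec_nat L0 (\<lambda>n L. ext (from_nat n) L @ L)"
  have L_simps: "L 0 = L0" "L (Suc n) = ext (from_nat n) (L n) @ L n" for n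
    by (simp_all add: L_def)
  have cons: "\<not> derives T (L n) Fls" for n
    by (induction n) (use L0 ext in \<open>auto simp: L_simps\<close>)
  \<comment> \<open>Formula p is decided at stage \<open>to_nat p\<close>; later stages only add
    hypotheses.\<close>
  have dec: "decided T (L (Suc (to_nat p))) p" for p
    using ext[OF cons, of "from_nat (to_nat p)"] by (simp add: L_simps)
  have mono: "derives T (L n) p" if "derives T (L m) p" "m \<le> n" for m n p
    using that(2,1) by (induction rule: dec_induct) (auto simp: L_simps intro: derives_append)
  define \<Gamma> where "\<Gamma> = {p. \<exists>n. derives T (L n) p}"
  have taut: "p \<in> \<Gamma>" if "T \<turnstile> p" for p
    using derives_thm[OF that] by (auto simp: \<Gamma>_def)
  have MP: "q \<in> \<Gamma>" if "Imp p q \<in> \<Gamma>" "p \<in> \<Gamma>" for p q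
  proof -
    obtain m n where "derives T (L m) (Imp p q)" "derives T (L n) p" using \<open>Imp p q \<in> \<Gamma>\<close> \<open>p \<in> \<Gamma>\<close>
      by (auto simp: \<Gamma>_def)
    then have "derives T (L (m + n)) q" by (meson derives_MP mono le_add1 le_add2)
    then show ?thesis by (auto simp: \<Gamma>_def)
  qed
  have Fls: "Fls \<notin> \<Gamma>" using cons by (auto simp: \<Gamma>_def)
  have con: "\<not> (p \<in> \<Gamma> \<and> Neg p \<in> \<Gamma>)" for p using MP[of p Fls] Fls by (auto simp: Neg_def)
  have decG: "p \<in> \<Gamma> \<or> Neg p \<in> \<Gamma> \<and>
    (\<forall>q. p = Forall q \<longrightarrow> (\<exists>t. Neg (inst t q) \<in> \<Gamma>)) \<and>
    (\<forall>q. p = ForallS q \<longrightarrow> (\<exists>X. Neg (instS X q) \<in> \<Gamma>))" for p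
    using dec[of p] unfolding decided_def \<Gamma>_def by blast
  have Imp: "Imp p q \<in> \<Gamma> \<longleftrightarrow> (p \<in> \<Gamma> \<longrightarrow> q \<in> \<Gamma>)" for p q
  proof
    assume "p \<in> \<Gamma> \<longrightarrow> q \<in> \<Gamma>"
    then consider "q \<in> \<Gamma>" | "Neg p \<in> \<Gamma>" using decG by blast
    then show "Imp p q \<in> \<Gamma>"
    proof cases
      case 1 then show ?thesis using taut[OF proves.K] MP by blast
    next
      case 2
      have "derives T [p, Neg p] q"
        by (meson derives_Fls derives_NegE derives_hd derives_weaken)
      then have "T \<turnstile> Imp (Neg p) (Imp p q)" by simp
      then show ?thesis using 2 taut MP by blast
    qed
  qed (use MP in blast)
  have Forall: "Forall p \<in> \<Gamma> \<longleftrightarrow> (\<forall>t. inst t p \<in> \<Gamma>)" for p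
    using MP[OF taut[OF proves.ForallE]] decG[of "Forall p"] con by blast
  have ForallS: "ForallS p \<in> \<Gamma> \<longleftrightarrow> (\<forall>X. instS X p \<in> \<Gamma>)" for p
    using MP[OF taut[OF proves.ForallSE]] decG[of "ForallS p"] con by blast
  have "set L0 \<subseteq> \<Gamma>"
    unfolding \<Gamma>_def using derives_mem L_simps(1) by (metis (mono_tags, lifting) mem_Collect_eq subsetI)
  moreover have "Henkin \<Gamma>"
    unfolding Henkin_def by (intro conjI allI Fls Imp Forall ForallS)
  ultimately show ?thesis using taut by blast
qed

section \<open>Models\<close>

record 'a model =
  zero_of :: 'a
  one_of :: 'a
  add_of :: "'a \<Rightarrow> 'a \<Rightarrow> 'a"
  mult_of :: "'a \<Rightarrow> 'a \<Rightarrow> 'a"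
  less_of :: "'a \<Rightarrow> 'a \<Rightarrow> bool"
  sets_of :: "'a set set"

primrec tval :: "('a, 'm) model_scheme \<Rightarrow> tm \<Rightarrow> (nat \<Rightarrow> 'a) \<Rightarrow> 'a" where
  "tval M (Var i) e = e i"
| "tval M Zero e = zero_of M"
| "tval M One e = one_of M"
| "tval M (Add s t) e = add_of M (tval M s e) (tval M t e)"
| "tval M (Mult s t) e = mult_of M (tval M s e) (tval M t e)"

primrec sat :: "('a, 'm) model_scheme \<Rightarrow> fm \<Rightarrow> (nat \<Rightarrow> 'a) \<Rightarrow> (nat \<Rightarrow> 'a set) \<Rightarrow> bool" where
  "sat M (Eq s t) e E \<longleftrightarrow> tval M s e = tval M t e"
| "sat M (Less s t) e E \<longleftrightarrow> less_of M (tval M s e) (tval M t e)"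
| "sat M (Mem t X) e E \<longleftrightarrow> tval M t e \<in> E X"
| "sat M Fls e E \<longleftrightarrow> False"
| "sat M (Imp p q) e E \<longleftrightarrow> (sat M p e E \<longrightarrow> sat M q e E)"
| "sat M (Forall p) e E \<longleftrightarrow> (\<forall>x. sat M p (case_nat x e) E)"
| "sat M (ForallS p) e E \<longleftrightarrow> (\<forall>A\<in>sets_of M. sat M p e (case_nat A E))"

lemma sat_connectives [simp]:
  "sat M (Neg p) e E \<longleftrightarrow> \<not> sat M p e E"
  "sat M (And p q) e E \<longleftrightarrow> sat M p e E \<and> sat M q e E"
  "sat M (Or p q) e E \<longleftrightarrow> sat M p e E \<or> sat M q e E"
  "sat M (Iff p q) e E \<longleftrightarrow> (sat M p e E \<longleftrightarrow> sat M q e E)"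
  "sat M (Exists p) e E \<longleftrightarrow> (\<exists>x. sat M p (case_nat x e) E)"
  "sat M (ExistsS p) e E \<longleftrightarrow> (\<exists>A\<in>sets_of M. sat M p e (case_nat A E))"
  by (auto simp: Neg_def And_def Or_def Iff_def Exists_def ExistsS_def)

lemma case_nat_comp: "(\<lambda>i. h (case_nat a f i)) = case_nat (h a) (\<lambda>i. h (f i))"
  by (rule ext) (simp split: nat.split)

lemma tval_tsubst: "tval M (tsubst f t) e = tval M t (\<lambda>i. tval M (f i) e)"
  by (induction t) auto

lemma tval_tlift [simp]: "tval M (tlift t) (case_nat x e) = tval M t e"
  by (simp add: tlift_def tval_tsubst)

lemma sat_subst: "sat M (subst f g p) e E \<longleftrightarrow> sat M p (\<lambda>i. tval M (f i) e) (\<lambda>X. E (g X))"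
proof (induction p arbitrary: f g e E)
  case (Forall p)
  have "(\<lambda>i. tval M (case_nat (Var 0) (\<lambda>i. tlift (f i)) i) (case_nat x e)) =
      case_nat x (\<lambda>i. tval M (f i) e)" for x
    by (rule ext) (simp split: nat.split)
  then show ?case by (simp add: Forall)
next
  case (ForallS p)
  have "(\<lambda>X. case_nat A E (case_nat 0 (\<lambda>X. Suc (g X)) X)) = case_nat A (\<lambda>X. E (g X))" for A
    by (rule ext) (simp split: nat.split)
  then show ?case by (simp add: ForallS)
qed (auto simp: tval_tsubst)

text \<open>Axioms may have free variables, hence all environments. Without any sets there would be
  no environment, and every axiom would hold vacuously.\<close>

definition is_model :: "('a, 'm) model_scheme \<Rightarrow> fm set \<Rightarrow> bool" where
  "is_model M T \<longleftrightarrow> sets_of M \<noteq> {} \<and> (\<forall>p\<in>T. \<forall>e E. range E \<subseteq> sets_of M \<longrightarrow> sat M p e E)"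

text \<open>
  All models are carried by a copy of \<open>nat\<close>, which suffices because the term models below are
  countable and, by the successor axioms, infinite. The copy is a type of its own so that the
  operations of a nonstandard model can later be made its type class operations.
\<close>

typedef mnat = "UNIV :: nat set" ..

section \<open>Countable term models\<close>

lemma ex_enumeration:
  fixes r :: "'a::countable \<Rightarrow> 'a \<Rightarrow> bool"
  assumes "equivp r" and inf: "\<And>m n::nat. r (f m) (f n) \<Longrightarrow> m = n"
  shows "\<exists>h :: 'a \<Rightarrow> mnat. surj h \<and> (\<forall>x y. h x = h y \<longleftrightarrow> r x y)"
proof -
  have r: "r x = r y \<longleftrightarrow> r x y" for x y using assms(1) by (auto simp: equivp_def)
  have "inj (\<lambda>n. r (f n))" by (rule injI) (use r inf in blast)
  then have "infinite (range (\<lambda>n. r (f n)))" by (rule range_inj_infinite)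
  then have "infinite (range r)" by (rule infinite_super[rotated]) blast
  then have g: "bij_betw (to_nat_on (range r)) (range r) UNIV" by (intro to_nat_on_infinite) simp_all
  let ?g = "to_nat_on (range r)"
  let ?h = "\<lambda>x. Abs_mnat (?g (r x))"
  have "?h x = ?h y \<longleftrightarrow> r x y" for x y
    using inj_on_eq_iff[OF bij_betw_imp_inj_on[OF g], of "r x" "r y"] by (simp only: r rangeI Abs_mnat_inject UNIV_I)
  moreover have "surj ?h"
    using bij_betw_imp_surj_on[OF g] Abs_mnat_cases by (metis UNIV_I image_image surj_def)
  ultimately show ?thesis by (intro exI[of _ ?h] conjI allI)
qed

text \<open>The carrier consists of the terms modulo equality in \<open>\<Gamma>\<close>, and a set
  variable denotes the terms that \<open>\<Gamma>\<close> puts into it. The successor axioms make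
  the numerals distinct, so there are infinitely many classes, as many as elements of
  \<open>mnat\<close>.\<close>

lemma Henkin_model:
  assumes \<Gamma>: "Henkin \<Gamma>" "{p. T \<turnstile> p} \<subseteq> \<Gamma>" and PA: "basic_axioms \<subseteq> T"
  shows "\<exists>M :: mnat model. is_model M T \<and> (\<exists>e E. range E \<subseteq> sets_of M \<and> (\<forall>p\<in>\<Gamma>. sat M p e E))"
proof -
  have Fls: "Fls \<notin> \<Gamma>"
    and Imp: "\<And>p q. Imp p q \<in> \<Gamma> \<longleftrightarrow> (p \<in> \<Gamma> \<longrightarrow> q \<in> \<Gamma>)"
    and Forall: "\<And>p. Forall p \<in> \<Gamma> \<longleftrightarrow> (\<forall>t. inst t p \<in> \<Gamma>)"
    and ForallS: "\<And>p. ForallS p \<in> \<Gamma> \<longleftrightarrow> (\<forall>X. instS X p \<in> \<Gamma>)"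
    using \<Gamma>(1) by (auto simp: Henkin_def)
  define eqv where "eqv s t \<longleftrightarrow> Eq s t \<in> \<Gamma>" for s t
  have refl: "eqv t t" for t using \<Gamma>(2) proves.Refl by (auto simp: eqv_def)
  have leib: "subst (case_nat t Var) id p \<in> \<Gamma>"
    if "eqv s t" "subst (case_nat s Var) id p \<in> \<Gamma>" for s t p
    using that \<Gamma>(2) proves.Leibniz[of T s t p] Imp by (auto simp: eqv_def inst_def)
  \<comment> \<open>Here and below the lifted terms do not contain variable 0, so
    \<open>Leibniz\<close> changes only the places marked by \<open>Var 0\<close>.\<close>
  have sym: "eqv t s" if "eqv s t" for s t
    using leib[OF that, of "Eq (Var 0) (tlift s)"] refl
    by (simp add: eqv_def tlift_def tsubst_tsubst)
  have tr: "eqv s u" if "eqv s t" "eqv t u" for s t u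
    using leib[OF that(2), of "Eq (tlift s) (Var 0)"] that(1)
    by (simp add: eqv_def tlift_def tsubst_tsubst)
  have cong2: "eqv (c s t) (c s' t')"
    if c: "\<And>f s t. tsubst f (c s t) = c (tsubst f s) (tsubst f t)" and "eqv s s'" "eqv t t'" for c s s' t t'
  proof -
    have "eqv (c s t) (c s' t)"
      using leib[OF that(2), of "Eq (tlift (c s t)) (c (Var 0) (tlift t))"] refl
      by (simp add: eqv_def tlift_def tsubst_tsubst c)
    moreover have "eqv (c s' t) (c s' t')"
      using leib[OF that(3), of "Eq (tlift (c s' t)) (c (tlift s') (Var 0))"] refl
      by (simp add: eqv_def tlift_def tsubst_tsubst c)
    ultimately show ?thesis by (rule tr)
  qed
  have less_cong: "Less s' t' \<in> \<Gamma>" if "eqv s s'" "eqv t t'" "Less s t \<in> \<Gamma>" for s s' t t'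
  proof -
    have "Less s' t \<in> \<Gamma>"
      using leib[OF that(1), of "Less (Var 0) (tlift t)"] that(3)
      by (simp add: tlift_def tsubst_tsubst)
    then show ?thesis
      using leib[OF that(2), of "Less (tlift s') (Var 0)"]
      by (simp add: tlift_def tsubst_tsubst)
  qed
  have mem_cong: "Mem s' X \<in> \<Gamma>" if "eqv s s'" "Mem s X \<in> \<Gamma>" for s s' X
    using leib[OF that(1), of "Mem (Var 0) X"] that(2) by simp
  have ax: "p \<in> \<Gamma>" if "p \<in> basic_axioms" for p
    using that PA \<Gamma>(2) proves.Ax by blast
  have "Neg (Eq (Add t One) Zero) \<in> \<Gamma>" for t
  proof -
    have "Forall (Neg (Eq (Add (Var 0) One) Zero)) \<in> \<Gamma>"
      by (rule ax) (simp add: basic_axioms_def sentence_def fAll_def fNeg_def fEq_def fAdd_def fOne_def fZero_def)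
    then have "inst t (Neg (Eq (Add (Var 0) One) Zero)) \<in> \<Gamma>" using Forall by blast
    then show ?thesis by (simp add: inst_def Neg_def)
  qed
  then have suc0: "\<not> eqv (Add t One) Zero" for t using Imp Fls by (simp add: Neg_def eqv_def)
  have suc: "eqv s t" if "eqv (Add s One) (Add t One)" for s t
  proof -
    let ?p = "Imp (Eq (Add (Var (Suc 0)) One) (Add (Var 0) One)) (Eq (Var (Suc 0)) (Var 0))"
    have "Forall (Forall ?p) \<in> \<Gamma>"
      by (rule ax) (simp add: basic_axioms_def sentence_def fAll_def fImp_def fEq_def fAdd_def fOne_def)
    then have "inst s (Forall ?p) \<in> \<Gamma>" using Forall by blast
    then have "Forall (Imp (Eq (Add (tlift s) One) (Add (Var 0) One)) (Eq (tlift s) (Var 0))) \<in> \<Gamma>"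
      by (simp add: inst_def)
    then have "inst t (Imp (Eq (Add (tlift s) One) (Add (Var 0) One)) (Eq (tlift s) (Var 0))) \<in> \<Gamma>"
      using Forall by blast
    then have "Imp (Eq (Add s One) (Add t One)) (Eq s t) \<in> \<Gamma>"
      by (simp add: inst_def tlift_def tsubst_tsubst)
    then show ?thesis using that Imp by (simp add: eqv_def)
  qed
  define nm where "nm = rec_nat Zero (\<lambda>_ t. Add t One)"
  have nm: "nm 0 = Zero" "nm (Suc n) = Add (nm n) One" for n by (simp_all add: nm_def)
  have inf: "m = n" if "eqv (nm m) (nm n)" for m n
    using that
  proof (induction m arbitrary: n)
    case 0 then show ?case using suc0 sym by (cases n) (auto simp: nm)
  next
    case (Suc m) then show ?case using suc0 suc by (cases n) (auto simp: nm)
  qed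
  have "equivp eqv"
    by (intro equivpI reflpI sympI transpI) (fact refl, fact sym, fact tr)
  from ex_enumeration[OF this inf] obtain h :: "tm \<Rightarrow> mnat"
    where "surj h" and h: "\<And>s t. h s = h t \<longleftrightarrow> eqv s t" by blast
  define r where "r = inv h"
  have r: "h (r x) = x" for x using \<open>surj h\<close> by (simp add: r_def surj_f_inv_f)
  define Ext where "Ext X = {h t | t. Mem t X \<in> \<Gamma>}" for X
  define M where "M = \<lparr>zero_of = h Zero, one_of = h One, add_of = (\<lambda>x y. h (Add (r x) (r y))),
    mult_of = (\<lambda>x y. h (Mult (r x) (r y))), less_of = (\<lambda>x y. Less (r x) (r y) \<in> \<Gamma>), sets_of = range Ext\<rparr>"
  have rh: "eqv (r (h t)) t" for t using r h by blast
  have M: "zero_of M = h Zero" "one_of M = h One" "sets_of M = range Ext" by (simp_all add: M_def)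
  have "eqv (Add (r (h s)) (r (h t))) (Add s t)" "eqv (Mult (r (h s)) (r (h t))) (Mult s t)" for s t
    using rh by (rule cong2[where c = Add, rotated] cong2[where c = Mult, rotated]; simp)+
  then have ops: "add_of M (h s) (h t) = h (Add s t)" "mult_of M (h s) (h t) = h (Mult s t)" for s t
    using h by (simp_all add: M_def)
  have tval: "tval M t (\<lambda>i. h (f i)) = h (tsubst f t)" for t f
    by (induction t) (simp_all add: M ops)
  have less: "less_of M (h s) (h t) \<longleftrightarrow> Less s t \<in> \<Gamma>" for s t
    using less_cong[OF rh rh, of s t] less_cong[OF sym[OF rh] sym[OF rh], of s t]
    by (auto simp: M_def)
  have mem: "h t \<in> Ext X \<longleftrightarrow> Mem t X \<in> \<Gamma>" for t X
    unfolding Ext_def mem_Collect_eq h using mem_cong sym refl h by blast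
  \<comment> \<open>Stated for all substitutions, so that the quantifier cases only pass to another
    substitution: every environment over the model is the value of one.\<close>
  have truth: "sat M p (\<lambda>i. h (f i)) (\<lambda>X. Ext (g X)) \<longleftrightarrow> subst f g p \<in> \<Gamma>" for p f g
  proof (induction p arbitrary: f g)
    case (Forall p)
    have "inst t (subst (case_nat (Var 0) (\<lambda>i. tlift (f i))) g p) = subst (case_nat t f) g p" for t
    proof -
      have "(\<lambda>i. tsubst (case_nat t Var) (case_nat (Var 0) (\<lambda>i. tlift (f i)) i)) = case_nat t f"
        by (rule ext) (simp add: tlift_def tsubst_tsubst split: nat.split)
      then show ?thesis by (simp add: inst_def subst_subst)
    qed
    moreover have "sat M (Forall p) (\<lambda>i. h (f i)) (\<lambda>X. Ext (g X)) \<longleftrightarrow>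
        (\<forall>t. sat M p (case_nat (h t) (\<lambda>i. h (f i))) (\<lambda>X. Ext (g X)))"
      using r by (metis sat.simps(6))
    ultimately show ?case using Forall[of "case_nat _ f" g] \<open>\<And>p. (fm.Forall p \<in> \<Gamma>) = (\<forall>t. inst t p \<in> \<Gamma>)\<close>
      by (simp add: case_nat_comp)
  next
    case (ForallS p)
    have "instS X (subst f (case_nat 0 (\<lambda>X. Suc (g X))) p) = subst f (case_nat X g) p" for X
    proof -
      have "(\<lambda>i. case_nat X id (case_nat 0 (\<lambda>X. Suc (g X)) i)) = case_nat X g"
        by (rule ext) (simp split: nat.split)
      then show ?thesis by (simp add: instS_def subst_subst)
    qed
    moreover have "sat M (ForallS p) (\<lambda>i. h (f i)) (\<lambda>X. Ext (g X)) \<longleftrightarrow>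
        (\<forall>X. sat M p (\<lambda>i. h (f i)) (case_nat (Ext X) (\<lambda>X. Ext (g X))))"
      by (simp add: M)
    ultimately show ?case using ForallS[of f "case_nat _ g"] \<open>\<And>p. (fm.ForallS p \<in> \<Gamma>) = (\<forall>X. instS X p \<in> \<Gamma>)\<close>
      by (simp add: case_nat_comp)
  qed (simp_all add: tval less mem Imp Fls, simp add: h eqv_def)
  have "sat M p e E" if "p \<in> T" "range E \<subseteq> sets_of M" for p e E
  proof -
    have "\<forall>X. \<exists>Y. E X = Ext Y" using that(2) by (auto simp: M)
    then obtain g where g: "E = (\<lambda>X. Ext (g X))" by metis
    moreover have "e = (\<lambda>i. h (r (e i)))" by (simp add: r)
    moreover have "subst (\<lambda>i. r (e i)) g p \<in> \<Gamma>"
      using \<Gamma>(2) proves_subst[OF proves.Ax[OF that(1)]] by blast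
    ultimately show ?thesis using truth[of p "\<lambda>i. r (e i)" g] by simp
  qed
  then have "is_model M T" by (auto simp: is_model_def M)
  moreover have "\<forall>p\<in>\<Gamma>. sat M p (\<lambda>i. h (Var i)) (\<lambda>X. Ext (id X))"
    using truth[of _ Var id] by simp
  moreover have "range (\<lambda>X. Ext (id X)) \<subseteq> sets_of M" by (simp add: M)
  ultimately show ?thesis by blast
qed

theorem completeness:
  assumes "basic_axioms \<subseteq> T" "\<not> T \<turnstile> p"
  shows "\<exists>M :: mnat model. is_model M T \<and> (\<exists>e E. range E \<subseteq> sets_of M \<and> \<not> sat M p e E)"
proof -
  have "\<not> derives T [Neg p] Fls"
    using assms(2) derives_Neg[of T "Neg p" "[]"] derives_DN[of T "[]" p] by auto
  from Henkin_extension[OF this] obtain \<Gamma> where \<Gamma>: "Henkin \<Gamma>" "{p. T \<turnstile> p} \<subseteq> \<Gamma>" "Neg p \<in> \<Gamma>" by auto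
  from Henkin_model[OF this(1,2) assms(1)] obtain M :: "mnat model" and e E
    where "is_model M T" "range E \<subseteq> sets_of M" "\<forall>p\<in>\<Gamma>. sat M p e E" by blast
  moreover from this \<Gamma>(3) have "\<not> sat M p e E" by (metis sat_connectives(1))
  ultimately show ?thesis by blast
qed

section \<open>Truth of the axioms in a model\<close>

lemma sat_inst [simp]: "sat M (inst t p) e E \<longleftrightarrow> sat M p (case_nat (tval M t e) e) E"
proof -
  have "(\<lambda>i. tval M (case_nat t Var i) e) = case_nat (tval M t e) e"
    by (rule ext) (simp split: nat.split)
  then show ?thesis by (simp add: inst_def sat_subst id_def)
qed

lemma sat_liftS [simp]: "sat M (liftS p) e (case_nat A E) \<longleftrightarrow> sat M p e E"
  by (simp add: liftS_def sat_subst)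

lemma sat_subst_Suc:
  "sat M (subst (case_nat (Add (Var 0) One) (\<lambda>i. Var (Suc i))) id p) (case_nat x e) E \<longleftrightarrow>
    sat M p (case_nat (add_of M x (one_of M)) e) E"
proof -
  have "(\<lambda>i. tval M (case_nat (Add (Var 0) One) (\<lambda>i. Var (Suc i)) i) (case_nat x e)) =
      case_nat (add_of M x (one_of M)) e"
    by (rule ext) (simp split: nat.split)
  then show ?thesis by (simp add: sat_subst id_def)
qed

lemma sat_induction_axiom:
  "sat M (induction_axiom p) e E \<longleftrightarrow>
    (sat M p (case_nat (zero_of M) e) E \<longrightarrow>
     (\<forall>x. sat M p (case_nat x e) E \<longrightarrow> sat M p (case_nat (add_of M x (one_of M)) e) E) \<longrightarrow>
     (\<forall>x. sat M p (case_nat x e) E))"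
  by (auto simp: induction_axiom_def sat_subst_Suc)

lemma sat_comprehension_axiom:
  "sat M (comprehension_axiom p q) e E \<longleftrightarrow>
    ((\<forall>x. sat M p (case_nat x e) E \<longleftrightarrow> sat M q (case_nat x e) E) \<longrightarrow>
     (\<exists>A\<in>sets_of M. \<forall>x. x \<in> A \<longleftrightarrow> sat M p (case_nat x e) E))"
  by (simp add: comprehension_axiom_def)

lemmas form_defs = fZero_def fOne_def fAdd_def fMult_def fEq_def fLess_def fMem_def fNeg_def fAnd_def
  fOr_def fImp_def fIff_def fAll_def fEx_def fAllS_def fExS_def

lemma sat_basic_axioms:
  "(\<forall>p\<in>basic_axioms. sat M p e E) \<longleftrightarrow>
    (\<forall>x. add_of M x (one_of M) \<noteq> zero_of M) \<and>
    (\<forall>x y. add_of M x (one_of M) = add_of M y (one_of M) \<longrightarrow> x = y) \<and>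
    (\<forall>x. add_of M x (zero_of M) = x) \<and>
    (\<forall>x y. add_of M x (add_of M y (one_of M)) = add_of M (add_of M x y) (one_of M)) \<and>
    (\<forall>x. mult_of M x (zero_of M) = zero_of M) \<and>
    (\<forall>x y. mult_of M x (add_of M y (one_of M)) = add_of M (mult_of M x y) x) \<and>
    (\<forall>x. \<not> less_of M x (zero_of M)) \<and>
    (\<forall>x y. less_of M x (add_of M y (one_of M)) \<longleftrightarrow> less_of M x y \<or> x = y)"
  unfolding basic_axioms_def sentence_def form_defs image_insert image_empty ball_simps
  by (simp add: numeral_eq_Suc)

text \<open>The standard model. It makes sure that \<open>RCA0\<close> has a model, so that
  \<open>the_model\<close> is one even if nothing refutes the theorem.\<close>

definition full_model :: "mnat model" where
  "full_model = \<lparr>zero_of = Abs_mnat 0, one_of = Abs_mnat 1,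
    add_of = (\<lambda>x y. Abs_mnat (Rep_mnat x + Rep_mnat y)),
    mult_of = (\<lambda>x y. Abs_mnat (Rep_mnat x * Rep_mnat y)),
    less_of = (\<lambda>x y. Rep_mnat x < Rep_mnat y), sets_of = UNIV\<rparr>"

lemma full_model: "is_model full_model RCA0"
proof -
  have "sat full_model p e E" if "p \<in> basic_axioms" for p e E
  proof -
    have "\<forall>p\<in>basic_axioms. sat full_model p e E"
      unfolding sat_basic_axioms full_model_def
      by (auto simp: Abs_mnat_inverse Abs_mnat_inject Rep_mnat_inverse less_Suc_eq Rep_mnat_inject)
    then show ?thesis using that by blast
  qed
  moreover have "sat full_model (induction_axiom p) e E" for p e E
    unfolding sat_induction_axiom
  proof (intro impI allI)
    fix x
    assume 0: "sat full_model p (case_nat (zero_of full_model) e) E"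
      and Suc: "\<forall>x. sat full_model p (case_nat x e) E \<longrightarrow>
        sat full_model p (case_nat (add_of full_model x (one_of full_model)) e) E"
    have "sat full_model p (case_nat (Abs_mnat n) e) E" for n
    proof (induction n)
      case 0 then show ?case using \<open>sat full_model p (case_nat (zero_of full_model) e) E\<close> by (simp add: full_model_def)
    next
      case (Suc n) then show ?case using \<open>\<forall>x. sat full_model p _ E \<longrightarrow> _\<close>[rule_format, OF Suc]
        by (simp add: full_model_def Abs_mnat_inverse)
    qed
    from this[of "Rep_mnat x"] show "sat full_model p (case_nat x e) E" by (simp add: Rep_mnat_inverse)
  qed
  moreover have "sat full_model (comprehension_axiom p q) e E" for p q e E
    unfolding sat_comprehension_axiom
    by (intro impI bexI[of _ "{x. sat full_model p (case_nat x e) E}"]) (auto simp: full_model_def)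
  ultimately show ?thesis
    by (auto simp: is_model_def RCA0_def full_model_def[THEN arg_cong[of _ _ sets_of]])
qed

definition refutes :: "mnat model \<Rightarrow> bool" where
  "refutes M \<longleftrightarrow> (\<exists>e E. range E \<subseteq> sets_of M \<and> \<not> sat M (sentence (all_RT \<^bold>\<longrightarrow> ACA0')) e E)"

text \<open>
  The theorem is true if this model does not refute it. Fixing one model, instead of working in
  an arbitrary one, turns its operations into constants, for which type classes can be instantiated.
\<close>

definition the_model :: "mnat model" where
  "the_model = (SOME M. is_model M RCA0 \<and> ((\<exists>M'. is_model M' RCA0 \<and> refutes M') \<longrightarrow> refutes M))"

lemma the_model: "is_model the_model RCA0"
  and the_model_refutes: "is_model M RCA0 \<Longrightarrow> refutes M \<Longrightarrow> refutes the_model"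
proof -
  have "\<exists>M. is_model M RCA0 \<and> ((\<exists>M'. is_model M' RCA0 \<and> refutes M') \<longrightarrow> refutes M)"
    using full_model by blast
  from someI_ex[OF this, folded the_model_def] show "is_model the_model RCA0"
    and "is_model M RCA0 \<Longrightarrow> refutes M \<Longrightarrow> refutes the_model" by blast+
qed

abbreviation sets :: "mnat set set" where "sets \<equiv> sets_of the_model"

lemma sets_nonempty: "sets \<noteq> {}"
  using the_model by (simp add: is_model_def)

lemma the_model_sat: "p \<in> RCA0 \<Longrightarrow> range E \<subseteq> sets \<Longrightarrow> sat the_model p e E"
  using the_model by (simp add: is_model_def)

instantiation mnat :: "{zero, one, plus, times, ord, minus}"
begin
definition zero_mnat :: mnat where "0 = zero_of the_model"
definition one_mnat :: mnat where "1 = one_of the_model"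
definition plus_mnat :: "mnat \<Rightarrow> mnat \<Rightarrow> mnat" where "x + y = add_of the_model x y"
definition times_mnat :: "mnat \<Rightarrow> mnat \<Rightarrow> mnat" where "x * y = mult_of the_model x y"
definition less_mnat :: "mnat \<Rightarrow> mnat \<Rightarrow> bool" where "x < y \<longleftrightarrow> less_of the_model x y"
definition less_eq_mnat :: "mnat \<Rightarrow> mnat \<Rightarrow> bool" where "(x::mnat) \<le> y \<longleftrightarrow> x < y \<or> x = y"
text \<open>Truncated subtraction is no operation of the model; the type classes of cancellative
  semirings ask for it.\<close>

definition minus_mnat :: "mnat \<Rightarrow> mnat \<Rightarrow> mnat" where "(x::mnat) - y = (if y \<le> x then THE z. x = z + y else 0)"
instance ..
end

lemmas model_ops = zero_mnat_def[symmetric] one_mnat_def[symmetric] plus_mnat_def[symmetric]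
  times_mnat_def[symmetric] less_mnat_def[symmetric]

lemma PA:
  fixes x y :: mnat
  shows "x + 1 \<noteq> 0" "x + 1 = y + 1 \<Longrightarrow> x = y" "x + 0 = x" "x + (y + 1) = x + y + 1"
    "x * 0 = 0" "x * (y + 1) = x * y + x" "\<not> x < 0" "x < y + 1 \<longleftrightarrow> x < y \<or> x = y"
proof -
  obtain A where "A \<in> sets" using sets_nonempty by blast
  then have "\<forall>p\<in>basic_axioms. sat the_model p e (\<lambda>X. A)" for e
    using the_model_sat by (simp add: RCA0_def image_subset_iff)
  from this[unfolded sat_basic_axioms model_ops]
  show "x + 1 \<noteq> 0" "x + 1 = y + 1 \<Longrightarrow> x = y" "x + 0 = x" "x + (y + 1) = x + y + 1"
    "x * 0 = 0" "x * (y + 1) = x * y + x" "\<not> x < 0" "x < y + 1 \<longleftrightarrow> x < y \<or> x = y"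
    by blast+
qed

section \<open>Definability with parameters\<close>

text \<open>Definability is treated shallowly: a definable function or predicate is a HOL function
  of the environment. Number parameters enter as constants, set parameters as members of
  \<open>sets\<close>, and formulas appear only in \<open>delta0_fm\<close>.\<close>

inductive dterm :: "((nat \<Rightarrow> mnat) \<Rightarrow> mnat) \<Rightarrow> bool" where
  dterm_var: "dterm (\<lambda>e. e i)"
| dterm_const: "dterm (\<lambda>e. c)"
| dterm_add: "dterm s \<Longrightarrow> dterm t \<Longrightarrow> dterm (\<lambda>e. s e + t e)"
| dterm_mult: "dterm s \<Longrightarrow> dterm t \<Longrightarrow> dterm (\<lambda>e. s e * t e)"

inductive delta0 :: "((nat \<Rightarrow> mnat) \<Rightarrow> bool) \<Rightarrow> bool" where
  delta0_eq: "dterm s \<Longrightarrow> dterm t \<Longrightarrow> delta0 (\<lambda>e. s e = t e)"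
| delta0_less: "dterm s \<Longrightarrow> dterm t \<Longrightarrow> delta0 (\<lambda>e. s e < t e)"
| delta0_mem: "dterm t \<Longrightarrow> A \<in> sets \<Longrightarrow> delta0 (\<lambda>e. t e \<in> A)"
| delta0_False: "delta0 (\<lambda>e. False)"
| delta0_imp: "delta0 P \<Longrightarrow> delta0 Q \<Longrightarrow> delta0 (\<lambda>e. P e \<longrightarrow> Q e)"
| delta0_ball': "dterm t \<Longrightarrow> delta0 P \<Longrightarrow> delta0 (\<lambda>e. \<forall>x. x < t e \<longrightarrow> P (case_nat x e))"

text \<open>Variables sit at even positions and parameters at odd ones, so that formulas with
  parameters of their own can be merged by renaming.\<close>

definition join :: "(nat \<Rightarrow> 'a) \<Rightarrow> (nat \<Rightarrow> 'a) \<Rightarrow> nat \<Rightarrow> 'a" where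
  "join e f i = (if even i then e (i div 2) else f (i div 2))"

lemma join_even_odd [simp]: "join e f (2 * i) = e i" "join e f (Suc (2 * i)) = f i"
  by (simp_all add: join_def)

lemma eq_even_oddI: "(\<And>i. f (2 * i) = g (2 * i)) \<Longrightarrow> (\<And>i. f (Suc (2 * i)) = g (Suc (2 * i))) \<Longrightarrow> f = g"
  for f :: "nat \<Rightarrow> 'a"
  by (rule ext) (metis evenE oddE Suc_eq_plus1)

lemma join_left: "\<exists>\<rho>. \<forall>e. join e f = (\<lambda>i. join e (join f g) (\<rho> i))"
  by (intro exI[of _ "join (\<lambda>i. 2 * i) (\<lambda>i. Suc (2 * (2 * i)))"] allI eq_even_oddI)
    (simp_all only: join_even_odd)

lemma join_right: "\<exists>\<rho>. \<forall>e. join e g = (\<lambda>i. join e (join f g) (\<rho> i))"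
  by (intro exI[of _ "join (\<lambda>i. 2 * i) (\<lambda>i. Suc (2 * Suc (2 * i)))"] allI eq_even_oddI)
    (simp_all only: join_even_odd)

text \<open>The renaming must not depend on x, because x is about to be quantified.\<close>

lemma join_case_nat: "\<exists>\<rho>. \<forall>x e f. join (case_nat x e) f = (\<lambda>i. case_nat x (join e f) (\<rho> i))"
  by (intro exI[of _ "join (case_nat 0 (\<lambda>i. Suc (2 * i))) (\<lambda>i. Suc (Suc (2 * i)))"] allI eq_even_oddI)
    (simp_all split: nat.split)

lemma join_case_nat2:
  "\<exists>\<rho>. \<forall>x y e f. join (case_nat y (case_nat x e)) f = (\<lambda>i. case_nat y (case_nat x (join e f)) (\<rho> i))"
  by (intro exI[of _ "join (case_nat 0 (case_nat 1 (\<lambda>i. Suc (Suc (2 * i))))) (\<lambda>i. Suc (Suc (Suc (2 * i))))"]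
      allI eq_even_oddI) (simp_all split: nat.split)

lemma Delta0_subst: "Delta0 p \<Longrightarrow> Delta0 (subst f g p)"
proof (induction p arbitrary: f g rule: Delta0.induct)
  case (6 p t)
  show ?case using Delta0.intros(6)[OF 6(2)] by (simp add: tsubst_up_tlift)
next
  case (7 p t)
  show ?case using Delta0.intros(7)[OF 7(2)]
    by (simp add: tsubst_up_tlift Exists_def And_def Neg_def)
qed (auto intro: Delta0.intros)

lemma tval_rename: "tval M (tsubst (\<lambda>i. Var (\<rho> i)) t) e = tval M t (\<lambda>i. e (\<rho> i))"
  by (simp add: tval_tsubst)

lemma tval_join_left:
  "\<exists>\<rho>. \<forall>u e. tval M u (join e f) = tval M (tsubst (\<lambda>i. Var (\<rho> i)) u) (join e (join f g))"
proof -
  obtain \<rho> where \<rho>: "\<forall>e. join e f = (\<lambda>i. join e (join f g) (\<rho> i))" using join_left by blast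
  have "tval M u (join e f) = tval M (tsubst (\<lambda>i. Var (\<rho> i)) u) (join e (join f g))" for u e
    unfolding tval_rename by (rule arg_cong[OF \<rho>[rule_format]])
  then show ?thesis by blast
qed

lemma tval_join_right:
  "\<exists>\<rho>. \<forall>u e. tval M u (join e g) = tval M (tsubst (\<lambda>i. Var (\<rho> i)) u) (join e (join f g))"
proof -
  obtain \<rho> where \<rho>: "\<forall>e. join e g = (\<lambda>i. join e (join f g) (\<rho> i))" using join_right by blast
  have "tval M u (join e g) = tval M (tsubst (\<lambda>i. Var (\<rho> i)) u) (join e (join f g))" for u e
    unfolding tval_rename by (rule arg_cong[OF \<rho>[rule_format]])
  then show ?thesis by blast
qed

lemma sat_rename: "sat M (subst (\<lambda>i. Var (\<rho> i)) \<sigma> p) e E \<longleftrightarrow> sat M p (\<lambda>i. e (\<rho> i)) (\<lambda>X. E (\<sigma> X))"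
  by (simp add: sat_subst)

lemma dterm_tm: "dterm t \<Longrightarrow> \<exists>u f. \<forall>e. t e = tval the_model u (join e f)"
proof (induction rule: dterm.induct)
  case (dterm_var i)
  show ?case by (rule exI[of _ "Var (2 * i)"]) (simp add: join_def)
next
  case (dterm_const c)
  show ?case by (rule exI[of _ "Var 1"], rule exI[of _ "\<lambda>_. c"]) (simp add: join_def)
next
  case (dterm_add s t)
  then obtain u f v g where
    "\<forall>e. s e = tval the_model u (join e f)" "\<forall>e. t e = tval the_model v (join e g)" by blast
  moreover obtain \<rho> where "\<forall>u e. tval the_model u (join e f) =
      tval the_model (tsubst (\<lambda>i. Var (\<rho> i)) u) (join e (join f g))" using tval_join_left by blast
  moreover obtain \<sigma> where "\<forall>u e. tval the_model u (join e g) =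
      tval the_model (tsubst (\<lambda>i. Var (\<sigma> i)) u) (join e (join f g))" using tval_join_right by blast
  ultimately show ?case
    by (intro exI[of _ "Add (tsubst (\<lambda>i. Var (\<rho> i)) u) (tsubst (\<lambda>i. Var (\<sigma> i)) v)"] exI[of _ "join f g"])
      (simp add:  plus_mnat_def)
next
  case (dterm_mult s t)
  then obtain u f v g where
    "\<forall>e. s e = tval the_model u (join e f)" "\<forall>e. t e = tval the_model v (join e g)" by blast
  moreover obtain \<rho> where "\<forall>u e. tval the_model u (join e f) =
      tval the_model (tsubst (\<lambda>i. Var (\<rho> i)) u) (join e (join f g))" using tval_join_left by blast
  moreover obtain \<sigma> where "\<forall>u e. tval the_model u (join e g) =
      tval the_model (tsubst (\<lambda>i. Var (\<sigma> i)) u) (join e (join f g))" using tval_join_right by blast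
  ultimately show ?case
    by (intro exI[of _ "Mult (tsubst (\<lambda>i. Var (\<rho> i)) u) (tsubst (\<lambda>i. Var (\<sigma> i)) v)"] exI[of _ "join f g"])
      (simp add:  times_mnat_def)
qed

lemma dterm_tm2:
  assumes "dterm s" "dterm t"
  shows "\<exists>u v f. \<forall>e. s e = tval the_model u (join e f) \<and> t e = tval the_model v (join e f)"
proof -
  obtain u f v g where
    "\<forall>e. s e = tval the_model u (join e f)" "\<forall>e. t e = tval the_model v (join e g)"
    using assms dterm_tm by meson
  moreover obtain \<rho> where "\<forall>u e. tval the_model u (join e f) =
      tval the_model (tsubst (\<lambda>i. Var (\<rho> i)) u) (join e (join f g))" using tval_join_left by blast
  moreover obtain \<sigma> where "\<forall>u e. tval the_model u (join e g) =
      tval the_model (tsubst (\<lambda>i. Var (\<sigma> i)) u) (join e (join f g))" using tval_join_right by blast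
  ultimately show ?thesis
    by (intro exI[of _ "tsubst (\<lambda>i. Var (\<rho> i)) u"] exI[of _ "tsubst (\<lambda>i. Var (\<sigma> i)) v"] exI[of _ "join f g"])
      simp
qed

text \<open>The bridge from HOL predicates to formulas. One formula and one choice of parameters
  must work for all e; the parameters of subformulas are interleaved by renamings that are uniform
  in e.\<close>

lemma delta0_fm:
  "delta0 P \<Longrightarrow> \<exists>p f F. Delta0 p \<and> range F \<subseteq> sets \<and> (\<forall>e. P e \<longleftrightarrow> sat the_model p (join e f) F)"
proof (induction rule: delta0.induct)
  case (delta0_eq s t)
  from dterm_tm2[OF this] obtain u v f where
    "\<forall>e. s e = tval the_model u (join e f) \<and> t e = tval the_model v (join e f)"
    by blast
  moreover obtain A where "A \<in> sets" using sets_nonempty by blast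
  ultimately show ?case
    by (intro exI[of _ "Eq u v"] exI[of _ f] exI[of _ "\<lambda>_. A"]) (auto intro: Delta0.intros)
next
  case (delta0_less s t)
  from dterm_tm2[OF this] obtain u v f where
    "\<forall>e. s e = tval the_model u (join e f) \<and> t e = tval the_model v (join e f)"
    by blast
  moreover obtain A where "A \<in> sets" using sets_nonempty by blast
  ultimately show ?case
    by (intro exI[of _ "Less u v"] exI[of _ f] exI[of _ "\<lambda>_. A"]) (auto intro: Delta0.intros simp: less_mnat_def)
next
  case (delta0_mem t A)
  from dterm_tm[OF this(1)] obtain u f where "\<forall>e. t e = tval the_model u (join e f)" by blast
  then show ?case using delta0_mem
    by (intro exI[of _ "Mem u 0"] exI[of _ f] exI[of _ "\<lambda>_. A"]) (auto intro: Delta0.intros)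
next
  case delta0_False
  obtain A where "A \<in> sets" using sets_nonempty by blast
  then show ?case by (intro exI[of _ Fls] exI exI[of _ "\<lambda>_. A"]) (auto intro: Delta0.intros)
next
  case (delta0_imp P Q)
  from delta0_imp.IH(1) obtain p f F where
    p: "Delta0 p" "range F \<subseteq> sets" "\<forall>e. P e \<longleftrightarrow> sat the_model p (join e f) F" by (elim exE conjE)
  from delta0_imp.IH(2) obtain q g G where
    q: "Delta0 q" "range G \<subseteq> sets" "\<forall>e. Q e \<longleftrightarrow> sat the_model q (join e g) G" by (elim exE conjE)
  obtain \<rho> where \<rho>: "\<forall>e. join e f = (\<lambda>i. join e (join f g) (\<rho> i))" using join_left by blast
  obtain \<sigma> where \<sigma>: "\<forall>e. join e g = (\<lambda>i. join e (join f g) (\<sigma> i))" using join_right by blast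
  have FG: "F = (\<lambda>X. join F G (2 * X))" "G = (\<lambda>X. join F G (2 * X + 1))"
    by (simp_all add: join_def fun_eq_iff)
  show ?case
  proof (intro exI conjI allI)
    show "Delta0 (Imp (subst (\<lambda>i. Var (\<rho> i)) (\<lambda>X. 2 * X) p) (subst (\<lambda>i. Var (\<sigma> i)) (\<lambda>X. 2 * X + 1) q))"
      using p(1) q(1) by (intro Delta0.intros Delta0_subst)
    show "range (join F G) \<subseteq> sets" using p(2) q(2) by (auto simp: join_def)
    show "(P e \<longrightarrow> Q e) \<longleftrightarrow>
        sat the_model (Imp (subst (\<lambda>i. Var (\<rho> i)) (\<lambda>X. 2 * X) p) (subst (\<lambda>i. Var (\<sigma> i)) (\<lambda>X. 2 * X + 1) q))
          (join e (join f g)) (join F G)" for e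
      unfolding p(3)[rule_format] q(3)[rule_format] sat.simps(5) sat_rename FG[symmetric]
      using \<rho> \<sigma> by metis
  qed
next
  case (delta0_ball' t P)
  from delta0_ball'.IH obtain p f F where
    p: "Delta0 p" "range F \<subseteq> sets" "\<forall>e. P e \<longleftrightarrow> sat the_model p (join e f) F" by (elim exE conjE)
  from dterm_tm[OF delta0_ball'(1)] obtain u g where u: "\<forall>e. t e = tval the_model u (join e g)" by blast
  obtain \<rho> where \<rho>: "\<forall>e. join e f = (\<lambda>i. join e (join f g) (\<rho> i))" using join_left by blast
  obtain \<sigma> where \<sigma>: "\<forall>e. join e g = (\<lambda>i. join e (join f g) (\<sigma> i))" using join_right by blast
  obtain \<tau> where \<tau>: "\<forall>x e f. join (case_nat x e) f = (\<lambda>i. case_nat x (join e f :: nat \<Rightarrow> mnat) (\<tau> i))"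
    using join_case_nat by (elim exE) (rule that)
  let ?p = "subst (\<lambda>i. Var (\<tau> (\<rho> i))) (\<lambda>X. X) p"
  let ?u = "tsubst (\<lambda>i. Var (\<sigma> i)) u"
  show ?case
  proof (intro exI conjI allI)
    show "Delta0 (Forall (Imp (Less (Var 0) (tlift ?u)) ?p))"
      using p(1) by (intro Delta0.intros Delta0_subst)
    show "range F \<subseteq> sets" by (rule p(2))
    have 1: "P (case_nat x e) \<longleftrightarrow> sat the_model ?p (case_nat x (join e (join f g))) F" for e x
    proof -
      have "join (case_nat x e) f = (\<lambda>i. join (case_nat x e) (join f g) (\<rho> i))" using \<rho> by blast
      also have "\<dots> = (\<lambda>i. case_nat x (join e (join f g)) (\<tau> (\<rho> i)))" using \<tau> by metis
      finally show ?thesis unfolding p(3)[rule_format] sat_rename by simp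
    qed
    show "(\<forall>x. x < t e \<longrightarrow> P (case_nat x e)) \<longleftrightarrow>
        sat the_model (Forall (Imp (Less (Var 0) (tlift ?u)) ?p)) (join e (join f g)) F" for e
      using \<sigma>[rule_format, of e] by (simp add: 1 u tval_rename less_mnat_def)
  qed
qed

definition sigma1 :: "((nat \<Rightarrow> mnat) \<Rightarrow> bool) \<Rightarrow> bool" where
  "sigma1 P \<longleftrightarrow> (\<exists>Q. delta0 Q \<and> P = (\<lambda>e. \<exists>y. Q (case_nat y e)))"

text \<open>Counting e among the parameters leaves x as the distinguished variable, as the two axiom
  schemes require.\<close>

lemma sigma1_fm:
  assumes "sigma1 P"
  shows "\<exists>p f F. Delta0 p \<and> range F \<subseteq> sets \<and>
    (\<forall>x. P (case_nat x e) \<longleftrightarrow> (\<exists>y. sat the_model p (case_nat y (case_nat x f)) F))"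
proof -
  obtain Q where Q: "delta0 Q" "P = (\<lambda>e. \<exists>y. Q (case_nat y e))" using assms sigma1_def by blast
  obtain p f F where p: "Delta0 p" "range F \<subseteq> sets" "\<forall>e. Q e \<longleftrightarrow> sat the_model p (join e f) F"
    using delta0_fm[OF Q(1)] by (elim exE conjE)
  obtain \<rho> where \<rho>: "\<forall>x y e f. join (case_nat y (case_nat x e)) f =
      (\<lambda>i. case_nat y (case_nat x (join e f :: nat \<Rightarrow> mnat)) (\<rho> i))"
    using join_case_nat2 by (elim exE) (rule that)
  show ?thesis
  proof (intro exI conjI allI)
    show "Delta0 (subst (\<lambda>i. Var (\<rho> i)) (\<lambda>X. X) p)" using p(1) by (rule Delta0_subst)
    show "range F \<subseteq> sets" by (rule p(2))
    have "Q (case_nat y (case_nat x e)) \<longleftrightarrow>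
      sat the_model (subst (\<lambda>i. Var (\<rho> i)) (\<lambda>X. X) p) (case_nat y (case_nat x (join e f))) F" for x y
      by (subst p(3)[rule_format], subst \<rho>[rule_format], subst sat_rename, rule refl)
    then show "P (case_nat x e) \<longleftrightarrow>
      (\<exists>y. sat the_model (subst (\<lambda>i. Var (\<rho> i)) (\<lambda>X. X) p) (case_nat y (case_nat x (join e f))) F)" for x
      by (simp only: Q(2))
  qed
qed

lemma induction_axiom_RCA0: "Delta0 p \<Longrightarrow> induction_axiom (Exists p) \<in> RCA0"
  by (auto simp: RCA0_def Sigma1_def)

lemma comprehension_axiom_RCA0:
  "Delta0 p \<Longrightarrow> Delta0 q \<Longrightarrow> comprehension_axiom (Exists p) (Forall q) \<in> RCA0"
  unfolding RCA0_def Sigma1_def Pi1_def by blast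

lemma sigma1_induct_env:
  assumes "sigma1 P" "P (case_nat 0 e)" "\<And>x. P (case_nat x e) \<Longrightarrow> P (case_nat (x + 1) e)"
  shows "P (case_nat x e)"
proof -
  obtain p f F where p: "Delta0 p" "range F \<subseteq> sets"
    "\<forall>x. P (case_nat x e) \<longleftrightarrow> (\<exists>y. sat the_model p (case_nat y (case_nat x f)) F)"
    using sigma1_fm[OF assms(1), where e = e] by (elim exE conjE)
  have P: "sat the_model (Exists p) (case_nat x f) F \<longleftrightarrow> P (case_nat x e)" for x
    by (simp only: sat_connectives p(3))
  have ind: "P (case_nat 0 e) \<longrightarrow> (\<forall>x. P (case_nat x e) \<longrightarrow> P (case_nat (x + 1) e)) \<longrightarrow> (\<forall>x. P (case_nat x e))"
    using the_model_sat[OF induction_axiom_RCA0[OF p(1)] p(2), of f]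
    by (simp only: sat_induction_axiom model_ops P)
  have step: "\<forall>x. P (case_nat x e) \<longrightarrow> P (case_nat (x + 1) e)"
    by (intro allI impI) (rule assms(3))
  show ?thesis by (rule spec[OF mp[OF mp[OF ind assms(2)] step]])
qed

lemma comprehension_env:
  assumes "sigma1 P" "sigma1 (\<lambda>e. \<not> P e)"
  shows "{x. P (case_nat x e)} \<in> sets"
proof -
  obtain p f F where p: "Delta0 p" "range F \<subseteq> sets"
    "\<forall>x. P (case_nat x e) \<longleftrightarrow> (\<exists>y. sat the_model p (case_nat y (case_nat x f)) F)"
    using sigma1_fm[OF assms(1), where e = e] by (elim exE conjE)
  obtain q g G where q: "Delta0 q" "range G \<subseteq> sets"
    "\<forall>x. \<not> P (case_nat x e) \<longleftrightarrow> (\<exists>y. sat the_model q (case_nat y (case_nat x g)) G)"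
    using sigma1_fm[OF assms(2), where e = e] by (elim exE conjE)
  \<comment> \<open>Keeps the two leading variables y and x and sends the other indices to the even
    (k = 0) or odd (k = 1) positions of the joined parameters.\<close>
  define \<rho> :: "nat \<Rightarrow> nat \<Rightarrow> nat" where "\<rho> k = case_nat 0 (case_nat 1 (\<lambda>i. 2 + (2 * i + k)))" for k
  have \<rho>0: "(\<lambda>i. case_nat y (case_nat x (join f g)) (\<rho> 0 i)) = case_nat y (case_nat x f)" for x y
    by (rule ext) (simp add: \<rho>_def join_def split: nat.split)
  have \<rho>1: "(\<lambda>i. case_nat y (case_nat x (join f g)) (\<rho> 1 i)) = case_nat y (case_nat x g)" for x y
    by (rule ext) (simp add: \<rho>_def join_def split: nat.split)
  have FG: "F = (\<lambda>X. join F G (2 * X))" "G = (\<lambda>X. join F G (2 * X + 1))"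
    by (simp_all add: join_def fun_eq_iff)
  let ?p = "subst (\<lambda>i. Var (\<rho> 0 i)) (\<lambda>X. 2 * X) p" and ?q = "subst (\<lambda>i. Var (\<rho> 1 i)) (\<lambda>X. 2 * X + 1) q"
  have "Delta0 (Neg ?q)" unfolding Neg_def using q(1) by (intro Delta0.intros Delta0_subst)
  then have "comprehension_axiom (Exists ?p) (Forall (Neg ?q)) \<in> RCA0"
    by (intro comprehension_axiom_RCA0 Delta0_subst p(1))
  moreover have "range (join F G) \<subseteq> sets" using p(2) q(2) by (auto simp: join_def)
  ultimately have "sat the_model (comprehension_axiom (Exists ?p) (Forall (Neg ?q))) (join f g) (join F G)"
    by (rule the_model_sat)
  moreover have "sat the_model (Exists ?p) (case_nat x (join f g)) (join F G) \<longleftrightarrow> P (case_nat x e)" for x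
    by (simp only: sat_connectives sat_rename \<rho>0 FG[symmetric] p(3))
  moreover have "sat the_model (Forall (Neg ?q)) (case_nat x (join f g)) (join F G) \<longleftrightarrow> P (case_nat x e)" for x
  proof -
    have "sat the_model (Forall (Neg ?q)) (case_nat x (join f g)) (join F G) \<longleftrightarrow> \<not> \<not> P (case_nat x e)"
      unfolding q(3)[rule_format] by (simp only: sat.simps(6) sat_connectives sat_rename \<rho>1 FG[symmetric] not_ex)
    then show ?thesis by simp
  qed
  ultimately have "\<exists>A\<in>sets. \<forall>x. x \<in> A \<longleftrightarrow> P (case_nat x e)"
    by (simp only: sat_comprehension_axiom) simp
  then obtain A where "A \<in> sets" "A = {x. P (case_nat x e)}" by blast
  then show ?thesis by simp
qed

lemma dterm_subst: "dterm t \<Longrightarrow> (\<And>i. dterm (\<lambda>e. f e i)) \<Longrightarrow> dterm (\<lambda>e. t (f e))"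
  by (induction rule: dterm.induct) (simp_all add: dterm.intros)

lemma delta0_subst: "delta0 P \<Longrightarrow> (\<And>i. dterm (\<lambda>e. f e i)) \<Longrightarrow> delta0 (\<lambda>e. P (f e))"
proof (induction arbitrary: f rule: delta0.induct)
  case (delta0_ball' t P)
  have "dterm (\<lambda>e. case_nat (e 0) (f (\<lambda>i. e (Suc i))) i)" for i
  proof (cases i)
    case 0 then show ?thesis by (simp add: dterm_var)
  next
    case (Suc j)
    have "dterm (\<lambda>e. (\<lambda>e. f e j) (\<lambda>i. e (Suc i)))"
      by (rule dterm_subst[OF delta0_ball'(4)]) (rule dterm_var)
    then show ?thesis by (simp add: Suc)
  qed
  then have "delta0 (\<lambda>e. P (case_nat (e 0) (f (\<lambda>i. e (Suc i)))))" by (rule delta0_ball'.IH)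
  from delta0.delta0_ball'[OF dterm_subst[of t f, OF delta0_ball'(1,4)] this]
  show ?case by simp
next
  case (delta0_eq s t)
  show ?case by (intro delta0.delta0_eq dterm_subst[of s f] dterm_subst[of t f] delta0_eq)
next
  case (delta0_less s t)
  show ?case by (intro delta0.delta0_less dterm_subst[of s f] dterm_subst[of t f] delta0_less)
next
  case (delta0_mem t A)
  show ?case by (intro delta0.delta0_mem dterm_subst[of t f] delta0_mem)
next
  case (delta0_imp P Q)
  show ?case by (intro delta0.delta0_imp delta0_imp.IH delta0_imp.prems)
qed (rule delta0_False)

named_theorems delta0_intros

text \<open>The premise feeds variable 0 and the shifted environment to Q. Unification can thus peel
  the quantifiers off a HOL statement without mention of \<open>case_nat\<close>.\<close>

lemma delta0_ball [delta0_intros]: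
  assumes "dterm t" "delta0 (\<lambda>e. Q (e 0) (\<lambda>i. e (Suc i)))"
  shows "delta0 (\<lambda>e. \<forall>x<t e. Q x e)"
  using delta0_ball'[OF assms] by simp

lemma delta0_not [delta0_intros]: "delta0 P \<Longrightarrow> delta0 (\<lambda>e. \<not> P e)"
  using delta0_imp[OF _ delta0_False] by simp

lemma delta0_or [delta0_intros]: "delta0 P \<Longrightarrow> delta0 Q \<Longrightarrow> delta0 (\<lambda>e. P e \<or> Q e)"
  using delta0_imp[OF delta0_not, of P Q] by (simp add: disj_imp)

lemma delta0_and [delta0_intros]: "delta0 P \<Longrightarrow> delta0 Q \<Longrightarrow> delta0 (\<lambda>e. P e \<and> Q e)"
  using delta0_not[OF delta0_or[OF delta0_not delta0_not], of P Q] by simp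

lemma delta0_iff [delta0_intros]: "delta0 P \<Longrightarrow> delta0 Q \<Longrightarrow> delta0 (\<lambda>e. P e \<longleftrightarrow> Q e)"
  using delta0_and[OF delta0_imp delta0_imp, of P Q Q P] by (simp add: iff_conv_conj_imp)

lemma delta0_le [delta0_intros]: "dterm s \<Longrightarrow> dterm t \<Longrightarrow> delta0 (\<lambda>e. s e \<le> t e)"
  using delta0_or[OF delta0_less delta0_eq, of s t s t] by (simp add: less_eq_mnat_def)

lemma delta0_bex [delta0_intros]:
  assumes "dterm t" "delta0 (\<lambda>e. Q (e 0) (\<lambda>i. e (Suc i)))"
  shows "delta0 (\<lambda>e. \<exists>x<t e. Q x e)"
  using delta0_not[OF delta0_ball[OF assms(1) delta0_not[OF assms(2)]]] by simp

declare dterm_var [delta0_intros] dterm_const [delta0_intros] dterm_add [delta0_intros]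
  dterm_mult [delta0_intros] delta0_eq [delta0_intros] delta0_less [delta0_intros]
  delta0_mem [delta0_intros] delta0_False [delta0_intros] delta0_imp [delta0_intros]

lemma sigma1_delta0: "delta0 P \<Longrightarrow> sigma1 P"
  unfolding sigma1_def
  using delta0_subst[of P "\<lambda>e i. e (Suc i)"] by (intro exI[of _ "\<lambda>e. P (\<lambda>i. e (Suc i))"]) (simp add: dterm_var)

lemma sigma1_ex_delta0:
  "delta0 (\<lambda>e. Q (e 0) (\<lambda>i. e (Suc i))) \<Longrightarrow> sigma1 (\<lambda>e. \<exists>x. Q x e)"
  unfolding sigma1_def by (intro exI[of _ "\<lambda>e. Q (e 0) (\<lambda>i. e (Suc i))"]) simp

lemma sigma1_induct [case_names definable zero suc]:
  assumes "sigma1 (\<lambda>e. P (e 0))" "P 0" "\<And>x. P x \<Longrightarrow> P (x + 1)"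
  shows "P x"
  using sigma1_induct_env[of "\<lambda>e. P (e 0)" undefined x] assms by simp

lemma delta0_induct [case_names definable zero suc]:
  assumes "delta0 (\<lambda>e. P (e 0))" "P 0" "\<And>x. P x \<Longrightarrow> P (x + 1)"
  shows "P x"
  using sigma1_induct[OF sigma1_delta0] assms by blast

section \<open>Arithmetic\<close>

lemma add_zero_left: "0 + x = x" for x :: mnat
  by (rule delta0_induct[of "\<lambda>x. 0 + x = x"]) (intro delta0_intros, auto simp: PA)

lemma add_suc_left: "x + 1 + y = x + y + 1" for x y :: mnat
  by (rule delta0_induct[of "\<lambda>y. x + 1 + y = x + y + 1"]) (intro delta0_intros, auto simp: PA)

instance mnat :: ab_semigroup_add
proof
  fix x y z :: mnat
  show "x + y + z = x + (y + z)"
    by (rule delta0_induct[of "\<lambda>z. x + y + z = x + (y + z)"]) (intro delta0_intros, auto simp: PA)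
  show "x + y = y + x"
  proof (induction y rule: delta0_induct)
    case definable show ?case by (intro delta0_intros)
  next
    case zero show ?case by (simp add: PA add_zero_left)
  next
    case (suc y)
    have "x + (y + 1) = x + y + 1" by (rule PA)
    also have "\<dots> = y + x + 1" by (simp only: suc)
    finally show ?case by (simp only: add_suc_left)
  qed
qed

instance mnat :: comm_monoid_add
  by standard (rule add_zero_left)

lemma mult_zero_left: "0 * x = 0" for x :: mnat
  by (rule delta0_induct[of "\<lambda>x. 0 * x = 0"]) (intro delta0_intros, auto simp: PA)

lemma mult_suc_left: "(x + 1) * y = x * y + y" for x y :: mnat
  by (rule delta0_induct[of "\<lambda>y. (x + 1) * y = x * y + y"])
    (intro delta0_intros, auto simp: PA ac_simps)

lemma mult_commute: "x * y = y * x" for x y :: mnat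
proof (induction y rule: delta0_induct)
  case definable show ?case by (intro delta0_intros)
next
  case zero show ?case by (simp add: PA mult_zero_left)
next
  case (suc y)
  have "x * (y + 1) = x * y + x" by (rule PA)
  also have "\<dots> = y * x + x" by (simp only: suc)
  finally show ?case by (simp only: mult_suc_left)
qed

lemma mult_one_right: "x * 1 = x" for x :: mnat
  using PA(6)[of x 0] by (simp add: PA)

lemma distrib_left': "x * (y + z) = x * y + x * z" for x y z :: mnat
  by (rule delta0_induct[of "\<lambda>z. x * (y + z) = x * y + x * z"])
    (intro delta0_intros, auto simp: PA add.assoc[symmetric])

lemma add_left_cancel': "x + y = x + z \<longleftrightarrow> y = z" for x y z :: mnat
proof -
  have "y + x = z + x \<longrightarrow> y = z"
    by (rule delta0_induct[of "\<lambda>x. y + x = z + x \<longrightarrow> y = z"])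
      (intro delta0_intros, auto simp: PA dest: PA(2))
  then show ?thesis by (auto simp: add.commute[of x])
qed

text \<open>The axioms describe the order only through successor. Once it is an equation, order
  facts become algebra. The witness z has no bound yet, hence an induction for a Sigma1
  statement.\<close>

lemma less_iff_add: "x < y \<longleftrightarrow> (\<exists>z. y = x + (z + 1))" for x y :: mnat
proof
  have "\<exists>z. x < y \<longrightarrow> y = x + (z + 1)"
  proof (induction y rule: sigma1_induct)
    case definable show ?case by (intro sigma1_ex_delta0 delta0_intros)
  next
    case zero then show ?case by (simp add: PA)
  next
    case (suc y)
    then obtain z where z: "x < y \<longrightarrow> y = x + (z + 1)" by blast
    show ?case
    proof (cases "x < y")
      case True
      have "y + 1 = x + (z + 1 + 1)"
        by (simp only: PA(4)[of x "z + 1"] z[rule_format, OF True, symmetric])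
      then show ?thesis by blast
    next
      case False
      then have "x < y + 1 \<longrightarrow> y + 1 = x + (0 + 1)" by (simp add: PA)
      then show ?thesis by blast
    qed
  qed
  then show "x < y \<Longrightarrow> \<exists>z. y = x + (z + 1)" by blast
  have "x < x + (z + 1)" for z
  proof (induction z rule: delta0_induct)
    case definable show ?case by (intro delta0_intros)
  qed (simp_all add: PA)
  then show "\<exists>z. y = x + (z + 1) \<Longrightarrow> x < y" by blast
qed

lemma mnat_cases: "x = 0 \<or> (\<exists>z. x = z + 1)" for x :: mnat
proof -
  have "\<exists>z. x = 0 \<or> x = z + 1"
    by (rule sigma1_induct[of "\<lambda>x. \<exists>z. x = 0 \<or> x = z + 1"])
      (intro sigma1_ex_delta0 delta0_intros, auto)
  then show ?thesis by blast
qed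

lemma less_eq_iff_add: "x \<le> y \<longleftrightarrow> (\<exists>z. y = x + z)" for x y :: mnat
  unfolding less_eq_mnat_def less_iff_add using mnat_cases by (metis add.commute add_0)

lemma mnat_lessE: "x < y \<Longrightarrow> (\<And>z. y = x + (z + 1) \<Longrightarrow> thesis) \<Longrightarrow> thesis" for x y :: mnat
  using less_iff_add by auto

lemma mnat_leE: "x \<le> y \<Longrightarrow> (\<And>z. y = x + z \<Longrightarrow> thesis) \<Longrightarrow> thesis" for x y :: mnat
  using less_eq_iff_add by auto

instance mnat :: comm_semiring_1
proof
  fix x y z :: mnat
  show "x * y * z = x * (y * z)"
    by (rule delta0_induct[of "\<lambda>z. x * y * z = x * (y * z)"])
      (intro delta0_intros, auto simp: PA distrib_left' mult_one_right)
  show "x * y = y * x" by (rule mult_commute)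
  show "1 * x = x" using mult_one_right[of x] by (simp only: mult_commute)
  show "(x + y) * z = x * z + y * z" by (simp only: mult_commute[of _ z] distrib_left')
  show "0 * x = 0" "x * 0 = 0" by (rule mult_zero_left, rule PA)
  show "(0::mnat) \<noteq> 1" using PA(1)[of 0] by simp
qed

instance mnat :: linorder
proof
  fix x y z :: mnat
  have nil: "z = 0" if "x + z = x" for x z :: mnat using add_left_cancel'[of x z 0] that by simp
  have pos: "z = 0 \<and> w = 0" if "z + w = 0" for z w :: mnat
    using that PA(1) mnat_cases by (metis add.assoc add.commute add_0)
  show "x \<le> x" by (simp add: less_eq_mnat_def)
  show "x \<le> z" if "x \<le> y" "y \<le> z" using that by (metis less_eq_iff_add add.assoc)
  show anti: "x = y" if xy: "x \<le> y" "y \<le> x" for x y :: mnat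
  proof -
    obtain a b where ab: "y = x + a" "x = y + b" using xy less_eq_iff_add by blast
    then have "x + (a + b) = x" by (metis add.assoc)
    then have "a = 0" using nil pos by blast
    then show ?thesis using ab(1) by (simp add: PA)
  qed
  have irrefl: "x \<noteq> y" if xy: "x < y" for x y :: mnat
  proof
    assume "x = y"
    then obtain z where "x + (z + 1) = x" using xy less_iff_add by metis
    then show False using nil PA(1) by blast
  qed
  show "x < y \<longleftrightarrow> x \<le> y \<and> \<not> y \<le> x"
    using anti[of x y] irrefl[of x y] irrefl[of y x] unfolding less_eq_mnat_def by auto
  have "x < y \<or> x = y \<or> y < x"
  proof (induction x rule: delta0_induct)
    case definable show ?case by (intro delta0_intros)
  next
    case zero
    then show ?case using mnat_cases[of y] by (auto simp: less_iff_add)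
  next
    case (suc x)
    consider "x < y" | "x = y" | "y < x" using suc by blast
    then show ?case
    proof cases
      case 1
      then obtain z where z: "y = x + (z + 1)" using less_iff_add by blast
      show ?thesis using mnat_cases[of z] z by (auto simp: less_iff_add ac_simps)
    next
      case 2 then show ?thesis by (simp add: PA)
    next
      case 3 then show ?thesis by (simp add: PA)
    qed
  qed
  then show "x \<le> y \<or> y \<le> x" by (auto simp: less_eq_mnat_def)
qed

instance mnat :: canonically_ordered_monoid_add
  by standard (rule less_eq_iff_add)

lemma add_diff_mnat: "x + y - y = x" for x y :: mnat
proof -
  have "y \<le> x + y" using less_eq_iff_add add.commute by blast
  moreover have "(THE z. x + y = z + y) = x" by (rule the_equality) (auto simp: add.commute[of _ y] add_left_cancel')
  ultimately show ?thesis by (simp add: minus_mnat_def)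
qed

lemma diff_le_mnat: "x - y = 0" if "x \<le> y" for x y :: mnat
proof (cases "x = y")
  case True then show ?thesis using add_diff_mnat[of 0 y] by simp
next
  case False then show ?thesis using that by (simp add: minus_mnat_def)
qed

lemma mult_less_mnat: "z * x < z * y" if "x < y" "0 < z" for x y z :: mnat
proof -
  from that(1) obtain a where a: "y = x + (a + 1)" by (rule mnat_lessE)
  from that(2) obtain b where b: "z = 0 + (b + 1)" by (rule mnat_lessE)
  have "z * y = z * x + (b * (a + 1) + a + 1)"
    unfolding a b by (simp add: distrib_left distrib_right ac_simps)
  then have "\<exists>c. z * y = z * x + (c + 1)" by blast
  then show ?thesis by (simp only: less_iff_add)
qed

lemma add_less_mnat: "z + x < z + y \<longleftrightarrow> x < y" for x y z :: mnat
  by (simp add: less_iff_add add.assoc add_left_cancel')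

instance mnat :: discrete_linordered_semidom
proof
  fix x y z :: mnat
  show "x + y - x = y" using add_diff_mnat[of y x] by (simp add: add.commute)
  show "x - y - z = x - (y + z)"
  proof (cases "y + z \<le> x")
    case True
    then obtain a where "x = y + z + a" by (rule mnat_leE)
    then have a: "x = a + z + y" by (simp only: ac_simps)
    have "x - y - z = a" unfolding a by (simp only: add_diff_mnat)
    moreover have "x - (y + z) = a" using add_diff_mnat[of a "y + z"] unfolding a by (simp add: ac_simps)
    ultimately show ?thesis by simp
  next
    case False
    have "x - y \<le> z"
    proof (cases "y \<le> x")
      case True
      then obtain a where "x = y + a" by (rule mnat_leE)
      then have a: "x = a + y" by (simp only: ac_simps)
      then have "y + a < y + z" using False by (simp add: add.commute)
      then show ?thesis using a by (simp add: add_diff_mnat add_less_mnat)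
    qed (simp add: diff_le_mnat)
    then show ?thesis using False by (simp add: diff_le_mnat)
  qed
  show "z * (x - y) = z * x - z * y"
  proof (cases "y \<le> x")
    case True
    then obtain a where "x = y + a" by (rule mnat_leE)
    then have "x = a + y" by (simp only: ac_simps)
    then show ?thesis by (simp add: add_diff_mnat distrib_left)
  next
    case False
    then have "x < y" by simp
    then have "z * x \<le> z * y" using mult_less_mnat[of x y z] by (cases "z = 0") (auto simp: zero_less_iff_neq_zero)
    then show ?thesis using \<open>x < y\<close> by (simp add: diff_le_mnat)
  qed
  show "(0::mnat) < 1" using less_iff_add[of 0 1] by auto
  show "x < y \<Longrightarrow> 0 < z \<Longrightarrow> z * x < z * y" by (rule mult_less_mnat)
  show "y \<le> x \<Longrightarrow> x - y + y = x" using add_diff_mnat by (auto simp: less_eq_iff_add add.commute[of y])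
  show "x \<noteq> 0 \<Longrightarrow> y \<noteq> 0 \<Longrightarrow> x * y \<noteq> 0"
    using mult_less_mnat[of 0 y x] by (simp add: zero_less_iff_neq_zero)
  show "x < y \<longleftrightarrow> x + 1 \<le> y" by (simp only: less_iff_add less_eq_iff_add ac_simps)
qed

text \<open>Linear arithmetic is only automated for ordered rings, so the semiring is embedded into its ring of differences.\<close>

quotient_type mint = "mnat \<times> mnat" / "\<lambda>(a, b) (c, d). a + d = c + b"
proof (rule equivpI)
  show "transp (\<lambda>(a, b :: mnat) (c, d). a + d = c + b)"
  proof (rule transpI, clarify)
    fix a b c d u v :: mnat
    assume "a + d = c + b" "c + v = u + d"
    then have "(a + d) + (c + v) = (c + b) + (u + d)" by simp
    then have "(a + v) + (c + d) = (u + b) + (c + d)" by (simp only: ac_simps)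
    then show "a + v = u + b" by simp
  qed
qed (auto intro!: reflpI sympI)

instantiation mint :: linordered_idom
begin

lift_definition zero_mint :: mint is "(0, 0)" .
lift_definition one_mint :: mint is "(1, 0)" .
lift_definition plus_mint :: "mint \<Rightarrow> mint \<Rightarrow> mint" is "\<lambda>(a, b) (c, d). (a + c, b + d)"
proof (clarify)
  fix a b c d a' b' c' d' :: mnat
  assume "a + b' = a' + b" "c + d' = c' + d"
  then have "(a + b') + (c + d') = (a' + b) + (c' + d)" by simp
  then show "a + c + (b' + d') = a' + c' + (b + d)" by (simp only: ac_simps)
qed
lift_definition uminus_mint :: "mint \<Rightarrow> mint" is "\<lambda>(a, b). (b, a)"
  by (clarsimp simp: ac_simps)
lift_definition minus_mint :: "mint \<Rightarrow> mint \<Rightarrow> mint" is "\<lambda>(a, b) (c, d). (a + d, b + c)"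
proof (clarify)
  fix a b c d a' b' c' d' :: mnat
  assume "a + b' = a' + b" "c + d' = c' + d"
  then have "(a + b') + (c' + d) = (a' + b) + (c + d')" by simp
  then show "a + d + (b' + c') = a' + d' + (b + c)" by (simp only: ac_simps)
qed
lift_definition times_mint :: "mint \<Rightarrow> mint \<Rightarrow> mint" is "\<lambda>(a, b) (c, d). (a * c + b * d, a * d + b * c)"
proof (clarify)
  fix a b c d a' b' c' d' :: mnat
  assume "a + b' = a' + b" "c + d' = c' + d"
  then have "(a + b') * c = (a' + b) * c" "(a + b') * d = (a' + b) * d"
    "a' * (c + d') = a' * (c' + d)" "b' * (c + d') = b' * (c' + d)" by simp_all
  then have "(a + b') * c + (a' + b) * d + a' * (c + d') + b' * (c' + d) =
      (a' + b) * c + (a + b') * d + a' * (c' + d) + b' * (c + d')" by simp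
  then have "a * c + b * d + (a' * d' + b' * c') + (b' * c + a' * d + a' * c + b' * d) =
      a' * c' + b' * d' + (a * d + b * c) + (b' * c + a' * d + a' * c + b' * d)"
    by (simp add: algebra_simps)
  then show "a * c + b * d + (a' * d' + b' * c') = a' * c' + b' * d' + (a * d + b * c)" by simp
qed
lift_definition less_eq_mint :: "mint \<Rightarrow> mint \<Rightarrow> bool" is "\<lambda>(a, b) (c, d). a + d \<le> c + b"
proof (clarify)
  fix a b c d a' b' c' d' :: mnat
  assume *: "a + b' = a' + b" "c + d' = c' + d"
  have "a + d \<le> c + b \<longleftrightarrow> (a + d) + (b' + d') \<le> (c + b) + (b' + d')" by simp
  also have "(a + d) + (b' + d') = (a + b') + (d + d')" by (simp only: ac_simps)
  also have "\<dots> = (a' + d') + (b + d)" by (simp only: * ac_simps)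
  also have "(c + b) + (b' + d') = (c + d') + (b + b')" by (simp only: ac_simps)
  also have "\<dots> = (c' + b') + (b + d)" by (simp only: * ac_simps)
  finally show "a + d \<le> c + b \<longleftrightarrow> a' + d' \<le> c' + b'" by simp
qed
definition less_mint :: "mint \<Rightarrow> mint \<Rightarrow> bool" where "(x::mint) < y \<longleftrightarrow> x \<le> y \<and> \<not> y \<le> x"
definition abs_eq: "\<bar>x::mint\<bar> = (if x < 0 then - x else x)"
definition sgn_mint :: "mint \<Rightarrow> mint" where "sgn (x::mint) = (if x = 0 then 0 else if 0 < x then 1 else - 1)"

instance
proof
  fix x y z :: mint
  show "x + y + z = x + (y + z)" "x + y = y + x" "0 + x = x" "- x + x = 0" "x - y = x + - y"
    "x + y - x = y" "x - y - z = x - (y + z)"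
    by (transfer, clarsimp simp: ac_simps)+
  show "0 * x = 0" "x * 0 = 0" by (transfer, clarsimp)+
  show "x * y * z = x * (y * z)" "x * y = y * x" "1 * x = x" "(x + y) * z = x * z + y * z"
    by (transfer, clarsimp simp: algebra_simps)+
  show "(0::mint) \<noteq> 1" by transfer simp
  show "x < y \<longleftrightarrow> x \<le> y \<and> \<not> y \<le> x" by (rule less_mint_def)
  show "x \<le> x" by transfer (clarsimp simp: ac_simps)
  show "x \<le> y \<Longrightarrow> y \<le> x \<Longrightarrow> x = y" by transfer (clarsimp simp: ac_simps)
  show "x \<le> z" if "x \<le> y" "y \<le> z"
    using that
  proof (transfer, clarify)
    fix a b c d u v :: mnat
    assume "a + d \<le> c + b" "c + v \<le> u + d"
    then have "(a + d) + (c + v) \<le> (c + b) + (u + d)" by (rule add_mono)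
    then have "(a + v) + (c + d) \<le> (u + b) + (c + d)" by (simp only: ac_simps)
    then show "a + v \<le> u + b" by simp
  qed
  show linear: "x \<le> y \<or> y \<le> x" for x y :: mint by transfer (auto simp: not_le)
  show "z + x \<le> z + y" if "x \<le> y"
    using that
  proof (transfer, clarify)
    fix a b c d u v :: mnat
    assume "c + v \<le> u + d"
    then have "(a + b) + (c + v) \<le> (a + b) + (u + d)" by simp
    then show "a + c + (b + v) \<le> a + u + (b + d)" by (simp only: ac_simps)
  qed
  have mono: "\<not> z * y \<le> z * x" if "\<not> y \<le> x" "\<not> z \<le> 0"
    using that
  proof (transfer, clarify)
    fix u v c d a b :: mnat
    assume "\<not> c + b \<le> a + d" "\<not> u + 0 \<le> 0 + v"
      and le: "u * c + v * d + (u * b + v * a) \<le> u * a + v * b + (u * d + v * c)"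
    then have *: "a + d < c + b" "v < u" by simp_all
    from *(2) obtain w' where "u = v + (w' + 1)" by (rule mnat_lessE)
    then obtain w where u: "u = v + w" "0 < w" by (metis add_pos_nonneg zero_le zero_less_one add.commute)
    have "w * (a + d) < w * (c + b)" using *(1) u(2) by (rule mult_strict_left_mono)
    \<comment> \<open>The added term is what both sides share once u is expanded as
      \<open>v + w\<close>.\<close>
    then have "(v * (a + b + c + d)) + w * (a + d) < (v * (a + b + c + d)) + w * (c + b)" by simp
    then have "u * a + v * b + (u * d + v * c) < u * c + v * d + (u * b + v * a)"
      unfolding u by (simp add: algebra_simps)
    then show False using le by simp
  qed
  show "x < y \<Longrightarrow> 0 < z \<Longrightarrow> z * x < z * y"
    using mono linear unfolding less_mint_def by blast
  show "\<bar>x\<bar> = (if x < 0 then - x else x)" by (rule abs_eq)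
  show "sgn x = (if x = 0 then 0 else if 0 < x then 1 else - 1)" by (rule sgn_mint_def)
qed

end

lift_definition mint :: "mnat \<Rightarrow> mint" is "\<lambda>a. (a, 0)" .

lemma mint_eq_iff: "x = y \<longleftrightarrow> mint x = mint y" by transfer simp
lemma mint_le_iff: "x \<le> y \<longleftrightarrow> mint x \<le> mint y" by transfer simp
text \<open>Discreteness is put into the translation, since linear arithmetic over ordered rings
  does not know it.\<close>

lemma mint_less_iff: "x < y \<longleftrightarrow> mint x + 1 \<le> mint y"
  unfolding less_iff_succ_less_eq by transfer simp
lemma mint_add: "mint (x + y) = mint x + mint y" by transfer simp
lemma mint_0: "mint 0 = 0" by transfer simp
lemma mint_1: "mint 1 = 1" by transfer simp
lemma mint_nonneg: "0 \<le> mint x" by transfer simp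
lemma mint_numeral: "mint (numeral k) = numeral k"
  by (induction k) (simp_all only: numeral.simps mint_1 mint_add)

lemmas to_mint = mint_eq_iff mint_le_iff mint_less_iff mint_add mint_0 mint_1 mint_numeral not_less not_le

section \<open>Closure properties of the arithmetical hierarchy\<close>

lemma dterm_case_nat [delta0_intros]:
  "dterm a \<Longrightarrow> (\<And>i. dterm (\<lambda>e. f e i)) \<Longrightarrow> dterm (\<lambda>e. case_nat (a e) (f e) i)"
  by (cases i) simp_all

lemma dterm_shift: "dterm t \<Longrightarrow> dterm (\<lambda>e. t (\<lambda>i. e (Suc i)))"
  by (erule dterm_subst) (rule dterm_var)

lemma sigma1_subst:
  assumes "sigma1 P" "\<And>i. dterm (\<lambda>e. f e i)" shows "sigma1 (\<lambda>e. P (f e))"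
proof -
  obtain Q where Q: "delta0 Q" "P = (\<lambda>e. \<exists>y. Q (case_nat y e))" using assms(1) unfolding sigma1_def by blast
  have "dterm (\<lambda>e. f (\<lambda>i. e (Suc i)) i)" for i
    by (rule dterm_subst[OF assms(2)]) (rule dterm_var)
  then have "delta0 (\<lambda>e. Q (case_nat (e 0) (f (\<lambda>i. e (Suc i)))))"
    by (intro delta0_subst[OF Q(1)] delta0_intros)
  then show ?thesis unfolding Q(2) by (rule sigma1_ex_delta0)
qed

text \<open>The two unbounded quantifiers merge into a common bound w for both witnesses, before
  pairing is available.\<close>

lemma sigma1_ex:
  assumes "sigma1 (\<lambda>e. Q (e 0) (\<lambda>i. e (Suc i)))" shows "sigma1 (\<lambda>e. \<exists>x. Q x e)"
proof -
  obtain R where R: "delta0 R" "(\<lambda>e. Q (e 0) (\<lambda>i. e (Suc i))) = (\<lambda>e. \<exists>y. R (case_nat y e))"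
    using assms unfolding sigma1_def by blast
  have Q: "Q x e \<longleftrightarrow> (\<exists>y. R (case_nat y (case_nat x e)))" for x e
    using fun_cong[OF R(2), of "case_nat x e"] by simp
  have "delta0 (\<lambda>e. \<exists>x<e 0. \<exists>y<e 0. R (case_nat y (case_nat x (\<lambda>i. e (Suc i)))))"
    by (intro delta0_intros delta0_subst[OF R(1)])
  then have "sigma1 (\<lambda>e. \<exists>w. \<exists>x<w. \<exists>y<w. R (case_nat y (case_nat x e)))"
    by (rule sigma1_ex_delta0)
  moreover have "(\<exists>w. \<exists>x<w. \<exists>y<w. R (case_nat y (case_nat x e))) \<longleftrightarrow> (\<exists>x. Q x e)" for e
  proof
    assume "\<exists>x. Q x e"
    then obtain x y where xy: "R (case_nat y (case_nat x e))" using Q by blast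
    have "x < x + y + 1" "y < x + y + 1" using mint_nonneg[of x] mint_nonneg[of y] by (simp_all add: to_mint)
    then show "\<exists>w. \<exists>x<w. \<exists>y<w. R (case_nat y (case_nat x e))" using xy by blast
  qed (use Q in blast)
  ultimately show ?thesis by simp
qed

named_theorems sigma1_intros

declare sigma1_ex [sigma1_intros]

lemma sigma1_and [sigma1_intros]:
  assumes "sigma1 P" "sigma1 Q" shows "sigma1 (\<lambda>e. P e \<and> Q e)"
proof -
  obtain R S where R: "delta0 R" "P = (\<lambda>e. \<exists>y. R (case_nat y e))"
    and S: "delta0 S" "Q = (\<lambda>e. \<exists>y. S (case_nat y e))"
    using assms unfolding sigma1_def by blast
  have "sigma1 (\<lambda>e. \<exists>y z. R (case_nat y e) \<and> S (case_nat z e))"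
    by (intro sigma1_ex sigma1_delta0 delta0_intros delta0_subst[OF R(1)] delta0_subst[OF S(1)])
  then show ?thesis by (simp add: R S)
qed

lemma sigma1_or [sigma1_intros]:
  assumes "sigma1 P" "sigma1 Q" shows "sigma1 (\<lambda>e. P e \<or> Q e)"
proof -
  obtain R S where R: "delta0 R" "P = (\<lambda>e. \<exists>y. R (case_nat y e))"
    and S: "delta0 S" "Q = (\<lambda>e. \<exists>y. S (case_nat y e))"
    using assms unfolding sigma1_def by blast
  have "sigma1 (\<lambda>e. \<exists>y. R (case_nat y e) \<or> S (case_nat y e))"
    by (intro sigma1_ex sigma1_delta0 delta0_intros delta0_subst[OF R(1)] delta0_subst[OF S(1)])
  then show ?thesis by (simp add: R S ex_disj_distrib)
qed

lemma sigma1_imp [sigma1_intros]: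
  "sigma1 (\<lambda>e. \<not> P e) \<Longrightarrow> sigma1 Q \<Longrightarrow> sigma1 (\<lambda>e. P e \<longrightarrow> Q e)"
  unfolding imp_conv_disj by (rule sigma1_or)

text \<open>Bounding, by induction on the initial segment: \<open>w + y + 1\<close> lies above the
  earlier witnesses and the one for m, and the existence of a bound is Sigma1.\<close>

lemma delta0_collection:
  assumes "delta0 R" "\<forall>x<t. \<exists>y. R (case_nat y (case_nat x e))"
  shows "\<exists>w. \<forall>x<t. \<exists>y<w. R (case_nat y (case_nat x e))"
proof -
  have "\<exists>w. m \<le> t \<longrightarrow> (\<forall>x<m. \<exists>y<w. R (case_nat y (case_nat x e)))" for m
  proof (induction m rule: sigma1_induct)
    case definable
    show ?case by (intro sigma1_ex sigma1_delta0 delta0_intros delta0_subst[OF assms(1)])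
  next
    case zero show ?case by simp
  next
    case (suc m)
    show ?case
    proof (cases "m < t")
      case True
      then obtain w y where w: "\<forall>x<m. \<exists>y<w. R (case_nat y (case_nat x e))"
        and y: "R (case_nat y (case_nat m e))" using suc assms(2) by (meson less_imp_le)
      have "\<exists>y'<w + y + 1. R (case_nat y' (case_nat x e))" if "x < m + 1" for x
      proof (cases "x = m")
        case True
        have "y < w + y + 1" using mint_nonneg[of w] by (simp add: to_mint)
        then show ?thesis using y True by blast
      next
        case False
        then have "x < m" using that PA(8) by blast
        then obtain y' where y': "y' < w" "R (case_nat y' (case_nat x e))" using w by blast
        have "y' < w + y + 1" using y'(1) mint_nonneg[of y] by (simp add: to_mint)
        then show ?thesis using y'(2) by blast
      qed
      then show ?thesis by blast
    next
      case False
      then show ?thesis by (simp add: to_mint)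
    qed
  qed
  from this[of t] show ?thesis by simp
qed

lemma sigma1_ball [sigma1_intros]:
  assumes "dterm t" "sigma1 (\<lambda>e. Q (e 0) (\<lambda>i. e (Suc i)))"
  shows "sigma1 (\<lambda>e. \<forall>x<t e. Q x e)"
proof -
  obtain R where R: "delta0 R" "(\<lambda>e. Q (e 0) (\<lambda>i. e (Suc i))) = (\<lambda>e. \<exists>y. R (case_nat y e))"
    using assms(2) unfolding sigma1_def by blast
  have Q: "Q x e \<longleftrightarrow> (\<exists>y. R (case_nat y (case_nat x e)))" for x e
    using fun_cong[OF R(2), of "case_nat x e"] by simp
  have "sigma1 (\<lambda>e. \<exists>w. \<forall>x<t e. \<exists>y<w. R (case_nat y (case_nat x e)))"
    by (intro sigma1_ex sigma1_delta0 delta0_intros delta0_subst[OF R(1)] dterm_shift[OF assms(1)])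
  \<comment> \<open>Collection moves the unbounded quantifier in front of the bounded one.\<close>
  moreover have "(\<exists>w. \<forall>x<t e. \<exists>y<w. R (case_nat y (case_nat x e))) \<longleftrightarrow> (\<forall>x<t e. Q x e)" for e
    using delta0_collection[OF R(1), of "t e" e] Q by blast
  ultimately show ?thesis by simp
qed

lemma comprehension:
  assumes "sigma1 (\<lambda>e. P (e 0))" "sigma1 (\<lambda>e. \<not> P (e 0))"
  shows "{x. P x} \<in> sets"
  using comprehension_env[OF assms] by simp

lemma delta0_comprehension: "delta0 (\<lambda>e. P (e 0)) \<Longrightarrow> {x. P x} \<in> sets"
  by (intro comprehension sigma1_delta0 delta0_not)

text \<open>That no y below x satisfies P is Sigma1 by collection, so without a least element
  induction carries it to every x.\<close>

lemma least_element:
  assumes "sigma1 (\<lambda>e. \<not> P (e 0))" "P x"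
  shows "\<exists>x. P x \<and> (\<forall>y<x. \<not> P y)"
proof (rule ccontr)
  assume *: "\<nexists>x. P x \<and> (\<forall>y<x. \<not> P y)"
  have "\<forall>y<x. \<not> P y" for x
  proof (induction x rule: sigma1_induct)
    case definable
    show ?case by (intro sigma1_ball dterm_var assms(1))
  next
    case zero show ?case by simp
  next
    case (suc x)
    then have "\<not> P x" using * by blast
    with suc show ?case by (auto simp: PA(8))
  qed
  from this[of "x + 1"] show False using assms(2) PA(8) by blast
qed

section \<open>Meaning of the formulas with named variables\<close>

text \<open>
  A context consists of the depths and environments for number and set variables. A context is
  extended by entering quantifiers; \<open>den\<close>, \<open>sden\<close> and \<open>frm\<close> give the meaning of terms, set
  variables and formulas in all extensions of a context. The meaning of a defined formula is given
  the name of the formula with the prefix \<open>m\<close>.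
\<close>

datatype ctx = Ctx nat "nat \<Rightarrow> mnat" nat "nat \<Rightarrow> mnat set"

fun ctx_le :: "ctx \<Rightarrow> ctx \<Rightarrow> bool" (infix "\<sqsubseteq>" 50) where
  "Ctx d e D E \<sqsubseteq> Ctx d' e' D' E' \<longleftrightarrow> d \<le> d' \<and> (\<forall>i. e' (i + (d' - d)) = e i) \<and>
    D \<le> D' \<and> (\<forall>i. E' (i + (D' - D)) = E i)"

lemma ctx_le_refl: "c \<sqsubseteq> c" by (cases c) simp

lemma ctx_le_trans: "a \<sqsubseteq> b \<Longrightarrow> b \<sqsubseteq> c \<Longrightarrow> a \<sqsubseteq> c"
proof (cases a; cases b; cases c)
  fix d e D E d' e' D' E' d'' e'' D'' E''
  assume "a = Ctx d e D E" "b = Ctx d' e' D' E'" "c = Ctx d'' e'' D'' E''" "a \<sqsubseteq> b" "b \<sqsubseteq> c"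
  moreover have "e'' (i + (d'' - d)) = e i" "E'' (i + (D'' - D)) = E i" for i
  proof -
    have "i + (d'' - d) = i + (d' - d) + (d'' - d')" "i + (D'' - D) = i + (D' - D) + (D'' - D')"
      using calculation by auto
    then show "e'' (i + (d'' - d)) = e i" "E'' (i + (D'' - D)) = E i"
      using calculation by (metis ctx_le.simps)+
  qed
  ultimately show ?thesis by auto
qed

definition den :: "ctx \<Rightarrow> nterm \<Rightarrow> mnat \<Rightarrow> bool" where
  "den c t x \<longleftrightarrow> (\<forall>d e D E. c \<sqsubseteq> Ctx d e D E \<longrightarrow> tval the_model (t d) e = x)"

definition sden :: "ctx \<Rightarrow> sterm \<Rightarrow> mnat set \<Rightarrow> bool" where
  "sden c X A \<longleftrightarrow> (\<forall>d e D E. c \<sqsubseteq> Ctx d e D E \<longrightarrow> E (X D) = A)"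

definition frm :: "ctx \<Rightarrow> form \<Rightarrow> bool \<Rightarrow> bool" where
  "frm c p P \<longleftrightarrow> (\<forall>d e D E. c \<sqsubseteq> Ctx d e D E \<longrightarrow> (sat the_model (p d D) e E \<longleftrightarrow> P))"

lemma den_mono: "c \<sqsubseteq> c' \<Longrightarrow> den c t x \<Longrightarrow> den c' t x"
  unfolding den_def using ctx_le_trans by blast

lemma sden_mono: "c \<sqsubseteq> c' \<Longrightarrow> sden c X A \<Longrightarrow> sden c' X A"
  unfolding sden_def using ctx_le_trans by blast

named_theorems frm_rules

lemma den_basic [frm_rules]:
  "den c \<^bold>0 0" "den c \<^bold>1 1"
  "den c s x \<Longrightarrow> den c t y \<Longrightarrow> den c (s \<^bold>+ t) (x + y)"
  "den c s x \<Longrightarrow> den c t y \<Longrightarrow> den c (s \<^bold>* t) (x * y)"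
  by (simp_all add: den_def fZero_def fAdd_def fMult_def fOne_def zero_mnat_def plus_mnat_def one_mnat_def
      times_mnat_def)

lemma den_num [frm_rules]: "den c (num n) (of_nat n)"
proof (induction n)
  case (Suc n)
  then have "den c (num n \<^bold>+ \<^bold>1) (of_nat n + 1)" by (intro den_basic)
  then show ?case by (simp add: add.commute)
qed (simp add: den_basic)

lemma frm_mem [frm_rules]: "den c s x \<Longrightarrow> sden c X A \<Longrightarrow> frm c (s \<^bold>\<in> X) (x \<in> A)"
  by (simp add: den_def sden_def frm_def fMem_def) metis

lemma frm_basic [frm_rules]:
  "den c s x \<Longrightarrow> den c t y \<Longrightarrow> frm c (s \<^bold>= t) (x = y)"
  "den c s x \<Longrightarrow> den c t y \<Longrightarrow> frm c (s \<^bold>< t) (x < y)"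
  "frm c p P \<Longrightarrow> frm c (\<^bold>\<not> p) (\<not> P)"
  "frm c p P \<Longrightarrow> frm c q Q \<Longrightarrow> frm c (p \<^bold>\<and> q) (P \<and> Q)"
  "frm c p P \<Longrightarrow> frm c q Q \<Longrightarrow> frm c (p \<^bold>\<or> q) (P \<or> Q)"
  "frm c p P \<Longrightarrow> frm c q Q \<Longrightarrow> frm c (p \<^bold>\<longrightarrow> q) (P \<longrightarrow> Q)"
  "frm c p P \<Longrightarrow> frm c q Q \<Longrightarrow> frm c (p \<^bold>\<longleftrightarrow> q) (P \<longleftrightarrow> Q)"
  by (simp_all add: den_def sden_def frm_def fEq_def fLess_def fMem_def fNeg_def fAnd_def fOr_def
      fImp_def fIff_def less_mnat_def)

lemma ctx_bind:
  assumes "c \<sqsubseteq> Ctx d e D E"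
  shows "c \<sqsubseteq> Ctx (Suc d) (case_nat x e) D E" "den (Ctx (Suc d) (case_nat x e) D E) (\<lambda>d'. Var (d' - Suc d)) x"
proof -
  have "Ctx d e D E \<sqsubseteq> Ctx (Suc d) (case_nat x e) D E" by simp
  then show "c \<sqsubseteq> Ctx (Suc d) (case_nat x e) D E" using assms ctx_le_trans by blast
  show "den (Ctx (Suc d) (case_nat x e) D E) (\<lambda>d'. Var (d' - Suc d)) x"
    unfolding den_def by (auto dest!: spec[of _ 0])
qed

lemma ctx_bindS:
  assumes "c \<sqsubseteq> Ctx d e D E"
  shows "c \<sqsubseteq> Ctx d e (Suc D) (case_nat A E)" "sden (Ctx d e (Suc D) (case_nat A E)) (\<lambda>D'. D' - Suc D) A"
proof -
  have "Ctx d e D E \<sqsubseteq> Ctx d e (Suc D) (case_nat A E)" by simp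
  then show "c \<sqsubseteq> Ctx d e (Suc D) (case_nat A E)" using assms ctx_le_trans by blast
  show "sden (Ctx d e (Suc D) (case_nat A E)) (\<lambda>D'. D' - Suc D) A"
    unfolding sden_def by (auto dest!: spec[of _ 0])
qed

lemma frm_binders:
  assumes "\<And>c' t x. c \<sqsubseteq> c' \<Longrightarrow> den c' t x \<Longrightarrow> frm c' (F t) (P x)"
  shows frm_all [frm_rules]: "frm c (fAll F) (\<forall>x. P x)" and frm_ex [frm_rules]: "frm c (fEx F) (\<exists>x. P x)"
proof -
  have "sat the_model (F (\<lambda>d'. Var (d' - Suc d)) (Suc d) D) (case_nat x e) E \<longleftrightarrow> P x"
    if "c \<sqsubseteq> Ctx d e D E" for d e D E x
    using assms[OF ctx_bind[OF that]] ctx_le_refl unfolding frm_def by blast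
  then show "frm c (fAll F) (\<forall>x. P x)" "frm c (fEx F) (\<exists>x. P x)"
    by (simp_all add: frm_def fAll_def fEx_def)
qed

lemma frm_bindersS:
  assumes "\<And>c' X A. c \<sqsubseteq> c' \<Longrightarrow> sden c' X A \<Longrightarrow> frm c' (F X) (P A)"
  shows frm_allS [frm_rules]: "frm c (fAllS F) (\<forall>A\<in>sets. P A)"
    and frm_exS [frm_rules]: "frm c (fExS F) (\<exists>A\<in>sets. P A)"
proof -
  have "sat the_model (F (\<lambda>D'. D' - Suc D) d (Suc D)) e (case_nat A E) \<longleftrightarrow> P A"
    if "c \<sqsubseteq> Ctx d e D E" for d e D E A
    using assms[OF ctx_bindS[OF that]] ctx_le_refl unfolding frm_def by blast
  then show "frm c (fAllS F) (\<forall>A\<in>sets. P A)" "frm c (fExS F) (\<exists>A\<in>sets. P A)"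
    by (simp_all add: frm_def fAllS_def fExS_def)
qed

lemma frm_bounded:
  assumes "den c t b" "\<And>c' t x. c \<sqsubseteq> c' \<Longrightarrow> den c' t x \<Longrightarrow> frm c' (F t) (P x)"
  shows frm_ball [frm_rules]: "frm c (fBall t F) (\<forall>x<b. P x)" and frm_bex [frm_rules]: "frm c (fBex t F) (\<exists>x<b. P x)"
  unfolding fBall_def fBex_def
  by (intro frm_rules assms(2); (assumption | rule den_mono[OF _ assms(1)]); assumption)+

definition mpair :: "mnat \<Rightarrow> mnat \<Rightarrow> mnat" where
  "mpair i j = (i + j) * (i + j) + i"

lemma den_pair [frm_rules]: "den c s x \<Longrightarrow> den c t y \<Longrightarrow> den c (pair s t) (mpair x y)"
  unfolding pair_def mpair_def by (intro frm_rules)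

definition mentry :: "mnat \<Rightarrow> mnat \<Rightarrow> mnat \<Rightarrow> bool" where
  "mentry s i v \<longleftrightarrow> (\<exists>a<s + 1. \<exists>b<s + 1. s = mpair a b \<and> v < b * (i + 1) + 1 \<and>
      (\<exists>q<a + 1. a = q * (b * (i + 1) + 1) + v))"

lemma frm_entry [frm_rules]:
  "den c s x \<Longrightarrow> den c i y \<Longrightarrow> den c v z \<Longrightarrow> frm c (entry s i v) (mentry x y z)"
  unfolding entry_def mentry_def
  \<comment> \<open>Descends through the formula; what is known of outer variables is carried into
    the extended contexts by monotonicity.\<close>
  by (rule frm_rules | assumption | (rule den_mono sden_mono, assumption))+

definition mnset :: "mnat \<Rightarrow> mnat \<Rightarrow> bool" where
  "mnset n s \<longleftrightarrow> (\<forall>i<n. \<exists>v<s + 1. mentry s i v) \<and>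
     (\<forall>i<n. \<forall>j<n. i < j \<longrightarrow> (\<exists>u<s + 1. \<exists>v<s + 1. mentry s i u \<and> mentry s j v \<and> u < v))"

lemma frm_nset [frm_rules]: "den c n x \<Longrightarrow> den c s y \<Longrightarrow> frm c (nset n s) (mnset x y)"
  unfolding nset_def mnset_def
  by (rule frm_rules | assumption | (rule den_mono sden_mono, assumption))+

definition msame_nset :: "mnat \<Rightarrow> mnat \<Rightarrow> mnat \<Rightarrow> bool" where
  "msame_nset n s t \<longleftrightarrow> (\<forall>i<n. \<exists>v<s + 1. mentry s i v \<and> mentry t i v)"

lemma frm_same_nset [frm_rules]:
  "den c n x \<Longrightarrow> den c s y \<Longrightarrow> den c t z \<Longrightarrow> frm c (same_nset n s t) (msame_nset x y z)"
  unfolding same_nset_def msame_nset_def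
  by (rule frm_rules | assumption | (rule den_mono sden_mono, assumption))+

definition mcolouring :: "mnat \<Rightarrow> mnat \<Rightarrow> mnat set \<Rightarrow> bool" where
  "mcolouring n k C \<longleftrightarrow> (\<forall>s. mnset n s \<longrightarrow> (\<exists>c<k. mpair s c \<in> C)) \<and>
     (\<forall>s t c d. mnset n s \<and> mnset n t \<and> msame_nset n s t \<and> mpair s c \<in> C \<and> mpair t d \<in> C \<longrightarrow> c = d)"

lemma frm_colouring [frm_rules]:
  "den c n x \<Longrightarrow> den c k y \<Longrightarrow> sden c C A \<Longrightarrow> frm c (colouring n k C) (mcolouring x y A)"
  unfolding colouring_def mcolouring_def
  by (rule frm_rules | assumption | (rule den_mono sden_mono, assumption))+

definition mhomogeneous :: "mnat \<Rightarrow> mnat set \<Rightarrow> mnat set \<Rightarrow> bool" where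
  "mhomogeneous n C H \<longleftrightarrow>
    (\<exists>c. \<forall>s. mnset n s \<and> (\<forall>i<n. \<exists>v<s + 1. mentry s i v \<and> v \<in> H) \<longrightarrow> mpair s c \<in> C)"

lemma frm_homogeneous [frm_rules]:
  "den c n x \<Longrightarrow> sden c C A \<Longrightarrow> sden c H B \<Longrightarrow> frm c (homogeneous n C H) (mhomogeneous x A B)"
  unfolding homogeneous_def nset_within_def mhomogeneous_def
  by (rule frm_rules | assumption | (rule den_mono sden_mono, assumption))+

definition mRT :: "mnat \<Rightarrow> mnat \<Rightarrow> bool" where
  "mRT n k \<longleftrightarrow> (\<forall>C\<in>sets. mcolouring n k C \<longrightarrow>
    (\<exists>H\<in>sets. (\<forall>m. \<exists>x. m < x \<and> x \<in> H) \<and> mhomogeneous n C H))"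

lemma frm_RT [frm_rules]: "den c n x \<Longrightarrow> den c k y \<Longrightarrow> frm c (RT n k) (mRT x y)"
  unfolding RT_def infinite_set_def mRT_def
  by (rule frm_rules | assumption | (rule den_mono sden_mono, assumption))+

definition mfinset :: "mnat \<Rightarrow> mnat \<Rightarrow> mnat \<Rightarrow> mnat \<Rightarrow> bool" where
  "mfinset k a b i \<longleftrightarrow> i < k \<and> (\<exists>q<a + 1. a = q * (b * (i + 1) + 1))"

definition mcomputed :: "mnat \<Rightarrow> mnat \<Rightarrow> mnat \<Rightarrow> mnat \<Rightarrow> mnat \<Rightarrow> mnat \<Rightarrow> bool" where
  "mcomputed k a b e x y \<longleftrightarrow> mfinset k a b (mpair e (mpair x y))"

lemma frm_computed [frm_rules]:
  "den c k k' \<Longrightarrow> den c a a' \<Longrightarrow> den c b b' \<Longrightarrow> den c e e' \<Longrightarrow> den c x x' \<Longrightarrow> den c y y' \<Longrightarrow>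
    frm c (computed k a b e x y) (mcomputed k' a' b' e' x' y')"
  unfolding computed_def mcomputed_def in_finset_def mfinset_def
  by (rule frm_rules | assumption | (rule den_mono sden_mono, assumption))+

abbreviation mop :: "nat \<Rightarrow> mnat" where "mop n \<equiv> mpair (of_nat 0) (of_nat n)"

definition mjustified ::
    "mnat set \<Rightarrow> mnat \<Rightarrow> mnat \<Rightarrow> mnat \<Rightarrow> mnat \<Rightarrow> mnat \<Rightarrow> mnat \<Rightarrow> bool" where
  "mjustified X k a b e x y \<longleftrightarrow>
    (e = mop 0 \<and> y = 0 \<or>
     e = mop 1 \<and> y = x + 1 \<or>
     e = mop 2 \<and> y = x \<or>
     e = mop 3 \<and> (\<exists>v<k. x = mpair y v) \<or>
     e = mop 4 \<and> (\<exists>u<k. x = mpair u y) \<or>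
     e = mop 5 \<and> (\<exists>u<k. \<exists>v<k. x = mpair u v \<and> y = u + v) \<or>
     e = mop 6 \<and> (\<exists>u<k. \<exists>v<k. x = mpair u v \<and> y = u * v) \<or>
     e = mop 7 \<and> (\<exists>u<k. \<exists>v<k. x = mpair u v \<and>
        (u < v \<and> y = 1 \<or> \<not> u < v \<and> y = 0)) \<or>
     e = mop 8 \<and> (x \<in> X \<and> y = 1 \<or> \<not> x \<in> X \<and> y = 0) \<or>
     (\<exists>f<k. \<exists>g<k. e = mpair (of_nat 1) (mpair f g) \<and>
        (\<exists>u<k. \<exists>v<k. mcomputed k a b f x u \<and> mcomputed k a b g x v \<and> y = mpair u v)) \<or>
     (\<exists>f<k. \<exists>g<k. e = mpair (of_nat 2) (mpair f g) \<and>
        (\<exists>u<k. mcomputed k a b g x u \<and> mcomputed k a b f u y)) \<or>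
     (\<exists>f<k. e = mpair (of_nat 3) f \<and> mcomputed k a b f (mpair x y) 0 \<and>
        (\<forall>z<y. \<exists>v<k. mcomputed k a b f (mpair x z) (v + 1))))"

lemma frm_justified [frm_rules]:
  "den c k k' \<Longrightarrow> den c a a' \<Longrightarrow> den c b b' \<Longrightarrow> den c e e' \<Longrightarrow> den c x x' \<Longrightarrow> den c y y' \<Longrightarrow>
    sden c X A \<Longrightarrow> frm c (justified X k a b e x y) (mjustified A k' a' b' e' x' y')"
  unfolding justified_def mjustified_def fun_zero_def fun_suc_def fun_id_def fun_left_def fun_right_def
    fun_sum_def fun_prod_def fun_less_def fun_oracle_def fun_pair_def fun_comp_def fun_mu_def
  by (rule frm_rules | assumption | (rule den_mono sden_mono, assumption))+

definition mderivation :: "mnat set \<Rightarrow> mnat \<Rightarrow> mnat \<Rightarrow> mnat \<Rightarrow> bool" where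
  "mderivation X k a b \<longleftrightarrow>
    (\<forall>e<k. \<forall>x<k. \<forall>y<k. mcomputed k a b e x y \<longrightarrow> mjustified X k a b e x y)"

definition mhalts :: "mnat set \<Rightarrow> mnat \<Rightarrow> mnat \<Rightarrow> bool" where
  "mhalts X e x \<longleftrightarrow> (\<exists>k a b y. mderivation X k a b \<and> mcomputed k a b e x y)"

lemma frm_halts [frm_rules]:
  "den c e e' \<Longrightarrow> den c x x' \<Longrightarrow> sden c X A \<Longrightarrow> frm c (halts X e x) (mhalts A e' x')"
  unfolding halts_def mhalts_def derivation_def mderivation_def
  by (rule frm_rules | assumption | (rule den_mono sden_mono, assumption))+

definition miterated_jump :: "mnat \<Rightarrow> mnat set \<Rightarrow> mnat set \<Rightarrow> bool" where
  "miterated_jump n X Y \<longleftrightarrow> (\<exists>Z\<in>sets. (\<forall>x. x \<in> X \<longleftrightarrow> mpair 0 x \<in> Z) \<and> (\<forall>x. x \<in> Y \<longleftrightarrow> mpair n x \<in> Z) \<and>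
    (\<forall>i<n. \<exists>U\<in>sets. \<exists>V\<in>sets. (\<forall>x. x \<in> U \<longleftrightarrow> mpair i x \<in> Z) \<and> (\<forall>x. x \<in> V \<longleftrightarrow> mpair (i + 1) x \<in> Z) \<and>
      (\<forall>e. e \<in> V \<longleftrightarrow> mhalts U e e)))"

lemma frm_iterated_jump [frm_rules]:
  "den c n x \<Longrightarrow> sden c X A \<Longrightarrow> sden c Y B \<Longrightarrow> frm c (is_iterated_jump n X Y) (miterated_jump x A B)"
  unfolding is_iterated_jump_def miterated_jump_def is_section_def is_jump_def
  by (rule frm_rules | assumption | (rule den_mono sden_mono, assumption))+

lemma sat_all_RT_ACA0':
  "sat the_model (sentence (all_RT \<^bold>\<longrightarrow> ACA0')) e E \<longleftrightarrow>
    ((\<forall>n k. 0 < n \<and> 0 < k \<longrightarrow> mRT n k) \<longrightarrow> (\<forall>n. \<forall>X\<in>sets. \<exists>Y\<in>sets. miterated_jump n X Y))"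
proof -
  have "frm (Ctx 0 e 0 E) (all_RT \<^bold>\<longrightarrow> ACA0')
    ((\<forall>n k. 0 < n \<and> 0 < k \<longrightarrow> mRT n k) \<longrightarrow> (\<forall>n. \<forall>X\<in>sets. \<exists>Y\<in>sets. miterated_jump n X Y))"
    unfolding all_RT_def ACA0'_def
    by (rule frm_rules | assumption | (rule den_mono sden_mono, assumption))+
  then show ?thesis unfolding frm_def sentence_def using ctx_le_refl by blast
qed

section \<open>Pairs and sequences\<close>

lemma less_succ: "x < y + 1 \<longleftrightarrow> x \<le> y" for x y :: mnat
  by (rule less_eq_iff_succ_less[symmetric])

lemma succ_le: "x + 1 \<le> y \<longleftrightarrow> x < y" for x y :: mnat
  by (rule less_iff_succ_less_eq[symmetric])

lemma le_square: "x \<le> x * x" for x :: mnat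
proof (cases "x = 0")
  case False
  then have "1 \<le> x" using less_iff_succ_less_eq[of 0 x] by (simp add: zero_less_iff_neq_zero)
  from mult_left_mono[OF this, of x] show ?thesis by simp
qed simp

lemma mpair_ge: "i \<le> mpair i j" "j \<le> mpair i j"
proof -
  show "i \<le> mpair i j" by (simp add: mpair_def)
  have "j \<le> i + j" by simp
  also have "\<dots> \<le> (i + j) * (i + j)" by (rule le_square)
  also have "\<dots> \<le> mpair i j" by (simp add: mpair_def)
  finally show "j \<le> mpair i j" .
qed

lemma mpair_mono: "i \<le> i' \<Longrightarrow> mpair i j \<le> mpair i' j"
  unfolding mpair_def by (intro add_mono mult_mono) auto

text \<open>\<open>mpair i j\<close> lies below the square of \<open>i + j + 1\<close>, so a larger
  sum means a larger code.\<close>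

lemma mpair_sum_le: "mpair i j = mpair k l \<Longrightarrow> k + l \<le> i + j"
proof (rule ccontr)
  assume eq: "mpair i j = mpair k l" and "\<not> k + l \<le> i + j"
  then have "i + j + 1 \<le> k + l" by (simp add: not_le succ_le)
  then have "(i + j + 1) * (i + j + 1) \<le> (k + l) * (k + l)" by (intro mult_mono) auto
  also have "\<dots> \<le> mpair k l" by (simp add: mpair_def)
  finally have "(i + j + 1) * (i + j + 1) \<le> mpair i j" using eq by simp
  then have "(i + j) * (i + j) + i + (i + (j + j) + 1) \<le> (i + j) * (i + j) + i"
    by (simp add: mpair_def algebra_simps)
  then show False by simp
qed

lemma mpair_eq_iff [simp]: "mpair i j = mpair k l \<longleftrightarrow> i = k \<and> j = l"
proof
  assume eq: "mpair i j = mpair k l"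
  then have sum: "i + j = k + l" using mpair_sum_le[of i j k l] mpair_sum_le[of k l i j] by simp
  then have "i = k" using eq unfolding mpair_def sum by simp
  then show "i = k \<and> j = l" using sum by simp
qed simp

lemma dterm_mpair [delta0_intros]: "dterm s \<Longrightarrow> dterm t \<Longrightarrow> dterm (\<lambda>e. mpair (s e) (t e))"
  unfolding mpair_def by (intro delta0_intros)

section \<open>Division and the entries of a code\<close>

lemma quotient_unique:
  fixes m :: mnat
  assumes "q * m + v = q' * m + v'" "v < m" "v' < m"
  shows "v = v'"
proof -
  have False if "q < q'" "q * m + v = q' * m + v'" "v < m" for q q' v v' :: mnat
  proof -
    have "(q + 1) * m \<le> q' * m" using that(1) less_iff_succ_less_eq by (intro mult_right_mono) auto
    also have "\<dots> \<le> q * m + v" using that(2) by simp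
    also have "\<dots> < q * m + m" using that(3) by simp
    finally show False by (simp add: algebra_simps)
  qed
  from this[of q q' v v'] this[of q' q v' v] assms have "q = q'"
    by (metis linorder_neqE)
  then show ?thesis using assms(1) by simp
qed

lemma quotient_exists:
  fixes m :: mnat
  assumes "0 < m" shows "\<exists>q v. v < m \<and> a = q * m + v"
proof (induction a rule: sigma1_induct)
  case definable
  show ?case by (intro sigma1_ex sigma1_delta0 delta0_intros)
next
  case zero show ?case using assms by (intro exI[of _ 0]) simp
next
  case (suc a)
  then obtain q v where qv: "v < m" "a = q * m + v" by blast
  show ?case
  proof (cases "v + 1 = m")
    case True
    have "a + 1 = q * m + (v + 1)" by (simp add: qv(2) add.assoc)
    also have "\<dots> = (q + 1) * m + 0" unfolding True by (simp add: algebra_simps)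
    finally show ?thesis using assms by blast
  next
    case False
    then have "v + 1 < m" using qv(1) by (simp add: order_less_le[of "v + 1"] succ_le)
    moreover have "a + 1 = q * m + (v + 1)" by (simp add: qv(2) add.assoc)
    ultimately show ?thesis by blast
  qed
qed

lemma mentry_mpair:
  "mentry (mpair a b) i v \<longleftrightarrow> v < b * (i + 1) + 1 \<and> (\<exists>q. a = q * (b * (i + 1) + 1) + v)"
proof -
  have q: "q < a + 1" if "a = q * (b * (i + 1) + 1) + v" for q
  proof -
    have "q \<le> q + (q * (b * (i + 1)) + v)" by simp
    also have "\<dots> = a" using that by (simp add: algebra_simps)
    finally show ?thesis by (simp only: less_succ)
  qed
  have "a < mpair a b + 1" "b < mpair a b + 1"
    by (simp_all only: less_succ mpair_ge)
  then show ?thesis unfolding mentry_def using q by auto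
qed

lemma mentry_unique: "mentry s i v \<Longrightarrow> mentry s i w \<Longrightarrow> v = w"
proof -
  assume v: "mentry s i v" and w: "mentry s i w"
  from v obtain a b where s: "s = mpair a b" unfolding mentry_def by blast
  from v w show "v = w" unfolding s mentry_mpair using quotient_unique by metis
qed

lemma mentry_le: "mentry s i v \<Longrightarrow> v < s + 1"
proof -
  assume v: "mentry s i v"
  then obtain a b where s: "s = mpair a b" unfolding mentry_def by blast
  with v obtain q where "a = q * (b * (i + 1) + 1) + v" unfolding s mentry_mpair by blast
  then have "v \<le> a" by simp
  also have "a \<le> s" unfolding s by (rule mpair_ge)
  finally show ?thesis by (simp only: less_succ)
qed

lemma delta0_subst2:
  assumes "delta0 (\<lambda>e. P (e 0) (e (Suc 0)))" "dterm s" "dterm t"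
  shows "delta0 (\<lambda>e. P (s e) (t e))"
  using delta0_subst[OF assms(1), of "\<lambda>e. case_nat (s e) (case_nat (t e) e)"] assms(2,3)
  by (simp add: delta0_intros)

lemma delta0_subst3:
  assumes "delta0 (\<lambda>e. P (e 0) (e (Suc 0)) (e (Suc (Suc 0))))" "dterm s" "dterm t" "dterm u"
  shows "delta0 (\<lambda>e. P (s e) (t e) (u e))"
  using delta0_subst[OF assms(1), of "\<lambda>e. case_nat (s e) (case_nat (t e) (case_nat (u e) e))"] assms(2-)
  by (simp add: delta0_intros)

lemma delta0_mentry [delta0_intros]:
  "dterm s \<Longrightarrow> dterm i \<Longrightarrow> dterm v \<Longrightarrow> delta0 (\<lambda>e. mentry (s e) (i e) (v e))"
proof (rule delta0_subst3)
  show "delta0 (\<lambda>e. mentry (e 0) (e (Suc 0)) (e (Suc (Suc 0))))"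
    unfolding mentry_def by (intro delta0_intros)
qed

section \<open>Congruences and Chinese remainders\<close>

lemma sigma1_dvd [sigma1_intros]: "dterm s \<Longrightarrow> dterm t \<Longrightarrow> sigma1 (\<lambda>e. s e dvd t e)"
  unfolding dvd_def by (intro sigma1_ex sigma1_delta0 delta0_eq dterm_mult dterm_shift dterm_var)

text \<open>Multiples of m may be added on both sides, since there are no negative numbers.\<close>

definition cong_mod :: "mnat \<Rightarrow> mnat \<Rightarrow> mnat \<Rightarrow> bool" where
  "cong_mod m x y \<longleftrightarrow> (\<exists>q r. x + m * q = y + m * r)"

lemma cong_mod_mult: "cong_mod m x y \<Longrightarrow> cong_mod m (z * x) (z * y)"
proof -
  assume "cong_mod m x y"
  then obtain q r where "x + m * q = y + m * r" unfolding cong_mod_def by blast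
  then have "z * (x + m * q) = z * (y + m * r)" by simp
  then have "z * x + m * (z * q) = z * y + m * (z * r)" by (simp add: algebra_simps)
  then show ?thesis unfolding cong_mod_def by blast
qed

lemma cong_mod_trans: "cong_mod m x y \<Longrightarrow> cong_mod m y z \<Longrightarrow> cong_mod m x z"
proof -
  assume "cong_mod m x y" "cong_mod m y z"
  then obtain q r q' r' where "x + m * q = y + m * r" "y + m * q' = z + m * r'"
    unfolding cong_mod_def by blast
  then have "x + m * q + (y + m * q') = y + m * r + (z + m * r')" by simp
  then have "y + (x + m * (q + q')) = y + (z + m * (r + r'))" by (simp add: algebra_simps)
  then have "x + m * (q + q') = z + m * (r + r')" by simp
  then show ?thesis unfolding cong_mod_def by blast
qed

lemma cong_mod_residue:
  assumes "cong_mod m x v" "v < m" shows "\<exists>q. x = q * m + v"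
proof -
  from assms(1) obtain q r where qr: "x + m * q = v + m * r" unfolding cong_mod_def by blast
  have "0 < m" using assms(2) by (rule le_less_trans[OF zero_le])
  then obtain k w where w: "w < m" "x = k * m + w" using quotient_exists by blast
  then have "(k + q) * m + w = r * m + v" using qr by (simp add: algebra_simps)
  then have "w = v" using w(1) assms(2) by (rule quotient_unique)
  then show ?thesis using w(2) by blast
qed

abbreviation modulus :: "mnat \<Rightarrow> mnat \<Rightarrow> mnat" where "modulus b i \<equiv> b * (i + 1) + 1"

text \<open>Since \<open>(j + 1) * modulus b i - (i + 1) * modulus b j = j - i\<close> divides \<open>b\<close>, the inverse is explicit.\<close>

lemma modulus_inverse:
  assumes "i < j" "\<forall>d<n. d + 1 dvd b" "j < n"
  shows "\<exists>u. cong_mod (modulus b j) (modulus b i * u) 1"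
proof -
  from assms(1) obtain d where j: "j = i + (d + 1)" by (rule mnat_lessE)
  have "d < n" using j assms(3) mint_nonneg[of i] by (simp add: to_mint)
  then obtain c where b: "b = (d + 1) * c" using assms(2) unfolding dvd_def by blast
  define w where "w = (j + 1) * (j + 1) * c"
  define z where "z = (i + 1) * (j + 1) * c + 1"
  have "modulus b i * w + 1 = modulus b j * z"
    unfolding w_def z_def j b by (simp add: algebra_simps)
  \<comment> \<open>Modulo \<open>modulus b j\<close>, both \<open>modulus b i * w\<close> and
    \<open>b * (j + 1)\<close> are -1, so their product is 1.\<close>
  then have "(modulus b i * w + 1) * (b * (j + 1)) = modulus b j * z * (b * (j + 1))" by simp
  then have "modulus b i * (w * (b * (j + 1))) + modulus b j * 1 = 1 + modulus b j * (z * (b * (j + 1)))"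
    by (simp add: algebra_simps)
  then show ?thesis unfolding cong_mod_def by blast
qed

text \<open>b takes the place of the factorial in Goedel's construction. Being at least B, it leaves
  room for entries below B in every modulus.\<close>

lemma ex_common_multiple: "\<exists>b. B \<le> b \<and> (\<forall>d<n. d + 1 dvd b)" for n :: mnat
proof (induction n rule: sigma1_induct)
  case definable
  show ?case by (intro sigma1_intros; intro sigma1_delta0 delta0_intros)
next
  case zero show ?case by auto
next
  case (suc n)
  then obtain b where b: "B \<le> b" "\<forall>d<n. d + 1 dvd b" by blast
  have "b * 1 \<le> b * (n + 1)" by (rule mult_left_mono) auto
  then have "B \<le> b * (n + 1)" using b(1) by simp
  moreover have "\<forall>d<n + 1. d + 1 dvd b * (n + 1)"
    using b(2) by (auto simp: PA(8))
  ultimately show ?case by blast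
qed

text \<open>Reduction modulo Q does not change the entries, which bounds codes independently of the
  coded sequence.\<close>

lemma ex_modulus_product: "\<exists>Q. 0 < Q \<and> (\<forall>i<n. modulus b i dvd Q)" for n :: mnat
proof (induction n rule: sigma1_induct)
  case definable
  show ?case by (intro sigma1_intros; intro sigma1_delta0 delta0_intros)
next
  case zero show ?case by (intro exI[of _ 1]) simp
next
  case (suc n)
  then obtain Q where Q: "0 < Q" "\<forall>i<n. modulus b i dvd Q" by blast
  have "0 < modulus b n" using mint_nonneg by (simp add: zero_less_iff_neq_zero)
  then have "0 < Q * modulus b n" using Q(1) by simp
  moreover have "\<forall>i<n + 1. modulus b i dvd Q * modulus b n"
    using Q(2) by (auto simp: PA(8))
  ultimately show ?case by blast
qed

text \<open>Induction on the number k of congruences solved. P is a multiple of the moduli used so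
  far and stays invertible modulo the later ones, so adding a multiple of P to a repairs congruence
  k and keeps the earlier ones.\<close>

lemma chinese_remainder:
  assumes "delta0 (\<lambda>e. \<phi> (e 0) (e (Suc 0)))" "\<forall>d<n. d + 1 dvd b" "\<forall>i<n. \<exists>v<modulus b i. \<phi> i v"
  shows "\<exists>a. \<forall>i<n. \<exists>v. v < modulus b i \<and> \<phi> i v \<and> (\<exists>q. a = q * modulus b i + v)"
proof -
  have "k \<le> n \<longrightarrow> (\<exists>a P. (\<forall>i<k. modulus b i dvd P) \<and>
      (\<forall>j<n. k \<le> j \<longrightarrow> (\<exists>u. \<exists>q r. P * u + modulus b j * q = 1 + modulus b j * r)) \<and>
      (\<forall>i<k. \<exists>v. v < modulus b i \<and> \<phi> i v \<and> (\<exists>q. a = q * modulus b i + v)))" for k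
  proof (induction k rule: sigma1_induct)
    case definable
    show ?case by (intro sigma1_intros; intro sigma1_delta0 delta0_intros delta0_subst2[OF assms(1)])
  next
    case zero
    have "\<exists>u. \<exists>q r. 1 * u + modulus b j * q = 1 + modulus b j * r" for j
      by (intro exI[of _ 1]) simp
    then show ?case by (intro impI exI[of _ 0] exI[of _ 1]) simp
  next
    case (suc k)
    show ?case
    proof
      assume "k + 1 \<le> n"
      then have k: "k < n" by (simp only: less_iff_succ_less_eq)
      then obtain a P where P: "\<forall>i<k. modulus b i dvd P"
          "\<forall>j<n. k \<le> j \<longrightarrow> (\<exists>u. cong_mod (modulus b j) (P * u) 1)"
        and a: "\<forall>i<k. \<exists>v. v < modulus b i \<and> \<phi> i v \<and> (\<exists>q. a = q * modulus b i + v)"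
        using suc unfolding cong_mod_def by (auto simp: less_imp_le)
      obtain u where u: "cong_mod (modulus b k) (P * u) 1" using P(2) k by blast
      obtain v where v: "v < modulus b k" "\<phi> k v" using assms(3) k by blast
      \<comment> \<open>Modulo \<open>modulus b k\<close>, M is -1, so \<open>v + M * a\<close>
        stands for v - a. As u is inverse to P, \<open>a + P * t\<close> is congruent to v.\<close>
      define M where "M = b * (k + 1)"
      define t where "t = u * (v + M * a)"
      have "cong_mod (modulus b k) ((v + M * a) * (P * u)) ((v + M * a) * 1)"
        using u by (rule cong_mod_mult)
      then obtain q r where "(v + M * a) * (P * u) + modulus b k * q = (v + M * a) * 1 + modulus b k * r"
        unfolding cong_mod_def by blast
      then have "a + (v + M * a) * (P * u) + modulus b k * q = a + (v + M * a) + modulus b k * r"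
        by (simp add: ac_simps)
      then have "a + P * t + modulus b k * q = v + modulus b k * (a + r)"
        unfolding t_def M_def by (simp add: algebra_simps)
      then have "cong_mod (modulus b k) (a + P * t) v" unfolding cong_mod_def by blast
      then have new: "\<exists>q. a + P * t = q * modulus b k + v" using v(1) by (rule cong_mod_residue)
      have old: "\<exists>v. v < modulus b i \<and> \<phi> i v \<and> (\<exists>q. a + P * t = q * modulus b i + v)" if "i < k" for i
      proof -
        obtain v q where v: "v < modulus b i" "\<phi> i v" "a = q * modulus b i + v" using a \<open>i < k\<close> by blast
        obtain p where "P = modulus b i * p" using P(1) \<open>i < k\<close> unfolding dvd_def by blast
        then have "a + P * t = (q + p * t) * modulus b i + v" using v(3) by (simp add: algebra_simps)
        then show ?thesis using v(1,2) by blast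
      qed
      have "\<exists>u. cong_mod (modulus b j) (P * modulus b k * u) 1" if "j < n" "k + 1 \<le> j" for j
      proof -
        have j: "k < j" using that(2) by (simp only: less_iff_succ_less_eq)
        obtain u where u: "cong_mod (modulus b j) (P * u) 1" using P(2) \<open>j < n\<close> j less_imp_le by blast
        obtain w where w: "cong_mod (modulus b j) (modulus b k * w) 1"
          using modulus_inverse[OF j assms(2) \<open>j < n\<close>] by blast
        have "cong_mod (modulus b j) (modulus b k * w * (P * u)) (modulus b k * w * 1)"
          using u by (rule cong_mod_mult)
        then have "cong_mod (modulus b j) (P * modulus b k * (u * w)) (modulus b k * w)"
          by (simp add: ac_simps)
        then show ?thesis using w cong_mod_trans by blast
      qed
      moreover have "\<forall>i<k + 1. modulus b i dvd P * modulus b k" using P(1) by (auto simp: PA(8))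
      moreover have "\<forall>i<k + 1. \<exists>v. v < modulus b i \<and> \<phi> i v \<and> (\<exists>q. a + P * t = q * modulus b i + v)"
        using old new v unfolding PA(8) by blast
      ultimately show "\<exists>a P. (\<forall>i<k + 1. modulus b i dvd P) \<and>
        (\<forall>j<n. k + 1 \<le> j \<longrightarrow> (\<exists>u. \<exists>q r. P * u + modulus b j * q = 1 + modulus b j * r)) \<and>
        (\<forall>i<k + 1. \<exists>v. v < modulus b i \<and> \<phi> i v \<and> (\<exists>q. a = q * modulus b i + v))"
        unfolding cong_mod_def by blast
    qed
  qed
  from this[of n] show ?thesis by auto
qed

text \<open>U depends on n and B alone, not on the coded sequence. This uniformity becomes the bound
  on patterns.\<close>

lemma bounded_coding:
  "\<exists>U. \<forall>\<phi>. delta0 (\<lambda>e. \<phi> (e 0) (e (Suc 0))) \<longrightarrow> (\<forall>i<n. \<exists>v<B. \<phi> i v) \<longrightarrow>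
    (\<exists>s<U. \<forall>i<n. \<exists>v. mentry s i v \<and> \<phi> i v)"
proof -
  obtain b where b: "B \<le> b" "\<forall>d<n. d + 1 dvd b" using ex_common_multiple by blast
  obtain Q where Q: "0 < Q" "\<forall>i<n. modulus b i dvd Q" using ex_modulus_product by blast
  have "\<exists>s<mpair Q b + 1. \<forall>i<n. \<exists>v. mentry s i v \<and> \<phi> i v"
    if \<phi>: "delta0 (\<lambda>e. \<phi> (e 0) (e (Suc 0)))" "\<forall>i<n. \<exists>v<B. \<phi> i v" for \<phi>
  proof -
    have "v < modulus b i" if "v < B" for v i
    proof -
      have "b * 1 \<le> b * (i + 1)" by (rule mult_left_mono) auto
      then have "v < b * (i + 1)" using that b(1) by simp
      then show ?thesis using PA(8) by blast
    qed
    then have "\<forall>i<n. \<exists>v<modulus b i. \<phi> i v" using \<phi>(2) by blast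
    from chinese_remainder[OF \<phi>(1) b(2) this] obtain a where
      a: "\<forall>i<n. \<exists>v. v < modulus b i \<and> \<phi> i v \<and> (\<exists>q. a = q * modulus b i + v)" by blast
    obtain q c where c: "c < Q" "a = q * Q + c" using quotient_exists[OF Q(1)] by blast
    have "\<exists>v. mentry (mpair c b) i v \<and> \<phi> i v" if "i < n" for i
    proof -
      obtain v r where v: "v < modulus b i" "\<phi> i v" "a = r * modulus b i + v" using a \<open>i < n\<close> by blast
      obtain p where "Q = modulus b i * p" using Q(2) \<open>i < n\<close> unfolding dvd_def by blast
      then have "c + modulus b i * (q * p) = v + modulus b i * r" using v(3) c(2) by (simp add: algebra_simps)
      then have "cong_mod (modulus b i) c v" unfolding cong_mod_def by blast
      then have "\<exists>q. c = q * modulus b i + v" using v(1) by (rule cong_mod_residue)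
      then show ?thesis using v(1,2) unfolding mentry_mpair by blast
    qed
    moreover have "mpair c b < mpair Q b + 1" using mpair_mono[of c Q b] c(1) by (simp add: less_succ)
    ultimately show ?thesis by blast
  qed
  then show ?thesis by blast
qed

lemma coding:
  assumes "delta0 (\<lambda>e. \<phi> (e 0) (e (Suc 0)))" "\<And>i. i < n \<Longrightarrow> \<exists>v. \<phi> i v"
  shows "\<exists>s. \<forall>i<n. \<exists>v. mentry s i v \<and> \<phi> i v"
proof -
  have "delta0 (\<lambda>e. \<phi> (e (Suc 0)) (e 0))" by (intro delta0_subst2[OF assms(1)] delta0_intros)
  from delta0_collection[OF this, of n] have "\<exists>B. \<forall>i<n. \<exists>v<B. \<phi> i v" using assms(2) by simp
  then show ?thesis using bounded_coding[of n] assms(1) by blast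
qed

lemma set_coding: "\<exists>U. \<forall>A\<in>sets. \<exists>s<U. \<forall>i<n. mentry s i 1 \<longleftrightarrow> i \<in> A"
proof -
  obtain U where U: "\<forall>\<phi>. delta0 (\<lambda>e. \<phi> (e 0) (e (Suc 0))) \<longrightarrow> (\<forall>i<n. \<exists>v<1 + 1. \<phi> i v) \<longrightarrow>
    (\<exists>s<U. \<forall>i<n. \<exists>v. mentry s i v \<and> \<phi> i v)" using bounded_coding[of n "1 + 1"] by blast
  have "\<exists>s<U. \<forall>i<n. mentry s i 1 \<longleftrightarrow> i \<in> A" if "A \<in> sets" for A
  proof -
    let ?\<phi> = "\<lambda>i v :: mnat. i \<in> A \<and> v = 1 \<or> i \<notin> A \<and> v = 0"
    have "delta0 (\<lambda>e. ?\<phi> (e 0) (e (Suc 0)))" using that by (intro delta0_intros)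
    moreover have "\<exists>v<1 + 1. ?\<phi> i v" for i by (cases "i \<in> A") (auto simp: less_succ)
    ultimately obtain s where s: "s < U" "\<forall>i<n. \<exists>v. mentry s i v \<and> ?\<phi> i v" using U[rule_format, of ?\<phi>] by blast
    have "mentry s i 1 \<longleftrightarrow> i \<in> A" if "i < n" for i
      using s(2) that mentry_unique[of s i 1 0] by auto
    then show ?thesis using s(1) by blast
  qed
  then show ?thesis by blast
qed

lemma delta0_subst4:
  assumes "delta0 (\<lambda>e. P (e 0) (e (Suc 0)) (e (Suc (Suc 0))) (e (Suc (Suc (Suc 0)))))"
    "dterm s" "dterm t" "dterm u" "dterm v"
  shows "delta0 (\<lambda>e. P (s e) (t e) (u e) (v e))"
  using delta0_subst[OF assms(1), of "\<lambda>e. case_nat (s e) (case_nat (t e) (case_nat (u e) (case_nat (v e) e)))"]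
    assms(2-) by (simp add: delta0_intros)

lemma sigma1_subst4:
  assumes "sigma1 (\<lambda>e. P (e 0) (e (Suc 0)) (e (Suc (Suc 0))) (e (Suc (Suc (Suc 0)))))"
    "dterm s" "dterm t" "dterm u" "dterm v"
  shows "sigma1 (\<lambda>e. P (s e) (t e) (u e) (v e))"
  using sigma1_subst[OF assms(1), of "\<lambda>e. case_nat (s e) (case_nat (t e) (case_nat (u e) (case_nat (v e) e)))"]
    assms(2-) by (simp add: delta0_intros)

lemma sigma1_subst2:
  assumes "sigma1 (\<lambda>e. P (e 0) (e (Suc 0)))" "dterm s" "dterm t"
  shows "sigma1 (\<lambda>e. P (s e) (t e))"
  using sigma1_subst[OF assms(1), of "\<lambda>e. case_nat (s e) (case_nat (t e) e)"]
    assms(2-) by (simp add: delta0_intros)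

text \<open>Concatenation of a segment of s with one of t. It builds the tuples to be coloured and
  replaces the later stages of a block.\<close>

lemma splice:
  assumes "\<And>i. i < a \<Longrightarrow> \<exists>v. mentry s i v" "\<And>i. i < l \<Longrightarrow> \<exists>v. mentry t (i + b) v"
  shows "\<exists>u. (\<forall>i<a. \<exists>v. mentry u i v \<and> mentry s i v) \<and> (\<forall>i<l. \<exists>v. mentry u (a + i) v \<and> mentry t (i + b) v)"
proof -
  let ?\<phi> = "\<lambda>i v. i < a \<and> mentry s i v \<or> (\<exists>k<i + 1. i = a + k \<and> mentry t (k + b) v)"
  have "delta0 (\<lambda>e. ?\<phi> (e 0) (e (Suc 0)))" by (intro delta0_intros)
  moreover have "\<exists>v. ?\<phi> i v" if i: "i < a + l" for i
  proof (cases "i < a")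
    case True then show ?thesis using assms(1) by blast
  next
    case False
    then obtain k where k: "i = a + k" by (metis not_le mnat_leE)
    then have "k < l" "k < i + 1" using i by (simp_all add: less_succ)
    then show ?thesis using assms(2)[of k] k by blast
  qed
  ultimately obtain u where u: "\<forall>i<a + l. \<exists>v. mentry u i v \<and> ?\<phi> i v" using coding[of ?\<phi> "a + l"] by blast
  have "\<exists>v. mentry u i v \<and> mentry s i v" if "i < a" for i
  proof -
    have "i < a + l" using that by (meson less_le_trans le_add_same_cancel1 zero_le)
    then obtain v where "mentry u i v" "?\<phi> i v" using u by blast
    moreover have "\<not> (i = a + k)" for k using that by auto
    ultimately show ?thesis by blast
  qed
  moreover have "\<exists>v. mentry u (a + i) v \<and> mentry t (i + b) v" if "i < l" for i
  proof -
    have "a + i < a + l" using that by simp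
    then obtain v where "mentry u (a + i) v" "?\<phi> (a + i) v" using u by blast
    then show ?thesis by auto
  qed
  ultimately show ?thesis by blast
qed

section \<open>The jump as an existential quantifier\<close>

definition theta :: "mnat \<Rightarrow> mnat \<Rightarrow> mnat set \<Rightarrow> bool" where
  "theta e w A \<longleftrightarrow> (\<exists>k<w. \<exists>a<w. \<exists>b<w. \<exists>y<w. mderivation A k a b \<and> mcomputed k a b e e y)"

lemma mhalts_iff_theta: "mhalts A e e \<longleftrightarrow> (\<exists>w. theta e w A)"
proof
  assume "mhalts A e e"
  then obtain k a b y where *: "mderivation A k a b" "mcomputed k a b e e y" unfolding mhalts_def by blast
  have "k < k + a + b + y + 1" "a < k + a + b + y + 1" "b < k + a + b + y + 1" "y < k + a + b + y + 1"
    using mint_nonneg[of k] mint_nonneg[of a] mint_nonneg[of b] mint_nonneg[of y]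
    by (simp_all add: to_mint)
  then show "\<exists>w. theta e w A" using * unfolding theta_def by blast
qed (auto simp: theta_def mhalts_def)

lemma theta_mono: "theta e w A \<Longrightarrow> w \<le> w' \<Longrightarrow> theta e w' A"
  unfolding theta_def by (meson less_le_trans)

text \<open>The oracle is consulted only at arguments of assertions in the finite set, and these are
  below k.\<close>

lemma mderivation_local:
  "\<forall>z<k. z \<in> A \<longleftrightarrow> z \<in> B \<Longrightarrow> mderivation A k a b \<longleftrightarrow> mderivation B k a b"
  unfolding mderivation_def mjustified_def by simp

lemma theta_local:
  assumes "\<And>z. z < w \<Longrightarrow> z \<in> A \<longleftrightarrow> z \<in> B" shows "theta e w A \<longleftrightarrow> theta e w B"
proof -
  have "mderivation A k a b \<longleftrightarrow> mderivation B k a b" if "k < w" for k a b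
    using assms that by (intro mderivation_local) (meson less_trans)
  then show ?thesis unfolding theta_def by blast
qed

text \<open>Entry j of w is itself a code, namely of the characteristic function of set number
  j.\<close>

definition inrun :: "mnat \<Rightarrow> mnat \<Rightarrow> mnat \<Rightarrow> bool" where
  "inrun w j x \<longleftrightarrow> (\<exists>c<w + 1. mentry w j c \<and> mentry c x 1)"

lemma inrun_iff: "mentry w j c \<Longrightarrow> inrun w j x \<longleftrightarrow> mentry c x 1"
  unfolding inrun_def using mentry_unique mentry_le by blast

lemma delta0_inrun [delta0_intros]:
  "dterm w \<Longrightarrow> dterm j \<Longrightarrow> dterm x \<Longrightarrow> delta0 (\<lambda>e. inrun (w e) (j e) (x e))"
proof (rule delta0_subst3)
  show "delta0 (\<lambda>e. inrun (e 0) (e (Suc 0)) (e (Suc (Suc 0))))"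
    unfolding inrun_def by (intro delta0_intros)
qed

text \<open>The oracle is given by a number, so that it can be quantified; for such oracles
  \<open>theta\<close> is a bounded condition.\<close>

lemma delta0_theta [delta0_intros]:
  "dterm x \<Longrightarrow> dterm v \<Longrightarrow> dterm w \<Longrightarrow> dterm j \<Longrightarrow> delta0 (\<lambda>e. theta (x e) (v e) {z. inrun (w e) (j e) z})"
proof (rule delta0_subst4)
  show "delta0 (\<lambda>e. theta (e 0) (e (Suc 0)) {z. inrun (e (Suc (Suc 0))) (e (Suc (Suc (Suc 0)))) z})"
    unfolding theta_def mderivation_def mjustified_def mcomputed_def mfinset_def mem_Collect_eq
    by (intro delta0_intros)
qed

section \<open>Approximations of the iterated jumps\<close>

locale approximation =
  fixes n :: mnat and X :: "mnat set"
  assumes X: "X \<in> sets"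
begin

text \<open>
  The number \<open>w\<close> codes the sequence of sets \<open>B\<^sub>0, \<dots>, B\<^sub>n\<close> of the introduction, restricted to numbers
  below \<open>K\<close>, for the stages found in \<open>t\<close> from position \<open>l\<close> on: the stage \<open>s\<^sub>j\<^sub>+\<^sub>1\<close> that yields \<open>B\<^sub>j\<close> is entry
  \<open>l + j\<close>.
\<close>

definition run :: "mnat \<Rightarrow> mnat \<Rightarrow> mnat \<Rightarrow> mnat \<Rightarrow> bool" where
  "run K t l w \<longleftrightarrow> (\<forall>x<K. inrun w n x \<longleftrightarrow> x \<in> X) \<and>
    (\<forall>j<n. \<exists>v<K. mentry t (l + j) v \<and> (\<forall>x<K. inrun w j x \<longleftrightarrow> theta x v {z. inrun w (j + 1) z}))"

lemma delta0_run [delta0_intros]: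
  "dterm K \<Longrightarrow> dterm t \<Longrightarrow> dterm l \<Longrightarrow> dterm w \<Longrightarrow> delta0 (\<lambda>e. run (K e) (t e) (l e) (w e))"
proof (rule delta0_subst4)
  show "delta0 (\<lambda>e. run (e 0) (e (Suc 0)) (e (Suc (Suc 0))) (e (Suc (Suc (Suc 0)))))"
    unfolding run_def by (intro delta0_intros X)
qed

lemma run_exists:
  assumes t: "\<And>j. j < n \<Longrightarrow> \<exists>v<K. mentry t (l + j) v"
  shows "\<exists>w. run K t l w"
proof -
  have code: "\<exists>c. \<forall>x<K. mentry c x 1 \<longleftrightarrow> x \<in> A" if "A \<in> sets" for A
    using set_coding[of K] that by blast
  \<comment> \<open>After m steps the entries for j from n - m to n are correct. The others are only
    required to exist, so that one entry can be replaced in each step.\<close>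
  have "\<exists>w. (\<forall>j<n + 1. \<exists>c. mentry w j c) \<and> (\<forall>x<K. inrun w n x \<longleftrightarrow> x \<in> X) \<and>
    (\<forall>j<n. n \<le> j + m \<longrightarrow>
      (\<exists>v<K. mentry t (l + j) v \<and> (\<forall>x<K. inrun w j x \<longleftrightarrow> theta x v {z. inrun w (j + 1) z})))" for m
  proof (induction m rule: sigma1_induct)
    case definable
    show ?case by (intro sigma1_intros; intro sigma1_delta0 delta0_intros X)
  next
    case zero
    obtain c where c: "\<forall>x<K. mentry c x 1 \<longleftrightarrow> x \<in> X" using code[OF X] by blast
    have "delta0 (\<lambda>e. e (Suc 0) = c)" by (intro delta0_intros)
    then obtain w where "\<forall>i<n + 1. \<exists>v. mentry w i v \<and> v = c"
      using coding[of "\<lambda>i v. v = c" "n + 1"] by blast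
    then have w: "\<forall>i<n + 1. mentry w i c" by blast
    then have "mentry w n c" using PA(8) by blast
    then have "\<forall>x<K. inrun w n x \<longleftrightarrow> x \<in> X" using c inrun_iff by simp
    moreover have "\<not> n \<le> j + 0" if "j < n" for j using that by simp
    ultimately show ?case using w by blast
  next
    case (suc m)
    then obtain w where entries: "\<forall>j<n + 1. \<exists>c. mentry w j c" and top: "\<forall>x<K. inrun w n x \<longleftrightarrow> x \<in> X"
      and step: "\<forall>j<n. n \<le> j + m \<longrightarrow>
        (\<exists>v<K. mentry t (l + j) v \<and> (\<forall>x<K. inrun w j x \<longleftrightarrow> theta x v {z. inrun w (j + 1) z}))"
      by blast
    show ?case
    proof (cases "n \<le> m")
      case True
      then have "n \<le> j + m" for j by (meson add_increasing zero_le)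
      then show ?thesis using entries top step by blast
    next
      case False
      then have "m < n" by simp
      \<comment> \<open>i is n - m - 1, the entry to be filled in now.\<close>
      then obtain i where i: "n = m + (i + 1)" by (rule mnat_lessE)
      then have "i < n" using mint_nonneg[of m] by (simp add: to_mint)
      then obtain v where v: "v < K" "mentry t (l + i) v" using t by blast
      have "delta0 (\<lambda>e. theta (e 0) v {z. inrun w (i + 1) z})" by (intro delta0_intros)
      then have "{x. theta x v {z. inrun w (i + 1) z}} \<in> sets" by (rule delta0_comprehension)
      from code[OF this] obtain c where c: "\<forall>x<K. mentry c x 1 \<longleftrightarrow> theta x v {z. inrun w (i + 1) z}" by auto
      let ?\<phi> = "\<lambda>j u. j = i \<and> u = c \<or> j \<noteq> i \<and> mentry w j u"
      have "delta0 (\<lambda>e. ?\<phi> (e 0) (e (Suc 0)))" by (intro delta0_intros)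
      moreover have "\<exists>u. ?\<phi> j u" if "j < n + 1" for j using entries that by blast
      ultimately obtain w' where w': "\<forall>j<n + 1. \<exists>u. mentry w' j u \<and> ?\<phi> j u" using coding[of ?\<phi> "n + 1"] by blast
      have other: "inrun w' j x \<longleftrightarrow> inrun w j x" if "j < n + 1" "j \<noteq> i" for j x
        using w' that inrun_iff by metis
      have "i < n + 1" using \<open>i < n\<close> PA(8) by blast
      then have new: "inrun w' i x \<longleftrightarrow> mentry c x 1" for x
        using w' inrun_iff by metis
      have "\<exists>v<K. mentry t (l + j) v \<and> (\<forall>x<K. inrun w' j x \<longleftrightarrow> theta x v {z. inrun w' (j + 1) z})"
        if "j < n" "n \<le> j + (m + 1)" for j
      proof -
        have "i \<le> j" using i that(2) by (simp add: to_mint)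
        have "j < n + 1" "j + 1 < n + 1" "j + 1 \<noteq> i" using \<open>j < n\<close> \<open>i \<le> j\<close> by (auto simp: to_mint)
        then have j1: "inrun w' (j + 1) z \<longleftrightarrow> inrun w (j + 1) z" for z using other by blast
        show ?thesis
        proof (cases "j = i")
          case True
          then show ?thesis using v c new j1 by auto
        next
          case False
          then have "i < j" using \<open>i \<le> j\<close> by simp
          then have "n \<le> j + m" using i by (simp add: to_mint)
          moreover have "inrun w' j x \<longleftrightarrow> inrun w j x" for x using other \<open>j < n + 1\<close> False by blast
          ultimately show ?thesis using step \<open>j < n\<close> unfolding j1 by simp
        qed
      qed
      moreover have "\<forall>j<n + 1. \<exists>c. mentry w' j c" using w' by blast
      moreover have "\<forall>x<K. inrun w' n x \<longleftrightarrow> x \<in> X" using other[of n] \<open>i < n\<close> PA(8) top by auto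
      ultimately show ?thesis by blast
    qed
  qed
  from this[of n] show ?thesis unfolding run_def by (auto simp: add_increasing)
qed

text \<open>Downward from n: both runs start with X, and entry j depends on its stage v and on entry
  \<open>j + 1\<close> below v, hence below both K and \<open>K'\<close>. Only stages from i on are
  involved, so the runs may differ in earlier ones.\<close>

lemma run_agree:
  assumes r: "run K t l w" "run K' t' l' w'"
    and st: "\<And>j. j < n \<Longrightarrow> i \<le> j \<Longrightarrow> \<exists>v. mentry t (l + j) v \<and> mentry t' (l' + j) v"
    and "i \<le> j" "j \<le> n" "x < K" "x < K'"
  shows "inrun w j x \<longleftrightarrow> inrun w' j x"
proof -
  have "\<forall>j<n + 1. i \<le> j \<and> n \<le> j + m \<longrightarrow> (\<forall>x<K. x < K' \<longrightarrow> (inrun w j x \<longleftrightarrow> inrun w' j x))" for m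
  proof (induction m rule: delta0_induct)
    case definable show ?case by (intro delta0_intros)
  next
    case zero
    have "j = n" if "j < n + 1" "n \<le> j + 0" for j using that by (simp add: less_succ)
    then show ?case using r unfolding run_def by blast
  next
    case (suc m)
    have "inrun w j x \<longleftrightarrow> inrun w' j x"
      if j: "j < n + 1" "i \<le> j" "n \<le> j + (m + 1)" and x: "x < K" "x < K'" for j x
    proof (cases "j = n")
      case True
      then show ?thesis using r x unfolding run_def by blast
    next
      case False
      then have "j < n" using j(1) by (simp add: PA(8))
      obtain v where v: "v < K" "mentry t (l + j) v" "inrun w j x \<longleftrightarrow> theta x v {z. inrun w (j + 1) z}"
        using r(1) \<open>j < n\<close> x unfolding run_def by blast
      obtain v' where v': "v' < K'" "mentry t' (l' + j) v'" "inrun w' j x \<longleftrightarrow> theta x v' {z. inrun w' (j + 1) z}"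
        using r(2) \<open>j < n\<close> x unfolding run_def by blast
      have "v' = v" using st[OF \<open>j < n\<close> j(2)] v v' mentry_unique by metis
      have "j + 1 < n + 1" "i \<le> j + 1" "n \<le> j + 1 + m" using j \<open>j < n\<close> by (simp_all add: to_mint)
      then have "inrun w (j + 1) z \<longleftrightarrow> inrun w' (j + 1) z" if "z < v" for z
        using suc that v(1) v'(1) \<open>v' = v\<close> less_trans by blast
      then show ?thesis unfolding v(3) v'(3) \<open>v' = v\<close> by (intro theta_local) simp
    qed
    then show ?case by blast
  qed
  from this[of n] show ?thesis using assms(4-) by (auto simp: less_succ add_increasing)
qed

section \<open>Approximations independent of the run\<close>

definition block :: "mnat \<Rightarrow> mnat \<Rightarrow> bool" where
  "block t l \<longleftrightarrow> (\<forall>j<n. \<exists>v. mentry t (l + j) v)"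

lemma block_run: "block t l \<Longrightarrow> \<exists>K w. m \<le> K \<and> run K t l w"
proof -
  assume "block t l"
  then have "\<exists>v<m + t + 1. mentry t (l + j) v" if "j < n" for j
  proof -
    obtain v where "mentry t (l + j) v" using \<open>block t l\<close> \<open>j < n\<close> unfolding block_def by blast
    moreover from this have "v < m + t + 1" using mentry_le[of t "l + j" v] mint_nonneg[of m] by (simp add: to_mint)
    ultimately show ?thesis by blast
  qed
  then obtain w where "run (m + t + 1) t l w" using run_exists by blast
  moreover have "m \<le> m + t + 1" by (simp add: add.assoc)
  ultimately show ?thesis by blast
qed

definition approx :: "mnat \<Rightarrow> mnat \<Rightarrow> mnat \<Rightarrow> mnat \<Rightarrow> bool" where
  "approx t l j x \<longleftrightarrow> (\<exists>K w. x < K \<and> run K t l w \<and> inrun w j x)"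

lemma run_block: "run K t l w \<Longrightarrow> block t l"
  unfolding run_def block_def by blast

text \<open>By \<open>run_agree\<close>, all runs with the same stages give the same answer, so a
  single run decides \<open>approx\<close> both ways.\<close>

lemma approx_run: "run K t l w \<Longrightarrow> j \<le> n \<Longrightarrow> x < K \<Longrightarrow> approx t l j x \<longleftrightarrow> inrun w j x"
proof -
  assume r: "run K t l w" "j \<le> n" "x < K"
  have "inrun w' j x \<longleftrightarrow> inrun w j x" if "run K' t l w'" "x < K'" for K' w'
    using run_agree[OF that(1) r(1), of 0 j x] run_block[OF r(1)] r(2,3) that(2) unfolding block_def by auto
  then show ?thesis unfolding approx_def using r by blast
qed

lemma approx_cong:
  assumes "block t l" "block t' l'" "j \<le> n"
    and "\<And>i. i < n \<Longrightarrow> j \<le> i \<Longrightarrow> \<exists>v. mentry t (l + i) v \<and> mentry t' (l' + i) v"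
  shows "approx t l j x \<longleftrightarrow> approx t' l' j x"
proof -
  obtain K w K' w' where r: "x + 1 \<le> K" "run K t l w" "x + 1 \<le> K'" "run K' t' l' w'"
    using block_run[OF assms(1)] block_run[OF assms(2)] by meson
  then have "x < K" "x < K'" by (simp_all only: succ_le)
  then show ?thesis
    using run_agree[OF r(2,4) assms(4) order_refl assms(3)] r(2,4) approx_run assms(3) by blast
qed

lemma approx_top: "block t l \<Longrightarrow> approx t l n x \<longleftrightarrow> x \<in> X"
proof -
  assume "block t l"
  then obtain K w where r: "x + 1 \<le> K" "run K t l w" using block_run by blast
  then have "x < K" by (simp only: succ_le)
  then show ?thesis using approx_run[OF r(2) order_refl] r(2) unfolding run_def by blast
qed

lemma approx_step:
  assumes "block t l" "j < n" "mentry t (l + j) v"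
  shows "approx t l j x \<longleftrightarrow> theta x v {z. approx t l (j + 1) z}"
proof -
  obtain K w where r: "x + 1 \<le> K" "run K t l w" using block_run[OF assms(1)] by blast
  then have x: "x < K" by (simp only: succ_le)
  obtain v' where "v' < K" "mentry t (l + j) v'" "inrun w j x \<longleftrightarrow> theta x v' {z. inrun w (j + 1) z}"
    using r(2) assms(2) x unfolding run_def by blast
  then have v: "v < K" "inrun w j x \<longleftrightarrow> theta x v {z. inrun w (j + 1) z}"
    using assms(3) mentry_unique by metis+
  have "j + 1 \<le> n" using assms(2) by (simp only: succ_le)
  \<comment> \<open>The run is exact only below K, but stage v is below K and consults only numbers
    below v.\<close>
  then have "inrun w (j + 1) z \<longleftrightarrow> approx t l (j + 1) z" if "z < v" for z
    using approx_run[OF r(2)] v(1) that less_trans by blast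
  then have "theta x v {z. inrun w (j + 1) z} \<longleftrightarrow> theta x v {z. approx t l (j + 1) z}"
    by (intro theta_local) simp
  then show ?thesis using v(2) approx_run[OF r(2) less_imp_le[OF assms(2)] x] by blast
qed

text \<open>
  For a code \<open>t\<close> without the required entries there is no run at all, and neither \<open>pattern\<close> nor
  \<open>nonpattern\<close> holds. For blocks they are complementary, which makes patterns \<open>\<Delta>\<^sub>1\<close>-definable.
\<close>

definition pattern :: "mnat \<Rightarrow> mnat \<Rightarrow> mnat \<Rightarrow> mnat \<Rightarrow> bool" where
  "pattern m t l p \<longleftrightarrow> (\<exists>K w. m \<le> K \<and> run K t l w \<and>
    (\<forall>j<n + 1. \<forall>x<m. mentry p (mpair j x) 1 \<longleftrightarrow> inrun w j x))"

definition nonpattern :: "mnat \<Rightarrow> mnat \<Rightarrow> mnat \<Rightarrow> mnat \<Rightarrow> bool" where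
  "nonpattern m t l p \<longleftrightarrow> (\<exists>K w. m \<le> K \<and> run K t l w \<and>
    \<not> (\<forall>j<n + 1. \<forall>x<m. mentry p (mpair j x) 1 \<longleftrightarrow> inrun w j x))"

lemma run_pattern:
  assumes "run K t l w" "m \<le> K"
  shows "(\<forall>j<n + 1. \<forall>x<m. mentry p (mpair j x) 1 \<longleftrightarrow> inrun w j x) \<longleftrightarrow>
    (\<forall>j<n + 1. \<forall>x<m. mentry p (mpair j x) 1 \<longleftrightarrow> approx t l j x)"
proof -
  have "approx t l j x \<longleftrightarrow> inrun w j x" if "j < n + 1" "x < m" for j x
  proof -
    have "j \<le> n" "x < K" using that assms(2) by (simp_all add: less_succ)
    then show ?thesis using approx_run[OF assms(1)] by blast
  qed
  then show ?thesis by simp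
qed

lemma pattern_iff:
  assumes "block t l"
  shows "pattern m t l p \<longleftrightarrow> (\<forall>j<n + 1. \<forall>x<m. mentry p (mpair j x) 1 \<longleftrightarrow> approx t l j x)"
    and "nonpattern m t l p \<longleftrightarrow> \<not> (\<forall>j<n + 1. \<forall>x<m. mentry p (mpair j x) 1 \<longleftrightarrow> approx t l j x)"
  unfolding pattern_def nonpattern_def using run_pattern[of _ t l _ m p] block_run[OF assms, of m] by blast+

text \<open>A pattern has many codes. The least one represents it, so that patterns can be compared
  as numbers; \<open>nonpattern\<close> keeps the definition Sigma1.\<close>

definition least_pattern :: "mnat \<Rightarrow> mnat \<Rightarrow> mnat \<Rightarrow> mnat \<Rightarrow> bool" where
  "least_pattern m t l p \<longleftrightarrow> pattern m t l p \<and> (\<forall>q<p. nonpattern m t l q)"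

lemma sigma1_pattern [sigma1_intros]:
  assumes "dterm m" "dterm t" "dterm l" "dterm p"
  shows "sigma1 (\<lambda>e. pattern (m e) (t e) (l e) (p e))" "sigma1 (\<lambda>e. nonpattern (m e) (t e) (l e) (p e))"
    "sigma1 (\<lambda>e. least_pattern (m e) (t e) (l e) (p e))"
proof -
  have *: "sigma1 (\<lambda>e. pattern (e 0) (e (Suc 0)) (e (Suc (Suc 0))) (e (Suc (Suc (Suc 0)))))"
    unfolding pattern_def by (intro sigma1_ex sigma1_delta0 delta0_intros)
  have **: "sigma1 (\<lambda>e. nonpattern (e 0) (e (Suc 0)) (e (Suc (Suc 0))) (e (Suc (Suc (Suc 0)))))"
    unfolding nonpattern_def by (intro sigma1_ex sigma1_delta0 delta0_intros)
  show "sigma1 (\<lambda>e. pattern (m e) (t e) (l e) (p e))" by (rule sigma1_subst4[OF * assms])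
  show "sigma1 (\<lambda>e. nonpattern (m e) (t e) (l e) (p e))" by (rule sigma1_subst4[OF ** assms])
  have "sigma1 (\<lambda>e. least_pattern (e 0) (e (Suc 0)) (e (Suc (Suc 0))) (e (Suc (Suc (Suc 0)))))"
    unfolding least_pattern_def
    by (intro sigma1_and sigma1_ball sigma1_subst4[OF *] sigma1_subst4[OF **] delta0_intros)
  from sigma1_subst4[OF this assms] show "sigma1 (\<lambda>e. least_pattern (m e) (t e) (l e) (p e))" .
qed

lemma least_pattern_exists: "\<exists>U. \<forall>t l. block t l \<longrightarrow> (\<exists>p<U. least_pattern m t l p)"
proof -
  \<comment> \<open>\<open>mpair n m\<close> bounds all positions \<open>mpair j x\<close> with
    \<open>j \<le> n\<close> and \<open>x < m\<close>.\<close>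
  obtain U where U: "\<forall>A\<in>sets. \<exists>p<U. \<forall>i<mpair n m + 1. mentry p i 1 \<longleftrightarrow> i \<in> A" using set_coding by blast
  have "\<exists>p<U. least_pattern m t l p" if block: "block t l" for t l
  proof -
    obtain K w where r: "m \<le> K" "run K t l w" using block_run[OF block] by blast
    let ?A = "{z. \<exists>j<z + 1. \<exists>x<z + 1. z = mpair j x \<and> inrun w j x}"
    have "?A \<in> sets" by (rule delta0_comprehension) (intro delta0_intros)
    from bspec[OF U this] obtain p where p: "p < U" "\<forall>i<mpair n m + 1. mentry p i 1 \<longleftrightarrow> i \<in> ?A"
      by (elim exE conjE)
    have "mentry p (mpair j x) 1 \<longleftrightarrow> inrun w j x" if "j < n + 1" "x < m" for j x
    proof -
      have "mpair j x < mpair n m + 1"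
        unfolding less_succ mpair_def using that by (intro add_mono mult_mono) (auto simp: less_succ less_imp_le)
      moreover have "j < mpair j x + 1" "x < mpair j x + 1" by (simp_all only: less_succ mpair_ge)
      then have "mpair j x \<in> ?A \<longleftrightarrow> inrun w j x" by auto
      ultimately show ?thesis using p(2) by blast
    qed
    then have "pattern m t l p" unfolding pattern_def using r by blast
    \<comment> \<open>The least number principle asks for a Sigma1 complement, which for blocks is
      \<open>nonpattern\<close>.\<close>
    moreover have "sigma1 (\<lambda>e. \<not> pattern m t l (e 0))"
    proof -
      have "sigma1 (\<lambda>e. nonpattern m t l (e 0))" by (intro sigma1_intros delta0_intros)
      then show ?thesis unfolding pattern_iff(1)[OF block] pattern_iff(2)[OF block] .
    qed
    ultimately obtain p' where p': "pattern m t l p'" "\<forall>q<p'. \<not> pattern m t l q"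
      using least_element[of "\<lambda>p. pattern m t l p" p] by blast
    then have "least_pattern m t l p'"
      unfolding least_pattern_def pattern_iff[OF block] by blast
    moreover have "p' < U" using p' \<open>pattern m t l p\<close> p(1) by (meson le_less_trans not_le)
    ultimately show ?thesis by blast
  qed
  then show ?thesis by blast
qed

lemma least_pattern_block: "least_pattern m t l p \<Longrightarrow> block t l"
  unfolding least_pattern_def pattern_def using run_block by blast

lemma least_pattern_unique:
  assumes p: "least_pattern m t l p" and q: "least_pattern m t l q"
  shows "p = q"
proof -
  have "\<not> q' < p'" if "least_pattern m t l p'" "least_pattern m t l q'" for p' q'
    using that pattern_iff[OF least_pattern_block[OF p], of m q'] unfolding least_pattern_def by blast
  then show ?thesis using p q by (meson linorder_neqE)
qed

lemma least_pattern_cong: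
  assumes "least_pattern m t l p" "block t' l'"
    and "\<And>i. i < n \<Longrightarrow> \<exists>v. mentry t (l + i) v \<and> mentry t' (l' + i) v"
  shows "least_pattern m t' l' p"
proof -
  have b: "block t l" using assms(1) by (rule least_pattern_block)
  have "approx t l j x \<longleftrightarrow> approx t' l' j x" if "j < n + 1" for j x
    using that by (intro approx_cong b assms(2,3)) (auto simp: less_succ)
  then show ?thesis
    using assms(1) unfolding least_pattern_def pattern_iff[OF b] pattern_iff[OF assms(2)] by simp
qed

lemma least_pattern_approx:
  assumes "least_pattern m t l p" "least_pattern m t' l' p" "j \<le> n" "x < m"
  shows "approx t l j x \<longleftrightarrow> approx t' l' j x"
proof -
  have "j < n + 1" using assms(3) by (simp only: less_succ)
  then show ?thesis
    using assms pattern_iff(1)[OF least_pattern_block[OF assms(1)]] pattern_iff(1)[OF least_pattern_block[OF assms(2)]]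
    unfolding least_pattern_def by blast
qed

end

section \<open>The colouring\<close>

lemma delta0_mnset [delta0_intros]: "dterm k \<Longrightarrow> dterm s \<Longrightarrow> delta0 (\<lambda>e. mnset (k e) (s e))"
proof (rule delta0_subst2)
  show "delta0 (\<lambda>e. mnset (e 0) (e (Suc 0)))" unfolding mnset_def by (intro delta0_intros)
qed

lemma mnset_entry: "mnset k s \<Longrightarrow> i < k \<Longrightarrow> \<exists>v. mentry s i v"
  unfolding mnset_def by blast

context approximation
begin

text \<open>Position 0 of s holds m; the two blocks of stages begin at positions 1 and
  \<open>1 + n\<close>.\<close>

definition colour :: "mnat \<Rightarrow> mnat \<Rightarrow> bool" where
  "colour s c \<longleftrightarrow> (\<exists>m p q. mentry s 0 m \<and> least_pattern m s 1 p \<and> least_pattern m s (1 + n) q \<and>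
    (p = q \<and> c = 0 \<or> q < p \<and> c = 1 \<or> p < q \<and> c = 1 + 1))"

lemma sigma1_colour [sigma1_intros]: "dterm s \<Longrightarrow> dterm c \<Longrightarrow> sigma1 (\<lambda>e. colour (s e) (c e))"
proof (rule sigma1_subst2)
  show "sigma1 (\<lambda>e. colour (e 0) (e (Suc 0)))"
    unfolding colour_def by (intro sigma1_intros; intro sigma1_delta0 delta0_intros)
qed

text \<open>Colours are read off the entries: equal entries give equal approximations, so the least
  patterns agree whatever the codes.\<close>

lemma colour_unique:
  assumes "colour s c" "colour t d" "mentry s 0 m" "mentry t 0 m"
    and "\<And>i. i < n \<Longrightarrow> \<exists>v. mentry s (1 + i) v \<and> mentry t (1 + i) v"
    and "\<And>i. i < n \<Longrightarrow> \<exists>v. mentry s (1 + n + i) v \<and> mentry t (1 + n + i) v"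
  shows "c = d"
proof -
  obtain p q where p: "least_pattern m s 1 p" "least_pattern m s (1 + n) q"
    "p = q \<and> c = 0 \<or> q < p \<and> c = 1 \<or> p < q \<and> c = 1 + 1"
    using assms(1,3) mentry_unique unfolding colour_def by metis
  obtain p' q' where p': "least_pattern m t 1 p'" "least_pattern m t (1 + n) q'"
    "p' = q' \<and> d = 0 \<or> q' < p' \<and> d = 1 \<or> p' < q' \<and> d = 1 + 1"
    using assms(2,4) mentry_unique unfolding colour_def by metis
  have "least_pattern m t 1 p" "least_pattern m t (1 + n) q"
    using least_pattern_cong[OF p(1) least_pattern_block[OF p'(1)] assms(5)]
      least_pattern_cong[OF p(2) least_pattern_block[OF p'(2)] assms(6)] by simp_all
  then have "p = p'" "q = q'" using p' least_pattern_unique by blast+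
  then show ?thesis using p(3) p'(3) by auto
qed

lemma position_bounds: "0 < 1 + n + n" "i < n \<Longrightarrow> 1 + i < 1 + n + n" "i < n \<Longrightarrow> 1 + n + i < 1 + n + n"
  using mint_nonneg[of n] by (simp_all add: to_mint)

lemma mnset_blocks: "mnset (1 + n + n) s \<Longrightarrow> block s 1 \<and> block s (1 + n)"
  unfolding block_def using mnset_entry position_bounds by blast

lemma colour_exists:
  assumes "mnset (1 + n + n) s" shows "\<exists>c<1 + 1 + 1. colour s c"
proof -
  obtain m where m: "mentry s 0 m" using mnset_entry[OF assms position_bounds(1)] by blast
  obtain p q where "least_pattern m s 1 p" "least_pattern m s (1 + n) q"
    using least_pattern_exists[of m] mnset_blocks[OF assms] by meson
  moreover consider "p = q" | "q < p" | "p < q" by (rule linorder_cases) auto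
  moreover have "(0::mnat) < 1 + 1 + 1" "(1::mnat) < 1 + 1 + 1" "(1 + 1::mnat) < 1 + 1 + 1"
    by (simp_all add: to_mint)
  ultimately show ?thesis unfolding colour_def using m by metis
qed

definition colouring_set :: "mnat set" where
  "colouring_set = {z. \<exists>s c. z = mpair s c \<and> mnset (1 + n + n) s \<and> colour s c}"

lemma mem_colouring_set: "mpair s c \<in> colouring_set \<longleftrightarrow> mnset (1 + n + n) s \<and> colour s c"
  by (simp add: colouring_set_def)

lemma colour_functional: "mnset (1 + n + n) s \<Longrightarrow> colour s c \<Longrightarrow> colour s d \<Longrightarrow> c = d"
proof -
  assume s: "mnset (1 + n + n) s" and c: "colour s c" "colour s d"
  obtain m where m: "mentry s 0 m" using mnset_entry[OF s position_bounds(1)] by blast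
  show "c = d"
    using colour_unique[OF c m m] mnset_blocks[OF s] unfolding block_def by blast
qed

lemma colouring_set: "colouring_set \<in> sets"
  unfolding colouring_set_def
proof (rule comprehension)
  show "sigma1 (\<lambda>e. \<exists>s c. e 0 = mpair s c \<and> mnset (1 + n + n) s \<and> colour s c)"
    by (intro sigma1_intros; intro sigma1_delta0 delta0_intros)
  \<comment> \<open>A tuple fails to have colour c exactly if it has another colour, which is again
    Sigma1.\<close>
  have "sigma1 (\<lambda>e. \<forall>s<e 0 + 1. \<forall>c<e 0 + 1. e 0 \<noteq> mpair s c \<or>
      \<not> mnset (1 + n + n) s \<or> (\<exists>d. d \<noteq> c \<and> colour s d))"
    by (intro sigma1_intros; intro sigma1_delta0 delta0_intros)
  moreover have "(\<forall>s<z + 1. \<forall>c<z + 1. z \<noteq> mpair s c \<or>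
      \<not> mnset (1 + n + n) s \<or> (\<exists>d. d \<noteq> c \<and> colour s d)) \<longleftrightarrow>
    \<not> (\<exists>s c. z = mpair s c \<and> mnset (1 + n + n) s \<and> colour s c)" (is "?L \<longleftrightarrow> ?R") for z
  proof
    assume L: ?L
    show ?R
    proof
      assume "\<exists>s c. z = mpair s c \<and> mnset (1 + n + n) s \<and> colour s c"
      then obtain s c where sc: "z = mpair s c" "mnset (1 + n + n) s" "colour s c" by blast
      then have "s < z + 1" "c < z + 1" by (simp_all only: less_succ mpair_ge)
      then obtain d where "d \<noteq> c" "colour s d" using L sc by blast
      then show False using colour_functional sc by blast
    qed
  next
    assume R: ?R
    have "\<exists>d. d \<noteq> c \<and> colour s d" if "z = mpair s c" "mnset (1 + n + n) s" for s c
    proof -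
      obtain d where "colour s d" using colour_exists[OF \<open>mnset _ s\<close>] by blast
      moreover have "d \<noteq> c" using R that calculation by blast
      ultimately show ?thesis by blast
    qed
    then show ?L by blast
  qed
  ultimately show "sigma1 (\<lambda>e. \<not> (\<exists>s c. e 0 = mpair s c \<and> mnset (1 + n + n) s \<and> colour s c))" by simp
qed

lemma mcolouring: "mcolouring (1 + n + n) (1 + 1 + 1) colouring_set"
  unfolding mcolouring_def mem_colouring_set
proof (intro conjI allI impI)
  show "\<exists>c<1 + 1 + 1. mnset (1 + n + n) s \<and> colour s c" if "mnset (1 + n + n) s" for s
    using that colour_exists by blast
next
  fix s t c d
  assume *: "mnset (1 + n + n) s \<and> mnset (1 + n + n) t \<and> msame_nset (1 + n + n) s t \<and>
    (mnset (1 + n + n) s \<and> colour s c) \<and> mnset (1 + n + n) t \<and> colour t d"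
  then have same: "\<exists>v. mentry s i v \<and> mentry t i v" if "i < 1 + n + n" for i
    using that unfolding msame_nset_def by blast
  obtain m where "mentry s 0 m" "mentry t 0 m" using same[OF position_bounds(1)] by blast
  then show "c = d" using * same position_bounds colour_unique[of s c t d m] by blast
qed

end

section \<open>A homogeneous set\<close>

locale homogeneous_set = approximation +
  fixes H c0
  assumes H: "H \<in> sets" and infinite: "\<exists>x. m < x \<and> x \<in> H"
    and homogeneous: "mnset (1 + n + n) s \<Longrightarrow> (\<And>i. i < 1 + n + n \<Longrightarrow> \<exists>v. mentry s i v \<and> v \<in> H) \<Longrightarrow> colour s c0"
begin

definition increasing :: "mnat \<Rightarrow> mnat \<Rightarrow> mnat \<Rightarrow> bool" where
  "increasing k m t \<longleftrightarrow> (\<forall>j<k. \<exists>v. mentry t j v \<and> v \<in> H \<and> m < v) \<and>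
    (\<forall>i<k. \<forall>j<k. i < j \<longrightarrow> (\<exists>u v. mentry t i u \<and> mentry t j v \<and> u < v))"

lemma sigma1_increasing [sigma1_intros]: "dterm k \<Longrightarrow> dterm m \<Longrightarrow> dterm t \<Longrightarrow> sigma1 (\<lambda>e. increasing (k e) (m e) (t e))"
proof -
  assume *: "dterm k" "dterm m" "dterm t"
  have "sigma1 (\<lambda>e. increasing (e 0) (e (Suc 0)) (e (Suc (Suc 0))))"
    unfolding increasing_def by (intro sigma1_intros; intro sigma1_delta0 delta0_intros H)
  from sigma1_subst4[of "\<lambda>k m t _. increasing k m t", OF this *, of t] * show ?thesis by simp
qed

lemma increasing_entry: "increasing k m t \<Longrightarrow> j < k \<Longrightarrow> \<exists>v. mentry t j v \<and> v \<in> H \<and> m < v"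
  unfolding increasing_def by blast

lemma increasing_less:
  assumes "increasing k m t" "i < j" "j < k" "mentry t i u" "mentry t j v" shows "u < v"
proof -
  have "i < k" using assms(2,3) by (rule less_trans)
  then obtain u' v' where "mentry t i u'" "mentry t j v'" "u' < v'"
    using assms(1-3) unfolding increasing_def by blast
  then show ?thesis using assms(4,5) mentry_unique by blast
qed

text \<open>The number \<open>m'\<close> separates the parts: the entries of s do not exceed it, and
  those of t lie above it.\<close>

lemma increasing_append:
  assumes s: "increasing k m s" and t: "increasing l m' t"
    and le: "m \<le> m'" "\<And>i v. i < k \<Longrightarrow> mentry s i v \<Longrightarrow> v \<le> m'"
    and u: "\<And>i. i < k \<Longrightarrow> \<exists>v. mentry u i v \<and> mentry s i v"
      "\<And>i. i < l' \<Longrightarrow> \<exists>v. mentry u (k + i) v \<and> mentry t (i + b) v" and l: "l = b + l'"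
  shows "increasing (k + l') m u"
proof -
  have split: "i < k \<or> (\<exists>r<l'. i = k + r)" if "i < k + l'" for i
  proof (cases "i < k")
    case False
    then obtain r where "i = k + r" by (metis not_le mnat_leE)
    then show ?thesis using that by auto
  qed simp
  have tl: "r + b < l" if "r < l'" for r using that l by (simp add: add.commute)
  have low: "\<exists>v. mentry u i v \<and> mentry s i v \<and> v \<in> H \<and> m < v \<and> v \<le> m'" if "i < k" for i
    using u(1)[OF that] increasing_entry[OF s that] le(2)[OF that] mentry_unique by metis
  have high: "\<exists>v. mentry u (k + r) v \<and> mentry t (r + b) v \<and> v \<in> H \<and> m' < v" if "r < l'" for r
    using u(2)[OF that] increasing_entry[OF t tl[OF that]] mentry_unique by metis
  have "\<exists>v. mentry u i v \<and> v \<in> H \<and> m < v" if "i < k + l'" for i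
    using split[OF that] low high le(1) by (meson le_less_trans)
  moreover have "\<exists>v w. mentry u i v \<and> mentry u j w \<and> v < w" if ij: "i < k + l'" "j < k + l'" "i < j" for i j
  proof (cases "j < k")
    case True
    then have "i < k" using ij(3) less_trans by blast
    then show ?thesis using low[OF True] low[OF \<open>i < k\<close>] increasing_less[OF s ij(3) True] by blast
  next
    case False
    then obtain r where r: "r < l'" "j = k + r" using split[OF ij(2)] by blast
    show ?thesis
    proof (cases "i < k")
      case True
      then show ?thesis using low[OF True] high[OF r(1)] r(2) le_less_trans by blast
    next
      case False
      then obtain q where q: "q < l'" "i = k + q" using split[OF ij(1)] by blast
      then have "q + b < r + b" using ij(3) r by simp
      then show ?thesis
        using high[OF r(1)] high[OF q(1)] increasing_less[OF t _ tl[OF r(1)]] r(2) q(2) by blast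
    qed
  qed
  ultimately show ?thesis unfolding increasing_def by blast
qed

lemma singleton_code: "\<exists>s. mentry s 0 h"
proof -
  have "delta0 (\<lambda>e. e (Suc 0) = h)" by (intro delta0_intros)
  then show ?thesis using coding[of "\<lambda>i v. v = h" 1] zero_less_one by blast
qed

lemma increasing_singleton: "h \<in> H \<Longrightarrow> m < h \<Longrightarrow> mentry s 0 h \<Longrightarrow> increasing 1 m s"
proof -
  have "i = 0" if "i < 1" for i :: mnat using that PA(8)[of i 0] by simp
  then show "h \<in> H \<Longrightarrow> m < h \<Longrightarrow> mentry s 0 h \<Longrightarrow> increasing 1 m s"
    unfolding increasing_def by blast
qed

lemma increasing_exists: "\<exists>t. increasing k m t"
proof (induction k rule: sigma1_induct)
  case definable
  show ?case by (intro sigma1_intros; intro sigma1_delta0 delta0_intros)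
next
  case zero show ?case by (simp add: increasing_def)
next
  case (suc k)
  then obtain s where s: "increasing k m s" by blast
  \<comment> \<open>Entries never exceed their code, so h lies above all entries of s.\<close>
  obtain h where h: "m + s < h" "h \<in> H" using infinite by blast
  obtain t where t: "mentry t 0 h" using singleton_code by blast
  have "increasing 1 (m + s) t" using h t by (intro increasing_singleton)
  moreover obtain u where "\<forall>i<k. \<exists>v. mentry u i v \<and> mentry s i v" "\<forall>i<1. \<exists>v. mentry u (k + i) v \<and> mentry t (i + 0) v"
    using splice[of k s 1 t 0] increasing_entry[OF s] increasing_entry[OF calculation] by (metis add_0_right)
  moreover have "v \<le> m + s" if "mentry s i v" for i v
    using mentry_le[OF that] by (simp only: less_succ) (metis add.commute add_increasing2 zero_le)
  ultimately have "increasing (k + 1) m u" using s by (intro increasing_append[of k m s 1 "m + s" t u 1 0]) auto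
  then show ?case by blast
qed

lemma increasing_block: "increasing n m t \<Longrightarrow> block t 0"
  unfolding block_def add_0 using increasing_entry by blast

lemma increasing_le: "increasing k m t \<Longrightarrow> m' \<le> m \<Longrightarrow> increasing k m' t"
  unfolding increasing_def by (meson le_less_trans)

text \<open>Homogeneity is applied to the tuple formed by \<open>m\<close> and the entries of \<open>s\<close> and \<open>t\<close>.\<close>

lemma compare_patterns:
  assumes m: "m \<in> H" and s: "increasing n m s" and t: "increasing n (m + s) t"
    and p: "least_pattern m s 0 p" and q: "least_pattern m t 0 q"
  shows "p = q \<and> c0 = 0 \<or> q < p \<and> c0 = 1 \<or> p < q \<and> c0 = 1 + 1"
proof -
  obtain r where r: "mentry r 0 m" using singleton_code by blast
  have one: "i = 0" if "i < 1" for i :: mnat using that PA(8)[of i 0] by simp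
  obtain u where u: "\<forall>i<1. \<exists>v. mentry u i v \<and> mentry r i v" "\<forall>i<n. \<exists>v. mentry u (1 + i) v \<and> mentry s (i + 0) v"
    using splice[of 1 r n s 0] increasing_entry[OF s] r one by (metis add_0_right)
  have entries: "\<exists>v. mentry u i v \<and> v \<in> H \<and> v \<le> m + s" and
    inc: "i < j \<Longrightarrow> j < 1 + n \<Longrightarrow> \<exists>v w. mentry u i v \<and> mentry u j w \<and> v < w" if "i < 1 + n" for i j
  proof -
    have split: "i = 0 \<or> (\<exists>r<n. i = 1 + r)" if "i < 1 + n" for i
      using that mnat_cases[of i] by (auto simp: add.commute[of 1])
    have u0: "mentry u 0 m" using u(1) r mentry_unique zero_less_one by blast
    have uS: "\<exists>v. mentry u (1 + r) v \<and> mentry s r v \<and> v \<in> H \<and> m < v \<and> v \<le> m + s" if r: "r < n" for r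
    proof -
      obtain v where v: "mentry u (1 + r) v" "mentry s r v" using u(2) r by auto
      have "v \<le> s" using mentry_le[OF v(2)] by (simp only: less_succ)
      then have "v \<le> m + s" by (rule add_increasing[OF zero_le])
      then show ?thesis using v increasing_entry[OF s r] mentry_unique by metis
    qed
    show "\<exists>v. mentry u i v \<and> v \<in> H \<and> v \<le> m + s"
      using split[OF that] u0 uS m by (metis le_add_same_cancel1 zero_le)
    show "\<exists>v w. mentry u i v \<and> mentry u j w \<and> v < w" if ij: "i < j" "j < 1 + n"
    proof -
      obtain b where b: "b < n" "j = 1 + b" using split[OF ij(2)] ij(1) by auto
      show ?thesis
      proof (cases "i = 0")
        case True then show ?thesis using u0 uS[OF b(1)] b(2) by blast
      next
        case False
        then obtain a where a: "a < n" "i = 1 + a" using split[OF \<open>i < 1 + n\<close>] by blast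
        then have "a < b" using ij(1) b(2) by simp
        then show ?thesis using uS[OF a(1)] uS[OF b(1)] increasing_less[OF s _ b(1)] a(2) b(2) by blast
      qed
    qed
  qed
  \<comment> \<open>The entries of t lie above \<open>m + s\<close>, which bounds m and all entries
    of s, so the three parts follow one another in order.\<close>
  obtain w where w: "\<forall>i<1 + n. \<exists>v. mentry w i v \<and> mentry u i v"
      "\<forall>i<n. \<exists>v. mentry w (1 + n + i) v \<and> mentry t (i + 0) v"
    using splice[of "1 + n" u n t 0] increasing_entry[OF t] entries by (metis add_0_right)
  have split: "i < 1 + n \<or> (\<exists>r<n. i = 1 + n + r)" if "i < 1 + n + n" for i
  proof (cases "i < 1 + n")
    case False
    then obtain r where "i = 1 + n + r" by (metis not_le mnat_leE)
    then show ?thesis using that by auto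
  qed simp
  have low: "\<exists>v. mentry w i v \<and> mentry u i v \<and> v \<in> H \<and> v \<le> m + s" if "i < 1 + n" for i
    using w(1) entries[OF that] that mentry_unique by metis
  have high: "\<exists>v. mentry w (1 + n + r) v \<and> mentry t r v \<and> v \<in> H \<and> m + s < v" if r: "r < n" for r
  proof -
    obtain v where "mentry w (1 + n + r) v" "mentry t r v" using w(2) r by auto
    then show ?thesis using increasing_entry[OF t r] mentry_unique by metis
  qed
  have inH: "\<exists>v. mentry w i v \<and> v \<in> H" if "i < 1 + n + n" for i
    using split[OF that] low high by blast
  have "\<exists>x y. mentry w i x \<and> mentry w j y \<and> x < y" if ij: "i < 1 + n + n" "j < 1 + n + n" "i < j" for i j
  proof (cases "j < 1 + n")
    case True
    then have i: "i < 1 + n" using ij(3) less_trans by blast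
    show ?thesis using low[OF True] low[OF i] inc[OF i ij(3) True] mentry_unique by metis
  next
    case False
    then obtain b where b: "b < n" "j = 1 + n + b" using split[OF ij(2)] by blast
    show ?thesis
    proof (cases "i < 1 + n")
      case True
      then show ?thesis using low[OF True] high[OF b(1)] b(2) le_less_trans by blast
    next
      case False
      then obtain a where a: "a < n" "i = 1 + n + a" using split[OF ij(1)] by blast
      then have "a < b" using ij(3) b(2) by simp
      then show ?thesis using high[OF a(1)] high[OF b(1)] increasing_less[OF t _ b(1)] a(2) b(2) by blast
    qed
  qed
  then have "mnset (1 + n + n) w" unfolding mnset_def using inH mentry_le by metis
  then have c: "colour w c0" using inH by (rule homogeneous)
  have blocks: "block w 1" "block w (1 + n)" using mnset_blocks[OF \<open>mnset (1 + n + n) w\<close>] by blast+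
  have "\<exists>v. mentry s (0 + i) v \<and> mentry w (1 + i) v" if i: "i < n" for i
  proof -
    have "1 + i < 1 + n" using i by simp
    then obtain v where v: "mentry w (1 + i) v" "mentry u (1 + i) v" using w(1) by blast
    obtain v' where "mentry u (1 + i) v'" "mentry s i v'" using u(2) i by auto
    then show ?thesis using v mentry_unique by (metis add_0)
  qed
  from least_pattern_cong[OF p blocks(1) this] have p': "least_pattern m w 1 p" .
  have "\<exists>v. mentry t (0 + i) v \<and> mentry w (1 + n + i) v" if "i < n" for i
    using high[OF that] by auto
  from least_pattern_cong[OF q blocks(2) this] have q': "least_pattern m w (1 + n) q" .
  have "(0::mnat) < 1 + n" by (simp add: to_mint mint_nonneg add_nonneg_pos)
  then obtain v where "mentry w 0 v" "mentry u 0 v" using w(1) by blast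
  then have "mentry w 0 m" using u(1) r mentry_unique zero_less_one by metis
  then show ?thesis using c p' q' mentry_unique least_pattern_unique unfolding colour_def by metis
qed

text \<open>The next block is taken above s, but only that it lies above m is kept. It can then take
  the place of s, and the step can be repeated.\<close>

lemma next_block:
  assumes "m \<in> H" "increasing n m s" "least_pattern m s 0 p"
  shows "\<exists>t q. increasing n m t \<and> least_pattern m t 0 q \<and>
    (p = q \<and> c0 = 0 \<or> q < p \<and> c0 = 1 \<or> p < q \<and> c0 = 1 + 1)"
proof -
  obtain t where t: "increasing n (m + s) t" using increasing_exists by blast
  have "m \<le> m + s" by simp
  then have t': "increasing n m t" using t increasing_le by blast
  then obtain q where "least_pattern m t 0 q" using least_pattern_exists increasing_block by blast
  then show ?thesis using compare_patterns[OF assms(1,2) t assms(3)] t' by blast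
qed

text \<open>
  The patterns are natural numbers bounded in terms of \<open>m\<close>, so they can neither strictly
  decrease nor strictly increase along infinitely many blocks.
\<close>

lemma c0: "c0 = 0"
proof -
  obtain m where m: "m \<in> H" using infinite by blast
  obtain s where s: "increasing n m s" using increasing_exists by blast
  obtain U where U: "\<forall>t l. block t l \<longrightarrow> (\<exists>p<U. least_pattern m t l p)" using least_pattern_exists by blast
  obtain p where p: "least_pattern m s 0 p" using U increasing_block[OF s] by blast
  have "c0 \<noteq> 1"
  proof
    assume c: "c0 = 1"
    \<comment> \<open>Each step lowers the pattern by at least one, so k steps give
      \<open>q + k \<le> p\<close>, which is impossible for k = p + 1.\<close>
    have "\<exists>t q. increasing n m t \<and> least_pattern m t 0 q \<and> q + k \<le> p" for k
    proof (induction k rule: sigma1_induct)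
      case definable
      show ?case by (intro sigma1_intros; intro sigma1_delta0 delta0_intros)
    next
      case zero then show ?case using s p by auto
    next
      case (suc k)
      then obtain t q where t: "increasing n m t" "least_pattern m t 0 q" "q + k \<le> p" by blast
      obtain t' q' where t': "increasing n m t'" "least_pattern m t' 0 q'" "q' < q"
        using next_block[OF m t(1,2)] c by auto
      then have "q' + (k + 1) \<le> p" using t(3) by (simp add: to_mint)
      then show ?case using t' by blast
    qed
    from this[of "p + 1"] obtain q where "q + (p + 1) \<le> p" by blast
    then show False using mint_nonneg[of q] by (simp add: to_mint)
  qed
  moreover have "c0 \<noteq> 1 + 1"
  proof
    assume c: "c0 = 1 + 1"
    \<comment> \<open>Here k steps push the pattern up to at least k. At k = U this contradicts the
      existence of a least pattern below U.\<close>
    have "\<exists>t q. increasing n m t \<and> least_pattern m t 0 q \<and> k \<le> q" for k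
    proof (induction k rule: sigma1_induct)
      case definable
      show ?case by (intro sigma1_intros; intro sigma1_delta0 delta0_intros)
    next
      case zero then show ?case using s p by auto
    next
      case (suc k)
      then obtain t q where t: "increasing n m t" "least_pattern m t 0 q" "k \<le> q" by blast
      obtain t' q' where t': "increasing n m t'" "least_pattern m t' 0 q'" "q < q'"
        using next_block[OF m t(1,2)] c by auto
      then have "k + 1 \<le> q'" using t(3) by (simp add: to_mint)
      then show ?case using t' by blast
    qed
    from this[of U] obtain t q where t: "increasing n m t" "least_pattern m t 0 q" "U \<le> q" by blast
    then obtain q' where "q' < U" "least_pattern m t 0 q'" using U increasing_block by blast
    then show False using t least_pattern_unique by (metis not_le)
  qed
  ultimately show ?thesis using next_block[OF m s p] by blast
qed

text \<open>s and t may overlap and so cannot be compared directly. Each is compared with a third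
  block above both, and by \<open>c0\<close> the patterns agree.\<close>

lemma approx_stable:
  assumes m: "m \<in> H" and s: "increasing n m s" and t: "increasing n m t" and "j \<le> n" "x < m"
  shows "approx s 0 j x \<longleftrightarrow> approx t 0 j x"
proof -
  obtain u where u: "increasing n (m + s + t) u" using increasing_exists by blast
  have le: "m + s \<le> m + s + t" "m + t \<le> m + s + t" "m \<le> m + s + t"
    using mint_nonneg[of s] mint_nonneg[of t] by (simp_all add: to_mint)
  have *: "least_pattern m u 0 p" if "increasing n m r" "m + r \<le> m + s + t" "least_pattern m r 0 p" for r p
  proof -
    obtain q where "least_pattern m u 0 q"
      using least_pattern_exists increasing_block[OF increasing_le[OF u le(3)]] by blast
    then show ?thesis
      using compare_patterns[OF m that(1) increasing_le[OF u that(2)] that(3)] c0 by auto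
  qed
  obtain p q where p: "least_pattern m s 0 p" and q: "least_pattern m t 0 q"
    using least_pattern_exists increasing_block[OF s] increasing_block[OF t] by meson
  have "p = q" using *[OF s le(1) p] *[OF t le(2) q] by (rule least_pattern_unique)
  then show ?thesis using least_pattern_approx[OF p _ assms(4,5)] q by blast
qed

text \<open>i counts the jumps of X, while j counts down from n to the matching approximation. By
  \<open>limit_iff\<close>, every block above an element of H beyond x gives the same
  answer.\<close>

definition limit :: "mnat \<Rightarrow> mnat \<Rightarrow> bool" where
  "limit i x \<longleftrightarrow> (\<exists>j m t. i + j = n \<and> m \<in> H \<and> x < m \<and> increasing n m t \<and> approx t 0 j x)"

text \<open>The Sigma1 complement of \<open>limit\<close>, for comprehension. Beyond n there is no
  j, and \<open>limit\<close> is empty.\<close>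

definition nonlimit :: "mnat \<Rightarrow> mnat \<Rightarrow> bool" where
  "nonlimit i x \<longleftrightarrow> n < i \<or> (\<exists>j m t. i + j = n \<and> m \<in> H \<and> x < m \<and> increasing n m t \<and>
    (\<exists>K w. x < K \<and> run K t 0 w \<and> \<not> inrun w j x))"

lemma sigma1_limit [sigma1_intros]:
  assumes "dterm i" "dterm x"
  shows "sigma1 (\<lambda>e. limit (i e) (x e))" "sigma1 (\<lambda>e. nonlimit (i e) (x e))"
proof -
  have "sigma1 (\<lambda>e. limit (e 0) (e (Suc 0)))"
    unfolding limit_def approx_def by (intro sigma1_intros; intro sigma1_delta0 delta0_intros H)
  from sigma1_subst2[OF this assms] show "sigma1 (\<lambda>e. limit (i e) (x e))" .
  have "sigma1 (\<lambda>e. nonlimit (e 0) (e (Suc 0)))"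
    unfolding nonlimit_def by (intro sigma1_intros; intro sigma1_delta0 delta0_intros H)
  from sigma1_subst2[OF this assms] show "sigma1 (\<lambda>e. nonlimit (i e) (x e))" .
qed

text \<open>A block above both m and another bound \<open>m'\<close> is a block for each of them, so
  \<open>approx_stable\<close> links the two.\<close>

lemma limit_iff:
  assumes "i + j = n" "m \<in> H" "x < m" "increasing n m t"
  shows "limit i x \<longleftrightarrow> approx t 0 j x"
proof -
  have "approx t' 0 j x \<longleftrightarrow> approx t 0 j x" if t': "m' \<in> H" "x < m'" "increasing n m' t'" for m' t'
  proof -
    obtain u where u: "increasing n (m + m') u" using increasing_exists by blast
    have le: "m \<le> m + m'" "m' \<le> m + m'" using mint_nonneg[of m] mint_nonneg[of m'] by (simp_all add: to_mint)
    have "j \<le> n" using assms(1) less_eq_iff_add[of j n] by (auto simp: add.commute)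
    then show ?thesis
      using approx_stable[OF assms(2,4) increasing_le[OF u le(1)]] approx_stable[OF t'(1,3) increasing_le[OF u le(2)]]
        assms(3) t'(2) by blast
  qed
  moreover have "j' = j" if "i + j' = n" for j' using assms(1) that by auto
  ultimately show ?thesis unfolding limit_def using assms by blast
qed

lemma nonlimit_iff: "nonlimit i x \<longleftrightarrow> \<not> limit i x"
proof (cases "n < i")
  case True
  have "i + j \<noteq> n" for j using True mint_nonneg[of j] by (auto simp: to_mint)
  then show ?thesis using True unfolding nonlimit_def limit_def by blast
next
  case False
  then obtain j where j: "i + j = n" by (metis not_le mnat_leE)
  have "j \<le> n" using j less_eq_iff_add[of j n] by (auto simp: add.commute)
  have *: "(\<exists>K w. x < K \<and> run K t 0 w \<and> \<not> inrun w j x) \<longleftrightarrow> \<not> approx t 0 j x" if t: "increasing n m t" for m t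
  proof -
    obtain K w where r: "x + 1 \<le> K" "run K t 0 w" using block_run[OF increasing_block[OF t]] by blast
    then have "x < K" by (simp only: succ_le)
    then show ?thesis using approx_run[OF _ \<open>j \<le> n\<close>] r(2) by blast
  qed
  have unique: "j' = j" if "i + j' = n" for j' using j that by auto
  obtain m where m: "x < m" "m \<in> H" using infinite by blast
  obtain t where t: "increasing n m t" using increasing_exists by blast
  show ?thesis
  proof
    assume "nonlimit i x"
    then obtain m t where "m \<in> H" "x < m" "increasing n m t" "\<not> approx t 0 j x"
      unfolding nonlimit_def using False * unique by blast
    then show "\<not> limit i x" using limit_iff[OF j] by blast
  next
    assume "\<not> limit i x"
    then have "\<not> approx t 0 j x" using limit_iff[OF j m(2,1) t] by blast
    then show "nonlimit i x" unfolding nonlimit_def using j m t *[OF t] by blast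
  qed
qed

lemma limit_zero: "limit 0 x \<longleftrightarrow> x \<in> X"
proof -
  obtain m where m: "x < m" "m \<in> H" using infinite by blast
  obtain t where t: "increasing n m t" using increasing_exists by blast
  show ?thesis using limit_iff[of 0 n, OF _ m(2,1) t] approx_top[OF increasing_block[OF t]] by simp
qed

text \<open>The stages of u up to position j come from s and end with v; the later ones come from t,
  which starts above v. As a block above m, u decides \<open>limit (i + 1)\<close> at e. Its
  approximation \<open>j + 1\<close> uses only stages of t, a block above \<open>v \<in> H\<close>,
  and so equals \<open>limit i\<close> below v, which is all that \<open>theta e v\<close>
  consults.\<close>

lemma limit_stage:
  assumes "i < n" shows "\<exists>v. w \<le> v \<and> (limit (i + 1) e \<longleftrightarrow> theta e v {x. limit i x})"
proof -
  from assms obtain j where "n = i + (j + 1)" by (rule mnat_lessE)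
  then have j: "i + 1 + j = n" "i + (j + 1) = n" by (simp_all add: ac_simps)
  have "j < n" using j mint_nonneg[of i] by (simp add: to_mint)
  have jn: "j + 1 + i = n" using j by (simp add: ac_simps)
  obtain m where m: "e < m" "m \<in> H" using infinite by blast
  \<comment> \<open>Starting above \<open>m + w\<close> makes v larger than w and keeps the block
    above m.\<close>
  obtain s where s: "increasing n (m + w) s" using increasing_exists by blast
  obtain v where v: "mentry s j v" "v \<in> H" "m + w < v" using increasing_entry[OF s \<open>j < n\<close>] by blast
  have mv: "m \<le> v" "w \<le> v" using v(3) mint_nonneg[of w] mint_nonneg[of m] by (simp_all add: to_mint)
  obtain t where t: "increasing n v t" using increasing_exists by blast
  have j1: "i' < n" if "i' < j + 1" for i' using that \<open>j < n\<close> by (simp add: less_succ)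
  have s': "increasing (j + 1) m s"
  proof -
    have "increasing (j + 1) (m + w) s" using s j1 unfolding increasing_def by blast
    moreover have "m \<le> m + w" by simp
    ultimately show ?thesis by (rule increasing_le)
  qed
  have t_entries: "\<exists>v. mentry t (r + (j + 1)) v" if "r < i" for r
  proof -
    have "r + (j + 1) < n" using that jn by (simp add: to_mint)
    then show ?thesis using increasing_entry[OF t] by blast
  qed
  obtain u where u: "\<forall>i<j + 1. \<exists>v. mentry u i v \<and> mentry s i v"
      "\<forall>r<i. \<exists>v. mentry u (j + 1 + r) v \<and> mentry t (r + (j + 1)) v"
    using splice[of "j + 1" s i t "j + 1"] increasing_entry[OF s'] t_entries by blast
  have s_le: "x \<le> v" if "i' < j + 1" "mentry s i' x" for i' x
  proof (cases "i' = j")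
    case True then show ?thesis using that(2) v(1) mentry_unique by blast
  next
    case False
    then have "i' < j" using that(1) PA(8) by blast
    then show ?thesis using increasing_less[OF s _ \<open>j < n\<close> that(2) v(1)] less_imp_le by blast
  qed
  have "increasing (j + 1 + i) m u"
    by (rule increasing_append[OF s' t mv(1)]) (use s_le u jn in auto)
  then have inc: "increasing n m u" unfolding jn .
  have block: "block u 0" "block t 0" using inc t increasing_block by blast+
  have "mentry u (0 + j) v"
  proof -
    have "j < j + 1" by (simp only: less_succ order_refl)
    then show ?thesis using u(1) v(1) mentry_unique by (metis add_0)
  qed
  from approx_step[OF block(1) \<open>j < n\<close> this]
  have "approx u 0 j e \<longleftrightarrow> theta e v {z. approx u 0 (j + 1) z}" .
  moreover have "approx u 0 j e \<longleftrightarrow> limit (i + 1) e" using limit_iff[OF j(1) m(2,1) inc] by simp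
  moreover have "theta e v {z. approx u 0 (j + 1) z} \<longleftrightarrow> theta e v {z. limit i z}"
  proof (rule theta_local)
    fix z
    assume "z < v"
    have "j + 1 \<le> n" using \<open>j < n\<close> by (simp only: succ_le)
    moreover have "\<exists>x. mentry u (0 + i') x \<and> mentry t (0 + i') x" if "i' < n" "j + 1 \<le> i'" for i'
    proof -
      from that(2) obtain r where r: "i' = j + 1 + r" by (rule mnat_leE)
      then have "r < i" using that(1) jn by (simp add: to_mint)
      then show ?thesis using u(2) r by (metis add_0 add.commute)
    qed
    ultimately have "approx u 0 (j + 1) z \<longleftrightarrow> approx t 0 (j + 1) z"
      by (intro approx_cong block)
    also have "\<dots> \<longleftrightarrow> limit i z" using limit_iff[OF j(2) v(2) \<open>z < v\<close> t] by simp
    finally show "z \<in> {z. approx u 0 (j + 1) z} \<longleftrightarrow> z \<in> {z. limit i z}" by simp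
  qed
  ultimately show ?thesis using mv(2) by blast
qed

text \<open>A halting computation is found at some stage w, and \<open>limit_stage\<close> offers a
  v beyond it; conversely v itself is a witness of halting.\<close>

lemma limit_jump: "i < n \<Longrightarrow> limit (i + 1) e \<longleftrightarrow> mhalts {x. limit i x} e e"
  unfolding mhalts_iff_theta using limit_stage[of i _ e] theta_mono by meson

text \<open>A single comprehension collects all the jumps as sections of one set, which takes the
  place of an induction on their number.\<close>

lemma limit_set: "{z. \<exists>i x. z = mpair i x \<and> limit i x} \<in> sets"
proof (rule comprehension)
  show "sigma1 (\<lambda>e. \<exists>i x. e 0 = mpair i x \<and> limit i x)"
    by (intro sigma1_intros; intro sigma1_delta0 delta0_intros)
  have "sigma1 (\<lambda>e. \<forall>i<e 0 + 1. \<forall>x<e 0 + 1. e 0 \<noteq> mpair i x \<or> nonlimit i x)"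
    by (intro sigma1_intros; intro sigma1_delta0 delta0_intros)
  moreover have "(\<forall>i<z + 1. \<forall>x<z + 1. z \<noteq> mpair i x \<or> nonlimit i x) \<longleftrightarrow> \<not> (\<exists>i x. z = mpair i x \<and> limit i x)" for z
    unfolding nonlimit_iff less_succ using mpair_ge by blast
  ultimately show "sigma1 (\<lambda>e. \<not> (\<exists>i x. e 0 = mpair i x \<and> limit i x))" by simp
qed

lemma iterated_jump: "\<exists>Y\<in>sets. miterated_jump n X Y"
proof -
  let ?Z = "{z. \<exists>i x. z = mpair i x \<and> limit i x}"
  have Z: "mpair i x \<in> ?Z \<longleftrightarrow> limit i x" for i x by simp
  have sect: "{x. limit i x} \<in> sets" for i
  proof -
    have "delta0 (\<lambda>e. mpair i (e 0) \<in> ?Z)" by (intro delta0_intros limit_set)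
    then have "{x. mpair i x \<in> ?Z} \<in> sets" by (rule delta0_comprehension)
    then show ?thesis unfolding Z .
  qed
  have "miterated_jump n X {x. limit n x}"
    unfolding miterated_jump_def
  proof (rule bexI[OF _ limit_set], intro conjI allI impI)
    show "x \<in> X \<longleftrightarrow> mpair 0 x \<in> ?Z" for x unfolding Z limit_zero ..
    show "x \<in> {x. limit n x} \<longleftrightarrow> mpair n x \<in> ?Z" for x unfolding Z by simp
    show "\<exists>U\<in>sets. \<exists>V\<in>sets. (\<forall>x. x \<in> U \<longleftrightarrow> mpair i x \<in> ?Z) \<and> (\<forall>x. x \<in> V \<longleftrightarrow> mpair (i + 1) x \<in> ?Z) \<and>
        (\<forall>e. e \<in> V \<longleftrightarrow> mhalts U e e)" if "i < n" for i
      unfolding Z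
      by (rule bexI[where x = "{x. limit i x}"], rule bexI[where x = "{x. limit (i + 1) x}"],
          intro conjI allI) (simp, simp, simp add: limit_jump[OF that], rule sect, rule sect)
  qed
  then show ?thesis using sect by blast
qed

end

lemma iterated_jumps_exist:
  assumes RT: "\<And>n k. 0 < n \<Longrightarrow> 0 < k \<Longrightarrow> mRT n k" and X: "X \<in> sets"
  shows "\<exists>Y\<in>sets. miterated_jump n X Y"
proof -
  interpret approximation n X by standard (rule X)
  have "(0::mnat) < 1 + 1 + 1" by (simp add: to_mint)
  then have "mRT (1 + n + n) (1 + 1 + 1)" by (rule RT[OF position_bounds(1)])
  from mp[OF bspec[OF this[unfolded mRT_def] colouring_set] mcolouring] obtain H
    where H: "H \<in> sets" "\<forall>m. \<exists>x. m < x \<and> x \<in> H" "mhomogeneous (1 + n + n) colouring_set H"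
    by (elim bexE conjE)
  from H(3)[unfolded mhomogeneous_def] obtain c where c: "\<forall>s. mnset (1 + n + n) s \<and>
      (\<forall>i<1 + n + n. \<exists>v<s + 1. mentry s i v \<and> v \<in> H) \<longrightarrow> mpair s c \<in> colouring_set"
    by (elim exE)
  interpret homogeneous_set n X H c
  proof
    show "colour s c" if s: "mnset (1 + n + n) s" "\<And>i. i < 1 + n + n \<Longrightarrow> \<exists>v. mentry s i v \<and> v \<in> H" for s
    proof -
      have "\<forall>i<1 + n + n. \<exists>v<s + 1. mentry s i v \<and> v \<in> H" using s(2) mentry_le by blast
      then have "mpair s c \<in> colouring_set" using c s(1) by blast
      then show ?thesis unfolding mem_colouring_set by blast
    qed
    show "H \<in> sets" by (rule H(1))
    show "\<exists>x. m < x \<and> x \<in> H" for m using H(2) by blast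
  qed
  show ?thesis by (rule iterated_jump)
qed

theorem corollary2: "RCA0 \<turnstile> sentence (all_RT \<^bold>\<longrightarrow> ACA0')"
proof (rule ccontr)
  assume "\<not> RCA0 \<turnstile> sentence (all_RT \<^bold>\<longrightarrow> ACA0')"
  moreover have "basic_axioms \<subseteq> RCA0" by (auto simp: RCA0_def)
  ultimately obtain M :: "mnat model" where "is_model M RCA0" "refutes M"
    unfolding refutes_def using completeness by blast
  then have "refutes the_model" by (rule the_model_refutes)
  moreover have "(\<forall>n k. 0 < n \<and> 0 < k \<longrightarrow> mRT n k) \<longrightarrow> (\<forall>n. \<forall>X\<in>sets. \<exists>Y\<in>sets. miterated_jump n X Y)"
    using iterated_jumps_exist by simp
  ultimately show False
    unfolding refutes_def sat_all_RT_ACA0' by simp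
qed

end
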